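(* Let $M$ be a complete, oriented, minimal submanifold, of dimension $m$, of the unit sphere $S^{k-1}\subseteq\mathbb{R}^k$, and suppose that its second Gauss map $M\to \widetilde{G}_{n,k-n}$, where $n=k-1-m$, is a bounded embedding. Then $\mathrm{Ric} < m-1$. Furthermore, $M$ is compact if and only if $$\sup \mathrm{Ric} < m-1 .$$
   Context: $M$ carries the Riemannian metric induced from the unit sphere, and completeness refers to this metric. $\mathrm{Ric}$ is the Ricci curvature of $M$. $\mathrm{Ric}<m-1$ means $\mathrm{Ric}(X,X)<m-1$ for every unit tangent vector $X$ of $M$, and $\sup \mathrm{Ric}$ is the supremum of $\mathrm{Ric}(X,X)$ over all unit tangent vectors $X$ of $M$. $\widetilde{G}_{n,r}$ is the oriented Grassmannian of oriented $n$-planes (through the origin) in $\mathbb{R}^{n+r}$. Second Gauss map: fix an orientation of $N=S^{k-1}$. Let $Z_1,\dots,Z_m,V_1,\dots,V_n$ be a local oriented orthonormal frame for $N$ along $M$, with $Z_1,\dots,Z_m$ a local oriented frame for $M$ (so $V_1,\dots,V_n$ are tangent to $N$ and normal to $M$). The second Gauss map sends $p\in M$ to the $n$-plane $\mathrm{span}\{V_1(p),\dots,V_n(p)\}\subseteq\mathbb{R}^k$ with the orientation given by $V_1\wedge\cdots\wedge V_n$; it is independent of the choice of frame. The canonical Riemannian metric $g_c$ on $\widetilde{G}_{n,r}$ is determined as follows. For $P,Q\in\widetilde{G}_{n,r}$ with oriented orthonormal bases $\xi_1,\dots,\xi_n$ of $P$ and $\zeta_1,\dots,\zeta_n$ of $Q$,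 let $\alpha_{ij}=\langle \xi_i,\zeta_j\rangle$ and let $\lambda_1^2,\dots,\lambda_n^2$ (with $0\le\lambda_i\le 1$) be the eigenvalues of $\alpha\alpha^{T}$. Put $d_c(P,Q)=\sqrt{\sum_{i=1}^n \arccos^2\lambda_i}$. Then $g_c(X,X)=\left(\frac{d}{dt}\big|_{t=0^+} d_c(x(0),x(t))\right)^2$ for any smooth path $x(t)$ in $\widetilde{G}_{n,r}$ with $\dot x(0)=X$. A bounded embedding into $\widetilde{G}_{n,r}$ is a smooth embedding whose image $\mathcal{I}$ is bounded with respect to the metric on $\mathcal{I}$ induced from the canonical metric $g_c$. That is, with the Riemannian metric on the submanifold $\mathcal{I}$ obtained by restricting $g_c$, the distance between two points of $\mathcal{I}$, defined as the infimum of the lengths of piecewise smooth curves lying in $\mathcal{I}$ joining them, is bounded by a finite constant independent of the two points. *)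

theory Defs
  imports
    "HOL-Analysis.Analysis"
    "Jordan_Normal_Form.Char_Poly"
begin

text \<open>
  A manifold \<open>M\<close> immersed in a Euclidean space is given by a topology \<open>T\<close> (the space \<open>M\<close>) and a
  map \<open>f\<close> on \<open>topspace T\<close> (the immersion); an embedded submanifold \<open>S\<close> is the case
  \<open>T = top_of_set S\<close>, \<open>f = id\<close>. The smooth structure of \<open>M\<close> is the one that makes \<open>f\<close> an
  immersion. Tangent vectors of \<open>M\<close> are identified with their images under the differential of
  \<open>f\<close>, so that the Riemannian metric induced by \<open>f\<close> is the ambient inner product.
\<close>

section \<open>Smooth maps and immersed submanifolds\<close>

primrec Ck_on :: "nat \<Rightarrow> 'a::euclidean_space set \<Rightarrow> ('a \<Rightarrow> 'b::euclidean_space) \<Rightarrow> bool" where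
  "Ck_on 0 S g \<longleftrightarrow> continuous_on S g"
| "Ck_on (Suc r) S g \<longleftrightarrow>
     (\<forall>x\<in>S. g differentiable (at x)) \<and> (\<forall>v. Ck_on r S (\<lambda>x. frechet_derivative g (at x) v))"

text \<open>Used for open \<open>S\<close> only.\<close>

definition Cinf_on :: "'a::euclidean_space set \<Rightarrow> ('a \<Rightarrow> 'b::euclidean_space) \<Rightarrow> bool" where
  "Cinf_on S g \<longleftrightarrow> (\<forall>r. Ck_on r S g)"

text \<open>
  A map on \<open>M\<close> is smooth if it is locally the restriction of a smooth map of the ambient space.
  For \<open>T = top_of_set {a..b}\<close> and \<open>f = id\<close> this is smoothness up to the end points of an interval.
\<close>

definition smooth_map ::
  "'a topology \<Rightarrow> ('a \<Rightarrow> 'e::euclidean_space) \<Rightarrow> ('a \<Rightarrow> 'b::euclidean_space) \<Rightarrow> bool" where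
  "smooth_map T f h \<longleftrightarrow>
     (\<forall>p\<in>topspace T. \<exists>U W H. openin T U \<and> p \<in> U \<and> open W \<and> f ` U \<subseteq> W \<and> Cinf_on W H \<and>
        (\<forall>q\<in>U. h q = H (f q)))"

definition embedded_submanifold :: "nat \<Rightarrow> 'e::euclidean_space set \<Rightarrow> bool" where
  "embedded_submanifold m S \<longleftrightarrow>
     (\<forall>p\<in>S. \<exists>U V \<phi> \<psi> (L :: 'e set). open U \<and> p \<in> U \<and> open V \<and> homeomorphism U V \<phi> \<psi> \<and>
        Cinf_on U \<phi> \<and> Cinf_on V \<psi> \<and>
        subspace L \<and> dim L = m \<and> \<phi> ` (U \<inter> S) = V \<inter> L)"

definition immersed_submanifold :: "nat \<Rightarrow> 'a topology \<Rightarrow> ('a \<Rightarrow> 'e::euclidean_space) \<Rightarrow> bool" where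
  "immersed_submanifold m T f \<longleftrightarrow>
     Hausdorff_space T \<and> second_countable T \<and>
     (\<forall>p\<in>topspace T. \<exists>U. openin T U \<and> p \<in> U \<and>
        embedding_map (subtopology T U) euclidean f \<and> embedded_submanifold m (f ` U))"

definition smooth_curve ::
  "'a topology \<Rightarrow> ('a \<Rightarrow> 'e::euclidean_space) \<Rightarrow> real set \<Rightarrow> (real \<Rightarrow> 'a) \<Rightarrow> bool" where
  "smooth_curve T f J c \<longleftrightarrow>
     continuous_map (top_of_set J) T c \<and> smooth_map (top_of_set J) id (f \<circ> c)"

definition curve_through ::
  "'a topology \<Rightarrow> ('a \<Rightarrow> 'e::euclidean_space) \<Rightarrow> 'a \<Rightarrow> 'e \<Rightarrow> (real \<Rightarrow> 'a) \<Rightarrow> bool" where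
  "curve_through T f p v c \<longleftrightarrow>
     (\<exists>\<epsilon>>0. smooth_curve T f {-\<epsilon>..\<epsilon>} c) \<and> c 0 = p \<and> ((f \<circ> c) has_vector_derivative v) (at 0)"

definition tangent_space :: "'a topology \<Rightarrow> ('a \<Rightarrow> 'e::euclidean_space) \<Rightarrow> 'a \<Rightarrow> 'e set" where
  "tangent_space T f p = {v. \<exists>c. curve_through T f p v c}"

definition tangent_field ::
  "'a topology \<Rightarrow> ('a \<Rightarrow> 'e::euclidean_space) \<Rightarrow> 'a set \<Rightarrow> ('a \<Rightarrow> 'e) \<Rightarrow> bool" where
  "tangent_field T f U Y \<longleftrightarrow>
     smooth_map (subtopology T U) f Y \<and> (\<forall>q\<in>U. Y q \<in> tangent_space T f q)"

text \<open>The derivative of \<open>h\<close> (defined near \<open>p\<close>) in the direction of the tangent vector \<open>v\<close>.\<close>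

definition dir_deriv ::
  "'a topology \<Rightarrow> ('a \<Rightarrow> 'e::euclidean_space) \<Rightarrow> ('a \<Rightarrow> 'b::euclidean_space) \<Rightarrow> 'a \<Rightarrow> 'e \<Rightarrow> 'b" where
  "dir_deriv T f h p v =
     (THE w. \<forall>c. curve_through T f p v c \<longrightarrow> ((h \<circ> c) has_vector_derivative w) (at 0))"

section \<open>Intrinsic distance and completeness\<close>

definition subdivided :: "(real set \<Rightarrow> bool) \<Rightarrow> bool" where
  "subdivided Q \<longleftrightarrow>
     (\<exists>N (s :: nat \<Rightarrow> real). s 0 = 0 \<and> s N = 1 \<and> (\<forall>i<N. s i < s (Suc i) \<and> Q {s i..s (Suc i)}))"

definition pw_smooth_curve ::
  "'a topology \<Rightarrow> ('a \<Rightarrow> 'e::euclidean_space) \<Rightarrow> (real \<Rightarrow> 'a) \<Rightarrow> bool" where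
  "pw_smooth_curve T f c \<longleftrightarrow> subdivided (\<lambda>J. smooth_curve T f J c)"

definition curve_length :: "('a \<Rightarrow> 'e::euclidean_space) \<Rightarrow> (real \<Rightarrow> 'a) \<Rightarrow> real" where
  "curve_length f c = integral {0..1} (\<lambda>t. norm (vector_derivative (f \<circ> c) (at t)))"

definition riem_dist :: "'a topology \<Rightarrow> ('a \<Rightarrow> 'e::euclidean_space) \<Rightarrow> 'a \<Rightarrow> 'a \<Rightarrow> ereal" where
  "riem_dist T f p q =
     (INF c \<in> {c. pw_smooth_curve T f c \<and> c 0 = p \<and> c 1 = q}. ereal (curve_length f c))"

definition riem_complete :: "'a topology \<Rightarrow> ('a \<Rightarrow> 'e::euclidean_space) \<Rightarrow> bool" where
  "riem_complete T f \<longleftrightarrow>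
     (\<forall>\<sigma> :: nat \<Rightarrow> 'a. range \<sigma> \<subseteq> topspace T \<and>
        (\<forall>\<epsilon>>0. \<exists>N. \<forall>i\<ge>N. \<forall>j\<ge>N. riem_dist T f (\<sigma> i) (\<sigma> j) < ereal \<epsilon>) \<longrightarrow>
        (\<exists>p\<in>topspace T. (\<lambda>i. riem_dist T f (\<sigma> i) p) \<longlonglongrightarrow> 0))"

section \<open>Orthonormal frames and orthogonal projection\<close>

text \<open>
  An orthonormal \<open>n\<close>-frame is a sequence vanishing from index \<open>n\<close> on. The product topology on
  sequences induces the usual topology on the set of frames.
\<close>

definition stiefel :: "nat \<Rightarrow> (nat \<Rightarrow> 'e::euclidean_space) set" where
  "stiefel n = {\<xi>. (\<forall>i<n. \<forall>j<n. \<xi> i \<bullet> \<xi> j = (if i = j then 1 else 0)) \<and> (\<forall>i\<ge>n. \<xi> i = 0)}"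

definition orthonormal_basis :: "nat \<Rightarrow> 'e::euclidean_space set \<Rightarrow> (nat \<Rightarrow> 'e) \<Rightarrow> bool" where
  "orthonormal_basis n L \<xi> \<longleftrightarrow> \<xi> \<in> stiefel n \<and> span (\<xi> ` {..<n}) = L"

definition orth_proj :: "'e::euclidean_space set \<Rightarrow> 'e \<Rightarrow> 'e" where
  "orth_proj L v = (THE u. u \<in> L \<and> v - u \<in> orthogonal_comp L)"

section \<open>Levi-Civita connection and Ricci curvature\<close>

text \<open>With vector fields viewed as maps into the ambient space, \<open>[X, Y] = D\<^sub>X Y - D\<^sub>Y X\<close>.\<close>

definition lie_bracket ::
  "'a topology \<Rightarrow> ('a \<Rightarrow> 'e::euclidean_space) \<Rightarrow> ('a \<Rightarrow> 'e) \<Rightarrow> ('a \<Rightarrow> 'e) \<Rightarrow> 'a \<Rightarrow> 'e" where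
  "lie_bracket T f X Y p = dir_deriv T f Y p (X p) - dir_deriv T f X p (Y p)"

text \<open>The Levi-Civita connection of the induced metric, determined by the Koszul formula.\<close>

definition levi_civita ::
  "'a topology \<Rightarrow> ('a \<Rightarrow> 'e::euclidean_space) \<Rightarrow> ('a \<Rightarrow> 'e) \<Rightarrow> ('a \<Rightarrow> 'e) \<Rightarrow> 'a \<Rightarrow> 'e" where
  "levi_civita T f X Y p =
     (THE w. w \<in> tangent_space T f p \<and>
        (\<forall>U Z. openin T U \<and> p \<in> U \<and> tangent_field T f U Z \<longrightarrow>
           2 * (w \<bullet> Z p) =
             dir_deriv T f (\<lambda>q. Y q \<bullet> Z q) p (X p)
           + dir_deriv T f (\<lambda>q. Z q \<bullet> X q) p (Y p)
           - dir_deriv T f (\<lambda>q. X q \<bullet> Y q) p (Z p)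
           + lie_bracket T f X Y p \<bullet> Z p
           - lie_bracket T f X Z p \<bullet> Y p
           - lie_bracket T f Y Z p \<bullet> X p))"

text \<open>\<open>R(x,y)z = \<nabla>\<^sub>X \<nabla>\<^sub>Y Z - \<nabla>\<^sub>Y \<nabla>\<^sub>X Z - \<nabla>\<^bsub>[X,Y]\<^esub> Z\<close> for any local fields extending \<open>x, y, z\<close>.\<close>

definition riem_curvature ::
  "'a topology \<Rightarrow> ('a \<Rightarrow> 'e::euclidean_space) \<Rightarrow> 'a \<Rightarrow> 'e \<Rightarrow> 'e \<Rightarrow> 'e \<Rightarrow> 'e" where
  "riem_curvature T f p x y z =
     (THE w. \<forall>U X Y Z. openin T U \<and> p \<in> U \<and>
        tangent_field T f U X \<and> tangent_field T f U Y \<and> tangent_field T f U Z \<and>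
        X p = x \<and> Y p = y \<and> Z p = z \<longrightarrow>
        w = levi_civita T f X (levi_civita T f Y Z) p
          - levi_civita T f Y (levi_civita T f X Z) p
          - levi_civita T f (lie_bracket T f X Y) Z p)"

definition ricci ::
  "nat \<Rightarrow> 'a topology \<Rightarrow> ('a \<Rightarrow> 'e::euclidean_space) \<Rightarrow> 'a \<Rightarrow> 'e \<Rightarrow> 'e \<Rightarrow> real" where
  "ricci m T f p x y =
     (let e = (SOME e. orthonormal_basis m (tangent_space T f p) e)
      in \<Sum>i<m. riem_curvature T f p (e i) x y \<bullet> e i)"

section \<open>Minimal submanifolds of the unit sphere\<close>

text \<open>
  The Levi-Civita connection of the unit sphere is the part of the ambient derivative tangent to
  the sphere, so the second fundamental form of \<open>M\<close> in the sphere is the component of the ambient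
  derivative of a tangent field that is orthogonal both to \<open>f p\<close> and to the tangent space of \<open>M\<close>.
\<close>

definition sphere_normal_space :: "'a topology \<Rightarrow> ('a \<Rightarrow> 'e::euclidean_space) \<Rightarrow> 'a \<Rightarrow> 'e set" where
  "sphere_normal_space T f p = orthogonal_comp (insert (f p) (tangent_space T f p))"

definition second_fundamental_form ::
  "'a topology \<Rightarrow> ('a \<Rightarrow> 'e::euclidean_space) \<Rightarrow> 'a \<Rightarrow> 'e \<Rightarrow> 'e \<Rightarrow> 'e" where
  "second_fundamental_form T f p x y =
     (THE w. \<forall>U Y. openin T U \<and> p \<in> U \<and> tangent_field T f U Y \<and> Y p = y \<longrightarrow>
        w = orth_proj (sphere_normal_space T f p) (dir_deriv T f Y p x))"

definition minimal_in_sphere :: "nat \<Rightarrow> 'a topology \<Rightarrow> ('a \<Rightarrow> 'e::euclidean_space) \<Rightarrow> bool" where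
  "minimal_in_sphere m T f \<longleftrightarrow>
     (\<forall>p\<in>topspace T.
        let e = (SOME e. orthonormal_basis m (tangent_space T f p) e)
        in (\<Sum>i<m. second_fundamental_form T f p (e i) (e i)) = 0)"

section \<open>The oriented Grassmannian\<close>

definition gram_mat :: "nat \<Rightarrow> (nat \<Rightarrow> 'e::euclidean_space) \<Rightarrow> (nat \<Rightarrow> 'e) \<Rightarrow> real Matrix.mat" where
  "gram_mat n \<xi> \<zeta> = Matrix.mat n n (\<lambda>(i, j). \<xi> i \<bullet> \<zeta> j)"

text \<open>
  An oriented \<open>n\<close>-plane is the set of its positively oriented orthonormal bases. (A \<open>0\<close>-plane has
  only the empty basis, hence a single orientation.)
\<close>

definition oriented_span :: "nat \<Rightarrow> (nat \<Rightarrow> 'e::euclidean_space) \<Rightarrow> (nat \<Rightarrow> 'e) set" where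
  "oriented_span n \<xi> =
     {\<zeta> \<in> stiefel n. span (\<zeta> ` {..<n}) = span (\<xi> ` {..<n}) \<and> Determinant.det (gram_mat n \<xi> \<zeta>) > 0}"

definition oriented_grassmannian :: "nat \<Rightarrow> (nat \<Rightarrow> 'e::euclidean_space) set set" where
  "oriented_grassmannian n = oriented_span n ` stiefel n"

definition plane :: "(nat \<Rightarrow> 'e::euclidean_space) set \<Rightarrow> 'e set" where
  "plane P = span (\<Union>\<xi>\<in>P. range \<xi>)"

text \<open>The quotient topology.\<close>

definition grassmannian_topology :: "nat \<Rightarrow> (nat \<Rightarrow> 'e::euclidean_space) set topology" where
  "grassmannian_topology n =
     topology (\<lambda>G. G \<subseteq> oriented_grassmannian n \<and>
       openin (top_of_set (stiefel n)) {\<xi> \<in> stiefel n. oriented_span n \<xi> \<in> G})"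

lemma openin_grassmannian_topology:
  fixes G :: "(nat \<Rightarrow> 'e::euclidean_space) set set"
  shows "openin (grassmannian_topology n) G \<longleftrightarrow>
     G \<subseteq> oriented_grassmannian n \<and>
     openin (top_of_set (stiefel n)) {\<xi> \<in> stiefel n. oriented_span n \<xi> \<in> G}"
proof -
  let ?pre = "\<lambda>G :: (nat \<Rightarrow> 'e) set set. {\<xi> \<in> stiefel n. oriented_span n \<xi> \<in> G}"
  have inter: "?pre (G \<inter> H) = ?pre G \<inter> ?pre H" for G H
    by auto
  have union: "?pre (\<Union>K) = \<Union>(?pre ` K)" for K
    by auto
  have "istopology (\<lambda>G. G \<subseteq> oriented_grassmannian n \<and> openin (top_of_set (stiefel n)) (?pre G))"
    unfolding istopology_def inter union by (auto intro!: openin_Int openin_Union)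
  then show ?thesis
    by (simp add: grassmannian_topology_def topology_inverse')
qed

text \<open>
  Smoothness into the quotient of the Stiefel manifold by \<open>SO(n)\<close>: the map has smooth local lifts
  to orthonormal frames.
\<close>

definition smooth_grassmannian_map ::
  "nat \<Rightarrow> 'a topology \<Rightarrow> ('a \<Rightarrow> 'd::euclidean_space) \<Rightarrow> ('a \<Rightarrow> (nat \<Rightarrow> 'e::euclidean_space) set) \<Rightarrow> bool"
  where
  "smooth_grassmannian_map n T f \<nu> \<longleftrightarrow>
     (\<forall>p\<in>topspace T. \<nu> p \<in> oriented_grassmannian n) \<and>
     (\<forall>p\<in>topspace T. \<exists>U \<xi>. openin T U \<and> p \<in> U \<and>
        (\<forall>i<n. smooth_map (subtopology T U) f (\<lambda>q. \<xi> q i)) \<and> (\<forall>q\<in>U. \<xi> q \<in> \<nu> q))"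

text \<open>
  The tangent space of the Grassmannian at \<open>P\<close> is identified with the linear maps from \<open>P\<close> to its
  orthogonal complement: the velocity of \<open>\<gamma>\<close> at \<open>t\<close> sends \<open>\<xi>\<^sub>i(t)\<close> to the component of \<open>\<xi>\<^sub>i'(t)\<close>
  orthogonal to \<open>\<gamma>(t)\<close>, for any smooth lift \<open>\<xi>\<close> of \<open>\<gamma>\<close> to orthonormal frames. (The maps are
  extended by zero to the complement of \<open>P\<close>.)
\<close>

definition grassmannian_velocity ::
  "nat \<Rightarrow> (real \<Rightarrow> (nat \<Rightarrow> 'e::euclidean_space) set) \<Rightarrow> real \<Rightarrow> 'e \<Rightarrow> 'e" where
  "grassmannian_velocity n \<gamma> t =
     (THE A. \<forall>\<epsilon> \<xi>. \<epsilon> > 0 \<and>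
        (\<forall>i<n. smooth_map (top_of_set {t-\<epsilon>..t+\<epsilon>}) id (\<lambda>s. \<xi> s i)) \<and>
        (\<forall>s\<in>{t-\<epsilon>..t+\<epsilon>}. \<xi> s \<in> \<gamma> s) \<longrightarrow>
        A = (\<lambda>v. \<Sum>i<n. (v \<bullet> \<xi> t i) *\<^sub>R
               orth_proj (orthogonal_comp (plane (\<gamma> t))) (vector_derivative (\<lambda>s. \<xi> s i) (at t))))"

definition smooth_grassmannian_embedding ::
  "nat \<Rightarrow> 'a topology \<Rightarrow> ('a \<Rightarrow> 'd::euclidean_space) \<Rightarrow> ('a \<Rightarrow> (nat \<Rightarrow> 'e::euclidean_space) set) \<Rightarrow> bool"
  where
  "smooth_grassmannian_embedding n T f \<nu> \<longleftrightarrow>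
     smooth_grassmannian_map n T f \<nu> \<and>
     (\<forall>p\<in>topspace T. \<forall>v c. v \<noteq> 0 \<and> curve_through T f p v c \<longrightarrow>
        grassmannian_velocity n (\<nu> \<circ> c) 0 \<noteq> (\<lambda>_. 0)) \<and>
     embedding_map T (grassmannian_topology n) \<nu>"

section \<open>The canonical metric of the Grassmannian\<close>

definition d_c ::
  "nat \<Rightarrow> (nat \<Rightarrow> 'e::euclidean_space) set \<Rightarrow> (nat \<Rightarrow> 'e) set \<Rightarrow> real" where
  "d_c n P Q =
     (THE d. \<exists>\<xi>\<in>P. \<exists>\<zeta>\<in>Q. \<exists>\<mu>::nat \<Rightarrow> real.
        let \<alpha> = gram_mat n \<xi> \<zeta> in
        (\<forall>i<n. 0 \<le> \<mu> i \<and> \<mu> i \<le> 1) \<and>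
        char_poly (\<alpha> * transpose_mat \<alpha>) = (\<Prod>i<n. [:- ((\<mu> i)\<^sup>2), 1:]) \<and>
        d = sqrt (\<Sum>i<n. (arccos (\<mu> i))\<^sup>2))"

text \<open>\<open>g_speed n \<gamma> t\<close> is the norm of the velocity of \<open>\<gamma>\<close> at \<open>t\<close> with respect to the metric \<open>g\<^sub>c\<close>.\<close>

definition g_speed :: "nat \<Rightarrow> (real \<Rightarrow> (nat \<Rightarrow> 'e::euclidean_space) set) \<Rightarrow> real \<Rightarrow> real" where
  "g_speed n \<gamma> t = vector_derivative (\<lambda>s. d_c n (\<gamma> t) (\<gamma> s)) (at_right t)"

definition g_length :: "nat \<Rightarrow> (real \<Rightarrow> (nat \<Rightarrow> 'e::euclidean_space) set) \<Rightarrow> real" where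
  "g_length n \<gamma> = integral {0..1} (g_speed n \<gamma>)"

definition pw_smooth_grassmannian_curve ::
  "nat \<Rightarrow> (real \<Rightarrow> (nat \<Rightarrow> 'e::euclidean_space) set) \<Rightarrow> bool" where
  "pw_smooth_grassmannian_curve n \<gamma> \<longleftrightarrow>
     subdivided (\<lambda>J. smooth_grassmannian_map n (top_of_set J) id \<gamma>)"

definition induced_dist ::
  "nat \<Rightarrow> (nat \<Rightarrow> 'e::euclidean_space) set set \<Rightarrow> (nat \<Rightarrow> 'e) set \<Rightarrow> (nat \<Rightarrow> 'e) set \<Rightarrow> ereal" where
  "induced_dist n I P Q =
     (INF \<gamma> \<in> {\<gamma>. pw_smooth_grassmannian_curve n \<gamma> \<and> \<gamma> ` {0..1} \<subseteq> I \<and> \<gamma> 0 = P \<and> \<gamma> 1 = Q}.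
        ereal (g_length n \<gamma>))"

definition bounded_grassmannian_embedding ::
  "nat \<Rightarrow> 'a topology \<Rightarrow> ('a \<Rightarrow> 'd::euclidean_space) \<Rightarrow> ('a \<Rightarrow> (nat \<Rightarrow> 'e::euclidean_space) set) \<Rightarrow> bool"
  where
  "bounded_grassmannian_embedding n T f \<nu> \<longleftrightarrow>
     smooth_grassmannian_embedding n T f \<nu> \<and>
     (\<exists>C::real. \<forall>P \<in> \<nu> ` topspace T. \<forall>Q \<in> \<nu> ` topspace T.
        induced_dist n (\<nu> ` topspace T) P Q \<le> ereal C)"

section \<open>Orientations and the second Gauss map\<close>

text \<open>An orientation assigns to each point its oriented tangent plane, in a smooth way.\<close>

definition orientation ::
  "nat \<Rightarrow> 'a topology \<Rightarrow> ('a \<Rightarrow> 'e::euclidean_space) \<Rightarrow> ('a \<Rightarrow> (nat \<Rightarrow> 'e) set) \<Rightarrow> bool" where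
  "orientation m T f \<tau> \<longleftrightarrow>
     smooth_grassmannian_map m T f \<tau> \<and> (\<forall>p\<in>topspace T. plane (\<tau> p) = tangent_space T f p)"

text \<open>
  \<open>\<tau>\<close> is the orientation of \<open>M\<close> and \<open>\<omega>\<close> the orientation of the sphere. The value at \<open>p\<close> consists of
  the \<open>V\<close> such that \<open>Z\<^sub>1, \<dots>, Z\<^sub>m, V\<^sub>1, \<dots>, V\<^sub>n\<close> is positively oriented for some positively
  oriented \<open>Z\<close>.
\<close>

definition second_gauss_map ::
  "nat \<Rightarrow> nat \<Rightarrow> ('a \<Rightarrow> 'e::euclidean_space) \<Rightarrow> ('a \<Rightarrow> (nat \<Rightarrow> 'e) set) \<Rightarrow> ('e \<Rightarrow> (nat \<Rightarrow> 'e) set)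
     \<Rightarrow> 'a \<Rightarrow> (nat \<Rightarrow> 'e) set" where
  "second_gauss_map m n f \<tau> \<omega> p =
     {V \<in> stiefel n. \<exists>Z \<in> \<tau> p. (\<lambda>i. if i < m then Z i else V (i - m)) \<in> \<omega> (f p)}"

end

theory Submission
  imports Defs "Jordan_Normal_Form.Schur_Decomposition"
begin

text \<open>
  Let \<open>E\<^sub>1, \<dots>, E\<^sub>m, V\<^sub>1, \<dots>, V\<^sub>n\<close> be a local orthonormal frame of the sphere along \<open>M\<close>, the \<open>E\<^sub>a\<close> tangent
  and the \<open>V\<^sub>j\<close> normal to \<open>M\<close>, and let \<open>B\<^sub>j\<close> be the component of the second fundamental form along \<open>V\<^sub>j\<close>.
  The Gauss equation in the unit sphere, summed over \<open>E\<^sub>a\<close>, contains the traces of the \<open>B\<^sub>j\<close>, which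
  vanish by minimality, so \<open>Ric(X,X) = m - 1 - \<Sum>\<^sub>j\<^sub>a B\<^sub>j(X,E\<^sub>a)\<^sup>2\<close> for unit vectors \<open>X\<close> (\<open>ricci_minimal\<close>).

  The Gauss map \<open>\<nu>\<close> sends a point to the plane spanned by the \<open>V\<^sub>j\<close>. In the direction \<open>X\<close>, the part of
  \<open>D\<^sub>X V\<^sub>j\<close> orthogonal to this plane is tangent to \<open>M\<close> and has the components \<open>- B\<^sub>j(X,E\<^sub>a)\<close>. As the
  canonical metric is the Hilbert-Schmidt norm of this velocity (\<open>g_speed_eq_frame_speed\<close>), the
  curvature formula says \<open>Ric(X,X) = m - 1 - \<bar>d\<nu>(X)\<bar>\<^sup>2\<close>. Hence \<open>Ric < m - 1\<close> since \<open>\<nu>\<close> is an immersion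
  (\<open>immersion_imp_S_pos\<close>), and \<open>sup Ric < m - 1\<close> if and only if \<open>\<bar>d\<nu>(X)\<bar> \<ge> \<delta> \<bar>X\<bar>\<close> for some \<open>\<delta> > 0\<close>.

  On a compact \<open>M\<close> such a \<open>\<delta>\<close> exists because \<open>\<bar>d\<nu>\<bar>\<close> is positive and continuous on the unit tangent
  bundle (\<open>compact_imp_ricci_gap\<close>). Conversely, given \<open>\<delta>\<close>, a curve in the Gauss image that joins
  \<open>\<nu> p\<close> to \<open>\<nu> q\<close> comes from a curve in \<open>M\<close> that is at most \<open>1/\<delta>\<close> times as long, so a bounded Gauss
  image makes \<open>M\<close> bounded (\<open>riem_dist_le_induced_dist\<close>), and a complete bounded manifold is compact
  by the theorem of Hopf and Rinow (\<open>bounded_complete_imp_compact_space\<close>).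

  The lengths are compared infinitesimally. Around every point the distance in \<open>M\<close> is at most
  \<open>K > 1/\<delta>\<close> times the chordal distance of the normal planes (\<open>riem_dist_le_frame_chord\<close>). Along a
  curve in the Gauss image the chordal distance and the distance \<open>d\<^sub>c\<close> grow at the same rate, because
  the former is made of the sines and the latter of the values of the principal angles. The
  resulting estimate is additive in the interval, so bisection extends it from small intervals to
  the whole curve.
\<close>

no_notation Matrix.scalar_prod (infix "\<bullet>" 70)
hide_const (open) VectorSpace.subspace

section \<open>Smooth maps between Euclidean spaces\<close>

lemma Ck_on_SucD:
  assumes "Ck_on (Suc r) S g"
  shows "\<And>x. x \<in> S \<Longrightarrow> (g has_derivative frechet_derivative g (at x)) (at x)"
    and "\<And>v. Ck_on r S (\<lambda>x. frechet_derivative g (at x) v)"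
  using assms by (auto simp: frechet_derivative_works)

lemma Ck_on_cong:
  assumes "open S" "Ck_on r S g" "\<And>x. x \<in> S \<Longrightarrow> g x = h x"
  shows "Ck_on r S h"
  using assms(2,3)
proof (induction r arbitrary: g h)
  case 0
  then show ?case by (simp cong: continuous_on_cong)
next
  case (Suc r)
  have h: "(h has_derivative frechet_derivative g (at x)) (at x)" if "x \<in> S" for x
    using has_derivative_transform_within_open[OF Ck_on_SucD(1)[OF Suc.prems(1) that] \<open>open S\<close> that] Suc.prems(2)
    by blast
  have "frechet_derivative h (at x) = frechet_derivative g (at x)" if "x \<in> S" for x
    using h[OF that] frechet_derivative_at by metis
  then have "Ck_on r S (\<lambda>x. frechet_derivative h (at x) v)" for v
    using Suc.IH[OF Ck_on_SucD(2)[OF Suc.prems(1), of v]] by simp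
  moreover have "h differentiable (at x)" if "x \<in> S" for x
    using h[OF that] differentiable_def by blast
  ultimately show ?case by simp
qed

lemma Ck_on_SucI:
  assumes "open S" "\<And>x. x \<in> S \<Longrightarrow> (g has_derivative g' x) (at x)"
    and "\<And>v. Ck_on r S (\<lambda>x. g' x v)"
  shows "Ck_on (Suc r) S g"
proof -
  have "frechet_derivative g (at x) = g' x" if "x \<in> S" for x
    using assms(2)[OF that] frechet_derivative_at by metis
  then have "Ck_on r S (\<lambda>x. frechet_derivative g (at x) v)" for v
    using Ck_on_cong[OF assms(1) assms(3)[of v]] by simp
  moreover have "g differentiable (at x)" if "x \<in> S" for x
    using assms(2)[OF that] differentiable_def by blast
  ultimately show ?thesis by simp
qed

lemma Ck_on_Suc_imp: "Ck_on (Suc r) S g \<Longrightarrow> Ck_on r S g"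
proof (induction r arbitrary: g)
  case 0
  then show ?case
    by (auto intro!: continuous_at_imp_continuous_on differentiable_imp_continuous_within)
next
  case (Suc r)
  then show ?case by (metis Ck_on.simps(2))
qed

lemma Ck_on_subset: "Ck_on r S g \<Longrightarrow> S' \<subseteq> S \<Longrightarrow> Ck_on r S' g"
  by (induction r arbitrary: g) (auto intro: continuous_on_subset)

lemma Ck_on_const: "open S \<Longrightarrow> Ck_on r S (\<lambda>x. c)"
proof (induction r arbitrary: c)
  case (Suc r)
  show ?case
    by (rule Ck_on_SucI[where g' = "\<lambda>_ _. 0"]) (use Suc in auto)
qed simp

lemma Ck_on_bounded_linear:
  assumes "open S" "bounded_linear h"
  shows "Ck_on r S h"
proof (cases r)
  case 0
  then show ?thesis using assms by (simp add: linear_continuous_on)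
next
  case (Suc q)
  have "Ck_on (Suc q) S h"
    by (rule Ck_on_SucI[where g' = "\<lambda>_. h"])
      (use assms in \<open>auto intro: bounded_linear_imp_has_derivative Ck_on_const\<close>)
  then show ?thesis using Suc by simp
qed

lemma Ck_on_add:
  assumes "open S" "Ck_on r S g" "Ck_on r S h"
  shows "Ck_on r S (\<lambda>x. g x + h x)"
  using assms(2,3)
proof (induction r arbitrary: g h)
  case 0
  then show ?case by (auto intro: continuous_intros)
next
  case (Suc r)
  show ?case
    by (rule Ck_on_SucI[where g' = "\<lambda>x v. frechet_derivative g (at x) v + frechet_derivative h (at x) v"])
      (use Suc assms(1) Ck_on_SucD[OF Suc.prems(1)] Ck_on_SucD[OF Suc.prems(2)]
        in \<open>auto intro!: has_derivative_add\<close>)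
qed


lemma Ck_on_sum:
  assumes "open S" "\<And>i. i \<in> I \<Longrightarrow> Ck_on r S (g i)"
  shows "Ck_on r S (\<lambda>x. \<Sum>i\<in>I. g i x)"
  using assms(2)
  by (induction I rule: infinite_finite_induct) (auto intro!: Ck_on_const Ck_on_add assms(1))

lemma Ck_on_bilinear:
  fixes g :: "'d::euclidean_space \<Rightarrow> 'a::euclidean_space" and h :: "'d \<Rightarrow> 'b::euclidean_space"
    and prod :: "'a \<Rightarrow> 'b \<Rightarrow> 'c::euclidean_space"
  assumes "bounded_bilinear prod" "open S" "Ck_on r S g" "Ck_on r S h"
  shows "Ck_on r S (\<lambda>x. prod (g x) (h x))"
  using assms(3,4)
proof (induction r arbitrary: g h)
  case 0
  then show ?case using bounded_bilinear.continuous_on[OF assms(1)] by auto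
next
  case (Suc r)
  have "Ck_on r S (\<lambda>x. prod (g x) (frechet_derivative h (at x) v) + prod (frechet_derivative g (at x) v) (h x))" for v
    by (intro Ck_on_add assms(2) Suc.IH Ck_on_Suc_imp[OF Suc.prems(1)] Ck_on_Suc_imp[OF Suc.prems(2)]
        Ck_on_SucD(2)[OF Suc.prems(1)] Ck_on_SucD(2)[OF Suc.prems(2)])
  then show ?case
    by (intro Ck_on_SucI[where g' = "\<lambda>x v. prod (g x) (frechet_derivative h (at x) v) + prod (frechet_derivative g (at x) v) (h x)"])
      (use assms(2) Ck_on_SucD[OF Suc.prems(1)] Ck_on_SucD[OF Suc.prems(2)]
        in \<open>auto intro!: bounded_bilinear.FDERIV[OF assms(1)]\<close>)
qed

lemma linear_sum_Basis:
  fixes D :: "'a::euclidean_space \<Rightarrow> 'b::real_vector"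
  assumes "linear D"
  shows "D w = (\<Sum>i\<in>Basis. (w \<bullet> i) *\<^sub>R D i)"
proof -
  have "D (\<Sum>i\<in>Basis. (w \<bullet> i) *\<^sub>R i) = (\<Sum>i\<in>Basis. (w \<bullet> i) *\<^sub>R D i)"
    using assms by (simp add: linear_sum linear_scale)
  then show ?thesis by (simp add: euclidean_representation)
qed

lemma Ck_on_compose:
  fixes H :: "'b::euclidean_space \<Rightarrow> 'c::euclidean_space" and b :: "'a::euclidean_space \<Rightarrow> 'b"
  assumes "open S" "open W" "b ` S \<subseteq> W" "Ck_on r W H" "Ck_on r S b"
  shows "Ck_on r S (\<lambda>x. H (b x))"
  using assms(4,5)
proof (induction r arbitrary: H)
  case 0
  then show ?case using assms(3) continuous_on_compose2[of W H S b] by auto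
next
  case (Suc r)
  let ?H = "\<lambda>x. frechet_derivative H (at x)" and ?b = "\<lambda>x. frechet_derivative b (at x)"
  have lin: "?H (b x) w = (\<Sum>i\<in>Basis. (w \<bullet> i) *\<^sub>R ?H (b x) i)" if "x \<in> S" for x w
    using that assms(3) by (intro linear_sum_Basis has_derivative_linear[OF Ck_on_SucD(1)[OF Suc.prems(1)]]) auto
  have "Ck_on r S (\<lambda>x. \<Sum>i\<in>Basis. (?b x v \<bullet> i) *\<^sub>R ?H (b x) i)" for v
  proof (intro Ck_on_sum Ck_on_bilinear[OF bounded_bilinear_scaleR] Ck_on_bilinear[OF bounded_bilinear_inner]
      Ck_on_const assms(1))
    show "Ck_on r S (\<lambda>x. ?b x v)" using Ck_on_SucD(2)[OF Suc.prems(2)] .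
    show "Ck_on r S (\<lambda>x. ?H (b x) i)" for i
      using Suc.IH[OF Ck_on_SucD(2)[OF Suc.prems(1)] Ck_on_Suc_imp[OF Suc.prems(2)]] .
  qed
  then have "Ck_on r S (\<lambda>x. ?H (b x) (?b x v))" for v
    by (rule Ck_on_cong[OF assms(1)]) (use lin in simp)
  then show ?case
  proof (intro Ck_on_SucI[where g' = "\<lambda>x v. ?H (b x) (?b x v)"])
    show "((\<lambda>x. H (b x)) has_derivative (\<lambda>v. ?H (b x) (?b x v))) (at x)" if "x \<in> S" for x
      by (rule has_derivative_compose[OF Ck_on_SucD(1)[OF Suc.prems(2) that] Ck_on_SucD(1)[OF Suc.prems(1)]])
        (use that assms(3) in auto)
  qed (use assms in auto)
qed

lemma Cinf_on_subset: "Cinf_on S g \<Longrightarrow> S' \<subseteq> S \<Longrightarrow> Cinf_on S' g"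
  unfolding Cinf_on_def using Ck_on_subset by blast

lemma Cinf_on_const: "open S \<Longrightarrow> Cinf_on S (\<lambda>x. c)"
  unfolding Cinf_on_def using Ck_on_const by blast

lemma Cinf_on_bounded_linear: "open S \<Longrightarrow> bounded_linear h \<Longrightarrow> Cinf_on S h"
  unfolding Cinf_on_def using Ck_on_bounded_linear by blast

lemma Cinf_on_add: "open S \<Longrightarrow> Cinf_on S g \<Longrightarrow> Cinf_on S h \<Longrightarrow> Cinf_on S (\<lambda>x. g x + h x)"
  unfolding Cinf_on_def using Ck_on_add by blast

lemma Cinf_on_bilinear:
  "bounded_bilinear prod \<Longrightarrow> open S \<Longrightarrow> Cinf_on S g \<Longrightarrow> Cinf_on S h \<Longrightarrow> Cinf_on S (\<lambda>x. prod (g x) (h x))"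
  for prod :: "'a::euclidean_space \<Rightarrow> 'b::euclidean_space \<Rightarrow> 'c::euclidean_space"
  unfolding Cinf_on_def using Ck_on_bilinear by blast

lemma Cinf_on_compose:
  "open S \<Longrightarrow> open W \<Longrightarrow> b ` S \<subseteq> W \<Longrightarrow> Cinf_on W H \<Longrightarrow> Cinf_on S b \<Longrightarrow> Cinf_on S (\<lambda>x. H (b x))"
  unfolding Cinf_on_def using Ck_on_compose by blast

lemma Cinf_on_affine: "open S \<Longrightarrow> Cinf_on S (\<lambda>t::real. c + t *\<^sub>R v)"
  by (intro Cinf_on_add Cinf_on_const Cinf_on_bounded_linear bounded_linear_scaleR_left)

lemma Cinf_on_derivative:
  assumes "Cinf_on S g"
  shows "x \<in> S \<Longrightarrow> (g has_derivative frechet_derivative g (at x)) (at x)"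
    and "Cinf_on S (\<lambda>x. frechet_derivative g (at x) v)"
  using assms unfolding Cinf_on_def by (metis Ck_on_SucD)+

lemma Cinf_on_continuous: "Cinf_on S g \<Longrightarrow> continuous_on S g"
  unfolding Cinf_on_def by (metis Ck_on.simps(1))

text \<open>The second difference is \<open>h\<^sup>2\<close> times a second derivative at an intermediate point. As it is symmetric in
  \<open>a\<close> and \<open>b\<close>, letting \<open>h\<close> tend to \<open>0\<close> gives the symmetry of second derivatives.\<close>

lemma second_difference_mvt:
  fixes H :: "'a::euclidean_space \<Rightarrow> real"
  assumes H: "Cinf_on W H" and B: "ball x e \<subseteq> W" and h: "h > 0" "h * (norm a + norm b) < e"
  shows "\<exists>y \<in> ball x e. H (x + h *\<^sub>R a + h *\<^sub>R b) - H (x + h *\<^sub>R a) - H (x + h *\<^sub>R b) + H x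
            = h * h * frechet_derivative (\<lambda>y. frechet_derivative H (at y) a) (at y) b"
proof -
  let ?D = "\<lambda>H y. frechet_derivative H (at y)"
  have inb: "x + s *\<^sub>R a + t *\<^sub>R b \<in> ball x e" if "0 \<le> s" "s \<le> h" "0 \<le> t" "t \<le> h" for s t
  proof -
    have "norm (s *\<^sub>R a + t *\<^sub>R b) \<le> s * norm a + t * norm b"
      using that norm_triangle_ineq[of "s *\<^sub>R a" "t *\<^sub>R b"] by simp
    also have "\<dots> \<le> h * norm a + h * norm b"
      using that by (intro add_mono mult_right_mono) auto
    finally show ?thesis using h by (simp add: dist_norm algebra_simps norm_minus_commute)
  qed
  have der: "((\<lambda>s. G (c + s *\<^sub>R v)) has_real_derivative ?D G (c + s *\<^sub>R v) v) (at s)"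
    if "Cinf_on W G" "c + s *\<^sub>R v \<in> ball x e" for G :: "'a \<Rightarrow> real" and c v s
  proof -
    have lin: "((\<lambda>s. c + s *\<^sub>R v) has_derivative (\<lambda>u. u *\<^sub>R v)) (at s)"
      by (auto intro!: derivative_eq_intros)
    have D: "(G has_derivative ?D G (c + s *\<^sub>R v)) (at (c + s *\<^sub>R v))"
      using Cinf_on_derivative(1)[OF that(1)] that(2) B by blast
    have "((\<lambda>s. G (c + s *\<^sub>R v)) has_derivative (\<lambda>u. ?D G (c + s *\<^sub>R v) (u *\<^sub>R v))) (at s)"
      using has_derivative_compose[OF lin D] .
    moreover have "?D G (c + s *\<^sub>R v) (u *\<^sub>R v) = ?D G (c + s *\<^sub>R v) v * u" for u
      using has_derivative_linear[OF D] by (simp add: linear_scale)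
    ultimately show ?thesis
      by (simp add: has_field_derivative_def)
  qed
  have inb': "x + h *\<^sub>R b + s *\<^sub>R a \<in> ball x e" "x + s *\<^sub>R a \<in> ball x e" if "0 \<le> s" "s \<le> h" for s
    using inb[OF that, of h] inb[OF that, of 0] h that by (auto simp: algebra_simps)
  have "\<exists>s. 0 < s \<and> s < h \<and> (H (x + h *\<^sub>R b + h *\<^sub>R a) - H (x + h *\<^sub>R a)) - (H (x + h *\<^sub>R b + 0 *\<^sub>R a) - H (x + 0 *\<^sub>R a))
      = (h - 0) * (?D H (x + h *\<^sub>R b + s *\<^sub>R a) a - ?D H (x + s *\<^sub>R a) a)"
    by (rule MVT2[where f = "\<lambda>s. H (x + h *\<^sub>R b + s *\<^sub>R a) - H (x + s *\<^sub>R a)"])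
      (use h inb' in \<open>auto intro!: DERIV_diff der[OF H]\<close>)
  then obtain s where s: "0 < s" "s < h" "(H (x + h *\<^sub>R b + h *\<^sub>R a) - H (x + h *\<^sub>R a)) - (H (x + h *\<^sub>R b) - H x)
      = h * (?D H (x + h *\<^sub>R b + s *\<^sub>R a) a - ?D H (x + s *\<^sub>R a) a)" by auto
  have "\<exists>t. 0 < t \<and> t < h \<and> ?D H (x + s *\<^sub>R a + h *\<^sub>R b) a - ?D H (x + s *\<^sub>R a + 0 *\<^sub>R b) a
      = (h - 0) * ?D (\<lambda>y. ?D H y a) (x + s *\<^sub>R a + t *\<^sub>R b) b"
    by (rule MVT2[where f = "\<lambda>t. ?D H (x + s *\<^sub>R a + t *\<^sub>R b) a"])
      (use h s inb[of s] in \<open>auto intro!: der[OF Cinf_on_derivative(2)[OF H]]\<close>)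
  then obtain t where t: "0 < t" "t < h" "?D H (x + s *\<^sub>R a + h *\<^sub>R b) a - ?D H (x + s *\<^sub>R a) a
      = h * ?D (\<lambda>y. ?D H y a) (x + s *\<^sub>R a + t *\<^sub>R b) b" by auto
  show ?thesis
    by (rule bexI[of _ "x + s *\<^sub>R a + t *\<^sub>R b"]) (use s t inb[of s t] in \<open>auto simp: algebra_simps\<close>)
qed

lemma second_derivative_symmetric_real:
  fixes H :: "'a::euclidean_space \<Rightarrow> real"
  assumes H: "Cinf_on W H" and W: "open W" "x \<in> W"
  shows "frechet_derivative (\<lambda>y. frechet_derivative H (at y) a) (at x) b
       = frechet_derivative (\<lambda>y. frechet_derivative H (at y) b) (at x) a"
proof -
  define P where "P a b y = frechet_derivative (\<lambda>y. frechet_derivative H (at y) a) (at y) b" for a b y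
  have P: "continuous_on W (P a b)" for a b
    unfolding P_def by (intro Cinf_on_continuous Cinf_on_derivative(2) H)
  have "dist (P a b x) (P b a x) \<le> e" if "e > 0" for e
  proof -
    have "isCont (P a b) x" "isCont (P b a) x" using P W continuous_on_eq_continuous_at by blast+
    then obtain d1 d2 where d: "d1 > 0" "d2 > 0"
      "\<And>y. dist y x < d1 \<Longrightarrow> dist (P a b y) (P a b x) < e/2"
      "\<And>y. dist y x < d2 \<Longrightarrow> dist (P b a y) (P b a x) < e/2"
      using \<open>e > 0\<close> unfolding continuous_at_eps_delta by (metis half_gt_zero)
    obtain d3 where d3: "d3 > 0" "ball x d3 \<subseteq> W" using W open_contains_ball by blast
    define d where "d = min d1 (min d2 d3)"
    have dp: "d > 0" "ball x d \<subseteq> W" using d d3 by (auto simp: d_def)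
    \<comment> \<open>The step \<open>h\<close> is so small that both intermediate points lie in the ball of radius \<open>d\<close>.\<close>
    define h where "h = d / (2 * (norm a + norm b + 1))"
    have h: "h > 0" using dp by (auto simp: h_def intro!: divide_pos_pos add_nonneg_pos)
    have hh: "h * (norm a + norm b) < d"
    proof -
      have "norm a + norm b < 2 * (norm a + norm b + 1)"
        using norm_ge_zero[of a] norm_ge_zero[of b] by argo
      then have "h * (norm a + norm b) < h * (2 * (norm a + norm b + 1))"
        using h by (rule mult_strict_left_mono)
      also have "\<dots> = d" unfolding h_def
        using norm_ge_zero[of a] norm_ge_zero[of b] by (smt (verit) nonzero_eq_divide_eq)
      finally show ?thesis .
    qed
    obtain y1 where y1: "y1 \<in> ball x d" "H (x + h *\<^sub>R a + h *\<^sub>R b) - H (x + h *\<^sub>R a) - H (x + h *\<^sub>R b) + H x = h * h * P a b y1"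
      using second_difference_mvt[OF H dp(2) h hh] unfolding P_def by blast
    obtain y2 where y2: "y2 \<in> ball x d" "H (x + h *\<^sub>R b + h *\<^sub>R a) - H (x + h *\<^sub>R b) - H (x + h *\<^sub>R a) + H x = h * h * P b a y2"
      using second_difference_mvt[OF H dp(2) h, of b a] hh unfolding P_def by (auto simp: add.commute)
    have "x + h *\<^sub>R b + h *\<^sub>R a = x + h *\<^sub>R a + h *\<^sub>R b" by (simp add: algebra_simps)
    then have "H (x + h *\<^sub>R b + h *\<^sub>R a) = H (x + h *\<^sub>R a + h *\<^sub>R b)" by (rule arg_cong)
    then have "h * h * P a b y1 = h * h * P b a y2" using y1(2) y2(2) by linarith
    then have "P a b y1 = P b a y2" using h by simp
    moreover have "dist (P a b y1) (P a b x) < e/2" "dist (P b a y2) (P b a x) < e/2"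
      by (rule d(3), use y1(1) in \<open>simp add: d_def dist_commute\<close>, rule d(4), use y2(1) in \<open>simp add: d_def dist_commute\<close>)
    ultimately show ?thesis unfolding dist_real_def by linarith
  qed
  then have "P a b x = P b a x" by (metis dist_le_zero_iff dense_ge)
  then show ?thesis by (simp add: P_def)
qed

lemma second_derivative_symmetric:
  fixes H :: "'a::euclidean_space \<Rightarrow> 'b::euclidean_space"
  assumes H: "Cinf_on W H" and W: "open W" "x \<in> W"
  shows "frechet_derivative (\<lambda>y. frechet_derivative H (at y) a) (at x) b
       = frechet_derivative (\<lambda>y. frechet_derivative H (at y) b) (at x) a"
proof -
  have HD: "frechet_derivative (\<lambda>y. G y \<bullet> e) (at y) v = frechet_derivative G (at y) v \<bullet> e"
    if "Cinf_on W G" "y \<in> W" for G :: "'a \<Rightarrow> 'b" and e y v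
    using frechet_derivative_at[OF has_derivative_inner_left[OF Cinf_on_derivative(1)[OF that], of e]]
    by metis
  have C: "Cinf_on W (\<lambda>y. G y \<bullet> e)" if "Cinf_on W G" for G :: "'a \<Rightarrow> 'b" and e
    by (intro Cinf_on_bilinear[OF bounded_bilinear_inner] W that Cinf_on_const)
  have D2: "frechet_derivative (\<lambda>y. frechet_derivative (\<lambda>y. H y \<bullet> e) (at y) a) (at x) b
      = frechet_derivative (\<lambda>y. frechet_derivative H (at y) a) (at x) b \<bullet> e" for a b e
  proof -
    have "frechet_derivative (\<lambda>y. frechet_derivative (\<lambda>y. H y \<bullet> e) (at y) a) (at x)
        = frechet_derivative (\<lambda>y. frechet_derivative H (at y) a \<bullet> e) (at x)"
      by (rule frechet_derivative_at[symmetric], rule has_derivative_transform_within_open[OF _ W])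
        (use Cinf_on_derivative(1)[OF C[OF Cinf_on_derivative(2)[OF H]] W(2)] HD[OF H] in auto)
    then show ?thesis using HD[OF Cinf_on_derivative(2)[OF H] W(2)] by simp
  qed
  show ?thesis
  proof (rule euclidean_eqI)
    show "frechet_derivative (\<lambda>y. frechet_derivative H (at y) a) (at x) b \<bullet> e
       = frechet_derivative (\<lambda>y. frechet_derivative H (at y) b) (at x) a \<bullet> e" for e
      using second_derivative_symmetric_real[OF C[OF H] W, of e a b] unfolding D2 .
  qed
qed

text \<open>The product rule for the derivative of \<open>H\<close> applied to a moving vector. Only differentiability of
  \<open>Y\<close> at \<open>x\<close> is asked for, so that it applies to fields that arise as derivatives.\<close>

lemma has_derivative_directional:
  fixes H :: "'a::euclidean_space \<Rightarrow> 'b::euclidean_space"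
  assumes H: "Cinf_on W H" and W: "open W" "x \<in> W" and Y: "(Y has_derivative Y') (at x)"
  shows "((\<lambda>z. frechet_derivative H (at z) (Y z)) has_derivative
      (\<lambda>v. frechet_derivative (\<lambda>z. frechet_derivative H (at z) (Y x)) (at x) v
         + frechet_derivative H (at x) (Y' v))) (at x)"
proof -
  let ?D = "\<lambda>z. frechet_derivative H (at z)"
  have lin: "?D z w = (\<Sum>i\<in>Basis. (w \<bullet> i) *\<^sub>R ?D z i)" if "z \<in> W" for z w
    by (intro linear_sum_Basis has_derivative_linear[OF Cinf_on_derivative(1)[OF H that]])
  define D2 where "D2 w = frechet_derivative (\<lambda>z. ?D z w) (at x)" for w
  have D2: "((\<lambda>z. ?D z w) has_derivative D2 w) (at x)" for w
    unfolding D2_def by (rule Cinf_on_derivative(1)[OF Cinf_on_derivative(2)[OF H] W(2)])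
  have "((\<lambda>z. \<Sum>i\<in>Basis. (Y x \<bullet> i) *\<^sub>R ?D z i) has_derivative (\<lambda>v. \<Sum>i\<in>Basis. (Y x \<bullet> i) *\<^sub>R D2 i v)) (at x)"
    by (intro has_derivative_sum has_derivative_scaleR_right D2)
  then have "((\<lambda>z. ?D z (Y x)) has_derivative (\<lambda>v. \<Sum>i\<in>Basis. (Y x \<bullet> i) *\<^sub>R D2 i v)) (at x)"
    by (rule has_derivative_transform_within_open[OF _ W]) (use lin in simp)
  then have D2Y: "D2 (Y x) = (\<lambda>v. \<Sum>i\<in>Basis. (Y x \<bullet> i) *\<^sub>R D2 i v)"
    using D2 has_derivative_unique by blast
  have "((\<lambda>z. \<Sum>i\<in>Basis. (Y z \<bullet> i) *\<^sub>R ?D z i) has_derivative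
      (\<lambda>v. \<Sum>i\<in>Basis. (Y x \<bullet> i) *\<^sub>R D2 i v + (Y' v \<bullet> i) *\<^sub>R ?D x i)) (at x)"
    by (intro has_derivative_sum has_derivative_scaleR D2 has_derivative_inner_left Y)
  then have "((\<lambda>z. ?D z (Y z)) has_derivative
      (\<lambda>v. \<Sum>i\<in>Basis. (Y x \<bullet> i) *\<^sub>R D2 i v + (Y' v \<bullet> i) *\<^sub>R ?D x i)) (at x)"
    by (rule has_derivative_transform_within_open[OF _ W]) (use lin in simp)
  then show ?thesis
    unfolding D2_def[symmetric] D2Y sum.distrib lin[OF W(2), symmetric] .
qed

lemma smooth_map_subtopology_mono:
  assumes "smooth_map (subtopology T U) f h" "openin T U'" "U' \<subseteq> U"
  shows "smooth_map (subtopology T U') f h"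
  unfolding smooth_map_def
proof
  fix p assume p: "p \<in> topspace (subtopology T U')"
  then have "p \<in> topspace (subtopology T U)" using assms(3) by auto
  then obtain V W H where V: "openin (subtopology T U) V" "p \<in> V" "open W" "f ` V \<subseteq> W" "Cinf_on W H"
    "\<forall>q\<in>V. h q = H (f q)" using assms(1) unfolding smooth_map_def by meson
  obtain V' where "openin T V'" "V = V' \<inter> U" using V(1) by (auto simp: openin_subtopology)
  then have "openin (subtopology T U') (V \<inter> U')"
    using assms(3) by (auto simp: openin_subtopology intro!: exI[of _ V'])
  then show "\<exists>U W H. openin (subtopology T U') U \<and> p \<in> U \<and> open W \<and> f ` U \<subseteq> W \<and> Cinf_on W H \<and>
        (\<forall>q\<in>U. h q = H (f q))"
    using V p by (intro exI[of _ "V \<inter> U'"] exI[of _ W] exI[of _ H]) auto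
qed

lemma smooth_map_bilinear:
  fixes prod :: "'a::euclidean_space \<Rightarrow> 'b::euclidean_space \<Rightarrow> 'c::euclidean_space"
  assumes "bounded_bilinear prod" "smooth_map T f g" "smooth_map T f h"
  shows "smooth_map T f (\<lambda>q. prod (g q) (h q))"
  unfolding smooth_map_def
proof
  fix p assume p: "p \<in> topspace T"
  obtain U W G where 1: "openin T U" "p \<in> U" "open W" "f ` U \<subseteq> W" "Cinf_on W G" "\<forall>q\<in>U. g q = G (f q)"
    using assms(2) p unfolding smooth_map_def by meson
  obtain U' W' H where 2: "openin T U'" "p \<in> U'" "open W'" "f ` U' \<subseteq> W'" "Cinf_on W' H" "\<forall>q\<in>U'. h q = H (f q)"
    using assms(3) p unfolding smooth_map_def by meson
  have "Cinf_on (W \<inter> W') (\<lambda>x. prod (G x) (H x))"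
    using 1 2 by (intro Cinf_on_bilinear[OF assms(1)]) (auto intro: Cinf_on_subset)
  then show "\<exists>U W F. openin T U \<and> p \<in> U \<and> open W \<and> f ` U \<subseteq> W \<and> Cinf_on W F \<and>
        (\<forall>q\<in>U. prod (g q) (h q) = F (f q))"
    using 1 2 by (intro exI[of _ "U \<inter> U'"] exI[of _ "W \<inter> W'"] exI[of _ "\<lambda>x. prod (G x) (H x)"]) auto
qed

lemma smooth_map_const: "smooth_map T f (\<lambda>q. c)"
  unfolding smooth_map_def
  by (metis (no_types, lifting) Cinf_on_const open_UNIV openin_topspace subset_UNIV)

lemma smooth_map_add:
  assumes "smooth_map T f g" "smooth_map T f h"
  shows "smooth_map T f (\<lambda>q. g q + h q)"
  unfolding smooth_map_def
proof
  fix p assume p: "p \<in> topspace T"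
  obtain U W G where 1: "openin T U" "p \<in> U" "open W" "f ` U \<subseteq> W" "Cinf_on W G" "\<forall>q\<in>U. g q = G (f q)"
    using assms(1) p unfolding smooth_map_def by meson
  obtain U' W' H where 2: "openin T U'" "p \<in> U'" "open W'" "f ` U' \<subseteq> W'" "Cinf_on W' H" "\<forall>q\<in>U'. h q = H (f q)"
    using assms(2) p unfolding smooth_map_def by meson
  have "Cinf_on (W \<inter> W') (\<lambda>x. G x + H x)"
    using 1 2 by (intro Cinf_on_add) (auto intro: Cinf_on_subset)
  then show "\<exists>U W F. openin T U \<and> p \<in> U \<and> open W \<and> f ` U \<subseteq> W \<and> Cinf_on W F \<and>
        (\<forall>q\<in>U. g q + h q = F (f q))"
    using 1 2 by (intro exI[of _ "U \<inter> U'"] exI[of _ "W \<inter> W'"] exI[of _ "\<lambda>x. G x + H x"]) auto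
qed

lemma smooth_map_sum:
  assumes "\<And>i. i \<in> I \<Longrightarrow> smooth_map T f (g i)"
  shows "smooth_map T f (\<lambda>q. \<Sum>i\<in>I. g i q)"
  using assms
  by (induction I rule: infinite_finite_induct) (auto intro!: smooth_map_const smooth_map_add)

section \<open>Local parametrizations and tangent spaces\<close>

text \<open>\<open>\<phi>\<close> is a chart of the ambient space on \<open>W\<close> with inverse \<open>\<psi>\<close> on \<open>V\<close>, which maps \<open>f ` U\<close> to the
  linear slice \<open>V \<inter> L\<close>; the parametrization \<open>g\<close> of \<open>U\<close> by this slice inverts \<open>\<phi> \<circ> f\<close>.\<close>

definition local_param ::
  "nat \<Rightarrow> 'a topology \<Rightarrow> ('a \<Rightarrow> 'e::euclidean_space) \<Rightarrow> 'a set \<Rightarrow> 'e set \<Rightarrow> 'e set \<Rightarrow> 'e set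
    \<Rightarrow> ('e \<Rightarrow> 'e) \<Rightarrow> ('e \<Rightarrow> 'e) \<Rightarrow> ('e \<Rightarrow> 'a) \<Rightarrow> bool" where
  "local_param m T f U W V L \<phi> \<psi> g \<longleftrightarrow>
     openin T U \<and> open W \<and> f ` U \<subseteq> W \<and> open V \<and> subspace L \<and> dim L = m \<and>
     Cinf_on W \<phi> \<and> Cinf_on V \<psi> \<and> \<psi> ` V \<subseteq> W \<and> (\<forall>x\<in>V. \<phi> (\<psi> x) = x) \<and>
     (\<forall>q\<in>U. \<phi> (f q) \<in> V \<inter> L \<and> \<psi> (\<phi> (f q)) = f q \<and> g (\<phi> (f q)) = q) \<and>
     (\<forall>x\<in>V \<inter> L. g x \<in> U \<and> f (g x) = \<psi> x) \<and>
     continuous_map (top_of_set (V \<inter> L)) T g \<and> continuous_map (subtopology T U) euclidean f"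

text \<open>A chart of the ambient space that straightens \<open>f ` U\<close> is composed with the inverse of the
  embedding \<open>f\<close> of \<open>U\<close>.\<close>

lemma local_param_exists:
  fixes f :: "'a \<Rightarrow> 'e::euclidean_space"
  assumes "immersed_submanifold m T f" "p \<in> topspace T"
  obtains U W V L \<phi> \<psi> g where "local_param m T f U W V L \<phi> \<psi> g" "p \<in> U"
proof -
  obtain U0 where U0: "openin T U0" "p \<in> U0" "embedding_map (subtopology T U0) euclidean f"
    "embedded_submanifold m (f ` U0)"
    using assms unfolding immersed_submanifold_def by meson
  have ts: "topspace (subtopology T U0) = U0"
    using openin_subset[OF U0(1)] by auto
  have "homeomorphic_map (subtopology T U0) (top_of_set (f ` U0)) f"
    using U0(3) unfolding embedding_map_def ts .
  then obtain h where h: "homeomorphic_maps (subtopology T U0) (top_of_set (f ` U0)) f h"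
    by (meson homeomorphic_map_maps)
  have hf: "h (f q) = q" if "q \<in> U0" for q
    using h that ts by (auto simp: homeomorphic_maps_def)
  have fh: "f (h y) = y" "h y \<in> U0" if "y \<in> f ` U0" for y
    using hf that by auto
  have conth: "continuous_map (top_of_set (f ` U0)) T h"
    using h by (auto simp: homeomorphic_maps_def continuous_map_in_subtopology)
  have contf: "continuous_map (subtopology T U0) euclidean f"
    using h by (auto simp: homeomorphic_maps_def continuous_map_in_subtopology)
  obtain W V \<phi> \<psi> and L :: "'e set" where c: "open W" "f p \<in> W" "open V" "homeomorphism W V \<phi> \<psi>"
    "Cinf_on W \<phi>" "Cinf_on V \<psi>" "subspace L" "dim L = m" "\<phi> ` (W \<inter> f ` U0) = V \<inter> L"
    using bspec[OF U0(4)[unfolded embedded_submanifold_def] imageI[OF U0(2)]]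
    by (elim exE conjE) (rule that; assumption)
  have hom: "\<phi> x \<in> V" "\<psi> (\<phi> x) = x" if "x \<in> W" for x
    using c(4) that unfolding homeomorphism_def by blast+
  have hom': "\<psi> y \<in> W" "\<phi> (\<psi> y) = y" if "y \<in> V" for y
    using c(4) that unfolding homeomorphism_def by blast+
  define U where "U = {q \<in> U0. f q \<in> W}"
  define g where "g = h \<circ> \<psi>"
  have "openin (subtopology T U0) {q \<in> topspace (subtopology T U0). f q \<in> W}"
    using contf c(1) by (intro openin_continuous_map_preimage[of _ euclidean]) auto
  then have U: "openin T U"
    using U0(1) openin_trans_full unfolding U_def ts by blast
  have psi: "\<psi> x \<in> W \<inter> f ` U0" if "x \<in> V \<inter> L" for x
  proof -
    have "x \<in> \<phi> ` (W \<inter> f ` U0)" using c(9) that by simp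
    then obtain y where y: "y \<in> W \<inter> f ` U0" "x = \<phi> y" by blast
    then show ?thesis using hom(2)[of y] by simp
  qed
  have gU: "g x \<in> U \<and> f (g x) = \<psi> x" if "x \<in> V \<inter> L" for x
    using psi[OF that] fh by (auto simp: g_def U_def hf)
  have contg: "continuous_map (top_of_set (V \<inter> L)) T g"
    unfolding g_def
  proof (rule continuous_map_compose[OF _ conth])
    have "continuous_on (V \<inter> L) \<psi>"
      using Cinf_on_continuous[OF c(6)] continuous_on_subset by blast
    then show "continuous_map (top_of_set (V \<inter> L)) (top_of_set (f ` U0)) \<psi>"
      using psi by (auto simp: continuous_map_in_subtopology)
  qed
  have "\<phi> (f q) \<in> V \<inter> L \<and> \<psi> (\<phi> (f q)) = f q \<and> g (\<phi> (f q)) = q" if "q \<in> U" for q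
    using that c(9) hom hf by (auto simp: U_def g_def)
  moreover have "continuous_map (subtopology T U) euclidean f"
    using contf by (rule continuous_map_from_subtopology_mono) (auto simp: U_def)
  ultimately have "local_param m T f U W V L \<phi> \<psi> g"
    unfolding local_param_def using U c gU contg hom' by (auto simp: U_def)
  moreover have "p \<in> U" using U0 c by (auto simp: U_def)
  ultimately show thesis using that by blast
qed

lemma smooth_curve_stays:
  assumes "smooth_curve T f J c" "t \<in> J" "openin T U" "c t \<in> U"
  obtains d where "d > 0" "\<And>s. s \<in> J \<Longrightarrow> \<bar>s - t\<bar> < d \<Longrightarrow> c s \<in> U"
proof -
  have "openin (top_of_set J) {s \<in> J. c s \<in> U}"
    using openin_continuous_map_preimage[of "top_of_set J" T c U] assms(1,3)
    by (auto simp: smooth_curve_def)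
  then obtain G where G: "open G" "{s \<in> J. c s \<in> U} = J \<inter> G" by (auto simp: openin_open)
  then have "t \<in> G" using assms(2,4) by blast
  then obtain d where "d > 0" "ball t d \<subseteq> G" using G(1) open_contains_ball by blast
  then show thesis using that[of d] G(2) by (force simp: dist_real_def abs_minus_commute)
qed

lemma curve_through_stays:
  assumes "curve_through T f p v c" "openin T U" "p \<in> U"
  obtains d where "d > 0" "\<And>s. \<bar>s\<bar> < d \<Longrightarrow> c s \<in> U"
proof -
  obtain e where e: "e > 0" "smooth_curve T f {-e..e} c" "c 0 = p"
    using assms(1) by (auto simp: curve_through_def)
  obtain d where "d > 0" "\<And>s. s \<in> {-e..e} \<Longrightarrow> \<bar>s - 0\<bar> < d \<Longrightarrow> c s \<in> U"
    using smooth_curve_stays[OF e(2), of 0 U] e assms by auto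
  then show thesis
    by (intro that[of "min d e"]) (use e(1) in \<open>auto simp: abs_less_iff less_imp_le\<close>)
qed

text \<open>Near \<open>p\<close> the map \<open>h\<close> extends to the ambient space, differentiably at \<open>f p\<close>. The derivative \<open>h'\<close> of the
  extension is determined by \<open>h\<close> on the tangent space only. Unlike smoothness, this pointwise notion is
  inherited by derivatives of smooth fields along differentiable ones without further regularity.\<close>

definition has_tangential_derivative ::
  "'a topology \<Rightarrow> ('a \<Rightarrow> 'e::euclidean_space) \<Rightarrow> ('a \<Rightarrow> 'b::euclidean_space) \<Rightarrow> ('e \<Rightarrow> 'b) \<Rightarrow> 'a \<Rightarrow> bool" where
  "has_tangential_derivative T f h h' p \<longleftrightarrow>
     (\<exists>U H. openin T U \<and> p \<in> U \<and> (\<forall>q\<in>U. h q = H (f q)) \<and> (H has_derivative h') (at (f p)))"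

lemma has_tangential_derivativeI:
  "openin T U \<Longrightarrow> p \<in> U \<Longrightarrow> (\<And>q. q \<in> U \<Longrightarrow> h q = H (f q)) \<Longrightarrow> (H has_derivative h') (at (f p))
    \<Longrightarrow> has_tangential_derivative T f h h' p"
  unfolding has_tangential_derivative_def by blast

lemma has_tangential_derivative_linear:
  "has_tangential_derivative T f h h' p \<Longrightarrow> linear h'"
  unfolding has_tangential_derivative_def using has_derivative_linear by blast

lemma has_tangential_derivative_curve:
  assumes "has_tangential_derivative T f h h' p" "curve_through T f p v c"
  shows "((h \<circ> c) has_vector_derivative h' v) (at 0)"
proof -
  obtain U H where H: "openin T U" "p \<in> U" "\<forall>q\<in>U. h q = H (f q)" "(H has_derivative h') (at (f p))"
    using assms(1) unfolding has_tangential_derivative_def by blast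
  obtain d where d: "d > 0" "\<And>s. \<bar>s\<bar> < d \<Longrightarrow> c s \<in> U"
    using curve_through_stays[OF assms(2) H(1,2)] by blast
  have c: "((f \<circ> c) has_vector_derivative v) (at 0)" "c 0 = p"
    using assms(2) by (auto simp: curve_through_def)
  have "((H \<circ> (f \<circ> c)) has_vector_derivative h' v) (at 0)"
    using vector_derivative_diff_chain_within[of "f \<circ> c" v 0 UNIV H h'] c H(4)
    by (auto intro: has_derivative_at_withinI)
  then show ?thesis
    by (rule has_vector_derivative_transform_within_open[of _ _ _ "{-d<..<d}"]) (use d H(3) in auto)
qed

text \<open>At a tangent vector some curve represents the vector, which makes the directional derivative unique.\<close>

lemma dir_deriv_eq:
  assumes "has_tangential_derivative T f h h' p" "v \<in> tangent_space T f p"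
  shows "dir_deriv T f h p v = h' v"
  unfolding dir_deriv_def
proof (rule the_equality)
  show "\<forall>c. curve_through T f p v c \<longrightarrow> ((h \<circ> c) has_vector_derivative h' v) (at 0)"
    using has_tangential_derivative_curve[OF assms(1)] by blast
next
  fix w assume w: "\<forall>c. curve_through T f p v c \<longrightarrow> ((h \<circ> c) has_vector_derivative w) (at 0)"
  obtain c where "curve_through T f p v c" using assms(2) by (auto simp: tangent_space_def)
  then show "w = h' v"
    using w has_tangential_derivative_curve[OF assms(1)] vector_derivative_unique_at by blast
qed

lemma has_tangential_derivative_cong:
  assumes "has_tangential_derivative T f h h' p" "openin T U" "p \<in> U" "\<And>q. q \<in> U \<Longrightarrow> h q = k q"
  shows "has_tangential_derivative T f k h' p"
proof -
  obtain V H where H: "openin T V" "p \<in> V" "\<forall>q\<in>V. h q = H (f q)" "(H has_derivative h') (at (f p))"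
    using assms(1) unfolding has_tangential_derivative_def by blast
  show ?thesis
    by (rule has_tangential_derivativeI[of T "U \<inter> V"]) (use H assms in auto)
qed

lemma has_tangential_derivative_const:
  "p \<in> topspace T \<Longrightarrow> has_tangential_derivative T f (\<lambda>q. a) (\<lambda>v. 0) p"
  by (rule has_tangential_derivativeI[of T "topspace T" _ _ "\<lambda>_. a"]) auto

lemma has_tangential_derivative_immersion:
  "p \<in> topspace T \<Longrightarrow> has_tangential_derivative T f f (\<lambda>v. v) p"
  by (rule has_tangential_derivativeI[of T "topspace T" _ _ "\<lambda>x. x"]) auto

lemma has_tangential_derivative_bilinear:
  fixes prod :: "'b::euclidean_space \<Rightarrow> 'c::euclidean_space \<Rightarrow> 'd::euclidean_space"
  assumes "bounded_bilinear prod"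
    and "has_tangential_derivative T f h h' p" "has_tangential_derivative T f k k' p"
  shows "has_tangential_derivative T f (\<lambda>q. prod (h q) (k q)) (\<lambda>v. prod (h p) (k' v) + prod (h' v) (k p)) p"
proof -
  obtain U H where H: "openin T U" "p \<in> U" "\<forall>q\<in>U. h q = H (f q)" "(H has_derivative h') (at (f p))"
    using assms(2) unfolding has_tangential_derivative_def by blast
  obtain V K where K: "openin T V" "p \<in> V" "\<forall>q\<in>V. k q = K (f q)" "(K has_derivative k') (at (f p))"
    using assms(3) unfolding has_tangential_derivative_def by blast
  show ?thesis
    by (rule has_tangential_derivativeI[of T "U \<inter> V" _ _ "\<lambda>x. prod (H x) (K x)"])
      (use H K bounded_bilinear.FDERIV[OF assms(1) H(4) K(4)] in auto)
qed

lemma has_tangential_derivative_add: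
  assumes "has_tangential_derivative T f h h' p" "has_tangential_derivative T f k k' p"
  shows "has_tangential_derivative T f (\<lambda>q. h q + k q) (\<lambda>v. h' v + k' v) p"
proof -
  obtain U H where H: "openin T U" "p \<in> U" "\<forall>q\<in>U. h q = H (f q)" "(H has_derivative h') (at (f p))"
    using assms(1) unfolding has_tangential_derivative_def by blast
  obtain V K where K: "openin T V" "p \<in> V" "\<forall>q\<in>V. k q = K (f q)" "(K has_derivative k') (at (f p))"
    using assms(2) unfolding has_tangential_derivative_def by blast
  show ?thesis
    by (rule has_tangential_derivativeI[of T "U \<inter> V" _ _ "\<lambda>x. H x + K x"])
      (use H K has_derivative_add[OF H(4) K(4)] in auto)
qed

lemma has_tangential_derivative_uminus:
  assumes "has_tangential_derivative T f h h' p"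
  shows "has_tangential_derivative T f (\<lambda>q. - h q) (\<lambda>v. - h' v) p"
proof -
  obtain U H where H: "openin T U" "p \<in> U" "\<forall>q\<in>U. h q = H (f q)" "(H has_derivative h') (at (f p))"
    using assms(1) unfolding has_tangential_derivative_def by blast
  show ?thesis
    by (rule has_tangential_derivativeI[of T U _ _ "\<lambda>x. - H x"])
      (use H has_derivative_minus[OF H(4)] in auto)
qed

lemma has_tangential_derivative_diff:
  assumes "has_tangential_derivative T f h h' p" "has_tangential_derivative T f k k' p"
  shows "has_tangential_derivative T f (\<lambda>q. h q - k q) (\<lambda>v. h' v - k' v) p"
  using has_tangential_derivative_add[OF assms(1) has_tangential_derivative_uminus[OF assms(2)]] by simp

lemma has_tangential_derivative_sum:
  assumes "p \<in> topspace T" "\<And>i. i \<in> I \<Longrightarrow> has_tangential_derivative T f (h i) (h' i) p"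
  shows "has_tangential_derivative T f (\<lambda>q. \<Sum>i\<in>I. h i q) (\<lambda>v. \<Sum>i\<in>I. h' i v) p"
  using assms(2)
  by (induction I rule: infinite_finite_induct)
    (auto intro!: has_tangential_derivative_const has_tangential_derivative_add assms(1))

lemma smooth_map_local:
  assumes "smooth_map (subtopology T U) f h" "openin T U" "p \<in> U"
  obtains V W H where "openin T V" "p \<in> V" "V \<subseteq> U" "open W" "f ` V \<subseteq> W" "Cinf_on W H" "\<And>q. q \<in> V \<Longrightarrow> h q = H (f q)"
proof -
  have "p \<in> topspace (subtopology T U)" using assms openin_subset by fastforce
  then obtain V W H where V: "openin (subtopology T U) V" "p \<in> V" "open W" "f ` V \<subseteq> W" "Cinf_on W H"
    "\<forall>q\<in>V. h q = H (f q)" using assms(1) unfolding smooth_map_def by meson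
  then show thesis using that[of V W H] assms(2) openin_trans_full openin_imp_subset by metis
qed

lemma smooth_map_has_tangential_derivative:
  assumes "smooth_map (subtopology T U) f h" "openin T U" "p \<in> U"
  obtains h' where "has_tangential_derivative T f h h' p"
proof -
  obtain V W H where V: "openin T V" "p \<in> V" "open W" "f ` V \<subseteq> W" "Cinf_on W H" "\<And>q. q \<in> V \<Longrightarrow> h q = H (f q)"
    using smooth_map_local[OF assms] by metis
  show thesis
    by (rule that, rule has_tangential_derivativeI[OF V(1,2,6) Cinf_on_derivative(1)[OF V(5)]]) (use V in auto)
qed

lemma smooth_map_dir_deriv:
  assumes "smooth_map (subtopology T U) f h" "openin T U" "p \<in> U"
  shows "\<exists>h'. has_tangential_derivative T f h h' p \<and> (\<forall>v \<in> tangent_space T f p. dir_deriv T f h p v = h' v)"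
  using smooth_map_has_tangential_derivative[OF assms] dir_deriv_eq by metis

text \<open>All functionals that vanish on \<open>L\<close> vanish on the curve, hence on its velocity.\<close>

lemma vector_derivative_in_subspace:
  fixes y :: "real \<Rightarrow> 'e::euclidean_space"
  assumes "subspace L" "(y has_vector_derivative w) (at 0)" "d > 0" "\<And>s. \<bar>s\<bar> < d \<Longrightarrow> y s \<in> L"
  shows "w \<in> L"
proof -
  have "w \<bullet> u = 0" if "u \<in> orthogonal_comp L" for u
  proof -
    have "((\<lambda>s. y s \<bullet> u) has_vector_derivative w \<bullet> u) (at 0)"
      using bounded_linear.has_vector_derivative[OF bounded_linear_inner_left assms(2)] .
    then have "((\<lambda>s. 0) has_vector_derivative w \<bullet> u) (at 0)"
      by (rule has_vector_derivative_transform_within_open[of _ _ _ "{-d<..<d}"])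
        (use assms(3,4) that in \<open>auto simp: orthogonal_comp_def real_inner_class.orthogonal_def inner_commute\<close>)
    then show ?thesis
      using vector_derivative_unique_at has_vector_derivative_const by blast
  qed
  then have "w \<in> orthogonal_comp (orthogonal_comp L)"
    by (auto simp: orthogonal_comp_def real_inner_class.orthogonal_def inner_commute)
  then show ?thesis using orthogonal_comp_self[OF assms(1)] by simp
qed

context
  fixes m :: nat and T :: "'a topology" and f :: "'a \<Rightarrow> 'e::euclidean_space" and U W V L \<phi> \<psi> g
  assumes lp: "local_param m T f U W V L \<phi> \<psi> g"
begin

lemma local_param_smooth_curve:
  assumes "\<And>t. t \<in> J \<Longrightarrow> x + t *\<^sub>R w \<in> V \<inter> L"
  shows "smooth_curve T f J (\<lambda>t. g (x + t *\<^sub>R w))"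
  unfolding smooth_curve_def
proof
  have "continuous_map (top_of_set J) (top_of_set (V \<inter> L)) (\<lambda>t. x + t *\<^sub>R w)"
    using assms by (auto simp: continuous_map_in_subtopology intro!: continuous_intros)
  moreover have "continuous_map (top_of_set (V \<inter> L)) T g" using lp by (simp add: local_param_def)
  ultimately have "continuous_map (top_of_set J) T (g \<circ> (\<lambda>t. x + t *\<^sub>R w))"
    by (rule continuous_map_compose)
  then show "continuous_map (top_of_set J) T (\<lambda>t. g (x + t *\<^sub>R w))" by (simp add: o_def)
  define O' where "O' = (\<lambda>t. x + t *\<^sub>R w) -` V"
  have O': "open O'" unfolding O'_def using lp
    by (intro open_vimage) (auto simp: local_param_def intro!: continuous_intros)
  have V: "open V" "Cinf_on V \<psi>" using lp by (simp_all add: local_param_def)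
  have "Cinf_on O' (\<lambda>t. \<psi> (x + t *\<^sub>R w))"
    by (rule Cinf_on_compose[OF O' V(1) _ V(2) Cinf_on_affine[OF O']]) (auto simp: O'_def)
  then show "smooth_map (top_of_set J) id (f \<circ> (\<lambda>t. g (x + t *\<^sub>R w)))"
    unfolding smooth_map_def
  proof (intro ballI exI conjI)
    show "openin (top_of_set J) J" by simp
    show "id ` J \<subseteq> O'" using assms by (auto simp: O'_def)
    show "(f \<circ> (\<lambda>t. g (x + t *\<^sub>R w))) t = \<psi> (x + id t *\<^sub>R w)" if "t \<in> J" for t
      using assms[OF that] lp by (simp add: local_param_def)
  qed (use O' in auto)
qed

text \<open>Straight lines in the parameter space realise all vectors in the image of the derivative of \<open>\<psi>\<close>.\<close>

lemma local_param_curve_through: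
  assumes "q \<in> U" "w \<in> L"
  shows "curve_through T f q (frechet_derivative \<psi> (at (\<phi> (f q))) w) (\<lambda>t. g (\<phi> (f q) + t *\<^sub>R w))"
proof -
  let ?x = "\<phi> (f q)"
  have x: "?x \<in> V \<inter> L" "g ?x = q" using lp assms by (auto simp: local_param_def)
  have V: "open V" "subspace L" "Cinf_on V \<psi>" using lp by (auto simp: local_param_def)
  then obtain e where e: "e > 0" "ball ?x e \<subseteq> V" using x open_contains_ball by blast
  define d where "d = e / (norm w + 1)"
  have d: "d > 0" using e by (auto simp: d_def intro!: divide_pos_pos add_nonneg_pos)
  have in_V: "?x + t *\<^sub>R w \<in> V \<inter> L" if "\<bar>t\<bar> < d" for t
  proof -
    have "\<bar>t\<bar> * norm w \<le> \<bar>t\<bar> * (norm w + 1)" by (simp add: mult_left_mono)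
    also have "\<dots> < e"
      using that norm_ge_zero[of w] by (simp add: d_def pos_less_divide_eq add_nonneg_pos)
    finally have "?x + t *\<^sub>R w \<in> ball ?x e" by (simp add: dist_norm)
    then have "?x + t *\<^sub>R w \<in> V" using e by blast
    moreover have "?x + t *\<^sub>R w \<in> L" using x V(2) assms by (auto intro!: subspace_add subspace_scale)
    ultimately show ?thesis by blast
  qed
  have "smooth_curve T f {-(d/2)..d/2} (\<lambda>t. g (?x + t *\<^sub>R w))"
    using d by (intro local_param_smooth_curve in_V) auto
  moreover have "((f \<circ> (\<lambda>t. g (?x + t *\<^sub>R w))) has_vector_derivative frechet_derivative \<psi> (at ?x) w) (at 0)"
  proof (rule has_vector_derivative_transform_within_open[of _ _ _ "{-d<..<d}"])
    have "((\<lambda>t. ?x + t *\<^sub>R w) has_vector_derivative w) (at 0)"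
      by (auto intro!: derivative_eq_intros)
    moreover have "(\<psi> has_derivative frechet_derivative \<psi> (at ?x)) (at (?x + 0 *\<^sub>R w))"
      using Cinf_on_derivative(1)[OF V(3)] x by simp
    ultimately show "(\<psi> \<circ> (\<lambda>t. ?x + t *\<^sub>R w) has_vector_derivative frechet_derivative \<psi> (at ?x) w) (at 0)"
      using vector_derivative_diff_chain_within[of "\<lambda>t. ?x + t *\<^sub>R w" w 0 UNIV \<psi>]
      by (auto intro: has_derivative_at_withinI)
  qed (use d in_V lp in \<open>auto simp: local_param_def\<close>)
  ultimately show ?thesis
    unfolding curve_through_def using d x by (auto intro!: exI[of _ "d/2"])
qed

text \<open>In particular the derivative of \<open>\<psi>\<close> is injective, with a bound for its inverse.\<close>

lemma local_param_chain:
  assumes "x \<in> V"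
  shows "frechet_derivative \<phi> (at (\<psi> x)) (frechet_derivative \<psi> (at x) w) = w"
proof -
  have 1: "(\<psi> has_derivative frechet_derivative \<psi> (at x)) (at x)"
    using assms lp by (auto intro!: Cinf_on_derivative(1) simp: local_param_def)
  have 2: "(\<phi> has_derivative frechet_derivative \<phi> (at (\<psi> x))) (at (\<psi> x))"
    using assms lp by (intro Cinf_on_derivative(1)[of W]) (auto simp: local_param_def)
  have "((\<lambda>x. \<phi> (\<psi> x)) has_derivative (\<lambda>w. frechet_derivative \<phi> (at (\<psi> x)) (frechet_derivative \<psi> (at x) w))) (at x)"
    using has_derivative_compose[OF 1 2] .
  moreover have "((\<lambda>x. \<phi> (\<psi> x)) has_derivative (\<lambda>w. w)) (at x)"
    by (rule has_derivative_transform_within_open[OF has_derivative_ident, of V])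
      (use assms lp in \<open>auto simp: local_param_def\<close>)
  ultimately show ?thesis using has_derivative_unique by metis
qed

text \<open>A curve through \<open>q\<close>, read in the chart, stays in \<open>L\<close>, so its velocity does too; the other
  inclusion is given by straight lines in the parameter space.\<close>

lemma local_param_tangent_space:
  assumes "q \<in> U"
  shows "tangent_space T f q = frechet_derivative \<psi> (at (\<phi> (f q))) ` L"
proof
  show "frechet_derivative \<psi> (at (\<phi> (f q))) ` L \<subseteq> tangent_space T f q"
    using local_param_curve_through[OF assms] by (auto simp: tangent_space_def)
next
  let ?x = "\<phi> (f q)"
  have x: "?x \<in> V \<inter> L" "g ?x = q" "\<psi> ?x = f q" using lp assms by (auto simp: local_param_def)
  have 1: "(\<psi> has_derivative frechet_derivative \<psi> (at ?x)) (at ?x)"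
    using x lp by (auto intro!: Cinf_on_derivative(1) simp: local_param_def)
  have 2: "(\<phi> has_derivative frechet_derivative \<phi> (at (f q))) (at (f q))"
    using assms lp by (intro Cinf_on_derivative(1)[of W]) (auto simp: local_param_def)
  show "tangent_space T f q \<subseteq> frechet_derivative \<psi> (at ?x) ` L"
  proof
    fix v assume "v \<in> tangent_space T f q"
    then obtain c where c: "curve_through T f q v c" by (auto simp: tangent_space_def)
    have "openin T U" using lp by (simp add: local_param_def)
    then have hp: "has_tangential_derivative T f (\<lambda>q. \<phi> (f q)) (frechet_derivative \<phi> (at (f q))) q"
      by (rule has_tangential_derivativeI) (use assms 2 in auto)
    define w where "w = frechet_derivative \<phi> (at (f q)) v"
    have w: "((\<lambda>t. \<phi> (f (c t))) has_vector_derivative w) (at 0)"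
      using has_tangential_derivative_curve[OF hp c] by (simp add: w_def o_def)
    obtain d where d: "d > 0" "\<And>s. \<bar>s\<bar> < d \<Longrightarrow> c s \<in> U"
      using curve_through_stays[OF c \<open>openin T U\<close> assms] by blast
    have wL: "w \<in> L"
      by (rule vector_derivative_in_subspace[OF _ w d(1)]) (use d(2) lp in \<open>auto simp: local_param_def\<close>)
    have c0: "c 0 = q" and cv: "((f \<circ> c) has_vector_derivative v) (at 0)"
      using c by (auto simp: curve_through_def)
    have "((\<psi> \<circ> (\<lambda>t. \<phi> (f (c t)))) has_vector_derivative frechet_derivative \<psi> (at ?x) w) (at 0)"
      using vector_derivative_diff_chain_within[of "\<lambda>t. \<phi> (f (c t))" w 0 UNIV \<psi>] w 1 c0
      by (auto intro: has_derivative_at_withinI)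
    then have "((f \<circ> c) has_vector_derivative frechet_derivative \<psi> (at ?x) w) (at 0)"
      by (rule has_vector_derivative_transform_within_open[of _ _ _ "{-d<..<d}"])
        (use d lp in \<open>auto simp: local_param_def\<close>)
    then show "v \<in> frechet_derivative \<psi> (at ?x) ` L"
      using wL cv vector_derivative_unique_at by blast
  qed
qed

end

section \<open>Piecewise smooth curves and the intrinsic distance\<close>

lemma has_derivative_imp_has_vector_derivative:
  fixes H :: "real \<Rightarrow> 'b::real_normed_vector"
  assumes "(H has_derivative D) F"
  shows "(H has_vector_derivative D 1) F"
proof -
  have "D = (\<lambda>x. x *\<^sub>R D 1)"
  proof
    show "D x = x *\<^sub>R D 1" for x
      using linear_scale[OF has_derivative_linear[OF assms], of x 1] by simp
  qed
  then have eq: "(\<lambda>x. x *\<^sub>R D 1) = D" by (rule sym)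
  show ?thesis unfolding has_vector_derivative_def eq by (rule assms)
qed

text \<open>Smoothness up to the end points: the one-sided derivatives fit the interior ones continuously,
  because the map is locally the restriction of a smooth map of the line.\<close>

lemma smooth_map_interval_derivative:
  fixes F :: "real \<Rightarrow> 'b::euclidean_space"
  assumes "smooth_map (top_of_set {a..b}) id F" "a < b"
  shows "continuous_on {a..b} (\<lambda>t. vector_derivative F (at t within {a..b}))"
    and "\<And>t. t \<in> {a..b} \<Longrightarrow>
      (F has_vector_derivative vector_derivative F (at t within {a..b})) (at t within {a..b})"
proof -
  let ?D = "\<lambda>t. vector_derivative F (at t within {a..b})"
  have *: "\<exists>d>0. continuous_on ({a..b} \<inter> ball t d) ?D \<and> (F has_vector_derivative ?D t) (at t within {a..b})"
    if t: "t \<in> {a..b}" for t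
  proof -
    have "t \<in> topspace (top_of_set {a..b})" using t by simp
    then obtain U W H where U: "openin (top_of_set {a..b}) U" "t \<in> U" "open W" "id ` U \<subseteq> W" "Cinf_on W H"
      "\<forall>q\<in>U. F q = H (id q)" using assms(1) unfolding smooth_map_def by meson
    obtain G where G: "open G" "U = {a..b} \<inter> G" using U(1) by (auto simp: openin_open)
    then obtain d where d: "d > 0" "ball t d \<subseteq> G" using U(2) open_contains_ball by blast
    have D: "(F has_vector_derivative frechet_derivative H (at s) 1) (at s within {a..b})"
      if s: "s \<in> {a..b} \<inter> ball t d" for s
    proof -
      have sU: "s \<in> U" using s d G by blast
      then have "(H has_derivative frechet_derivative H (at s)) (at s)"
        using Cinf_on_derivative(1)[OF U(5)] U(4) by auto
      then have "(H has_vector_derivative frechet_derivative H (at s) 1) (at s within {a..b})"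
        by (rule has_vector_derivative_at_within[OF has_derivative_imp_has_vector_derivative])
      note H = this
      have eq: "H x = F x" if x: "x \<in> {a..b}" "dist x s < d - dist t s" for x
      proof -
        have "dist t x \<le> dist t s + dist s x" by (rule dist_triangle)
        then have "x \<in> ball t d" using x(2) by (simp add: dist_commute)
        then have "x \<in> U" using d G x by blast
        then show ?thesis using U(6) by simp
      qed
      show ?thesis
        by (rule has_vector_derivative_transform_within[OF H _ _ eq]) (use s in auto)
    qed
    have Deq: "?D s = frechet_derivative H (at s) 1" if "s \<in> {a..b} \<inter> ball t d" for s
      using vector_derivative_within_cbox[OF assms(2), of s F, unfolded cbox_interval, OF _ D[OF that]] that by auto
    have "continuous_on ({a..b} \<inter> ball t d) (\<lambda>s. frechet_derivative H (at s) 1)"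
      using Cinf_on_continuous[OF Cinf_on_derivative(2)[OF U(5)]] by (rule continuous_on_subset) (use d G U(4) in auto)
    then have "continuous_on ({a..b} \<inter> ball t d) ?D"
      by (rule continuous_on_eq) (rule Deq[symmetric])
    then show ?thesis using D[of t] Deq[of t] d t by auto
  qed
  show "\<And>t. t \<in> {a..b} \<Longrightarrow> (F has_vector_derivative ?D t) (at t within {a..b})"
    using * by blast
  show "continuous_on {a..b} ?D"
    unfolding continuous_on_eq_continuous_within
  proof
    fix t assume t: "t \<in> {a..b}"
    then obtain d where d: "d > 0" "continuous_on ({a..b} \<inter> ball t d) ?D" using * by blast
    then have "continuous (at t within ({a..b} \<inter> ball t d)) ?D"
      using t by (auto simp: continuous_on_eq_continuous_within)
    moreover have "at t within ({a..b} \<inter> ball t d) = at t within {a..b}"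
      using d t by (intro at_within_nhd[of _ "ball t d"]) auto
    ultimately show "continuous (at t within {a..b}) ?D" by simp
  qed
qed

lemma smooth_map_interval_has_vector_derivative_interior:
  fixes F :: "real \<Rightarrow> 'b::euclidean_space"
  assumes "smooth_map (top_of_set {a..b}) id F" "t \<in> {a<..<b}"
  shows "(F has_vector_derivative vector_derivative F (at t within {a..b})) (at t)"
proof -
  have "at t within {a..b} = at t" using assms(2) by (intro at_within_interior) auto
  then show ?thesis using smooth_map_interval_derivative(2)[OF assms(1), of t] assms(2) by auto
qed

lemma smooth_map_cong:
  assumes "smooth_map T f h" "\<And>q. q \<in> topspace T \<Longrightarrow> h q = k q"
  shows "smooth_map T f k"
  unfolding smooth_map_def
proof
  fix p assume p: "p \<in> topspace T"
  then obtain U W H where U: "openin T U" "p \<in> U" "open W" "f ` U \<subseteq> W" "Cinf_on W H" "\<forall>q\<in>U. h q = H (f q)"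
    using assms(1) unfolding smooth_map_def by meson
  have "\<forall>q\<in>U. k q = H (f q)" using U(1,6) assms(2) openin_subset by fastforce
  then show "\<exists>U W H. openin T U \<and> p \<in> U \<and> open W \<and> f ` U \<subseteq> W \<and> Cinf_on W H \<and> (\<forall>q\<in>U. k q = H (f q))"
    using U by blast
qed

lemma smooth_map_affine_reparam:
  assumes "smooth_map (top_of_set J) id F" "\<And>t. t \<in> J' \<Longrightarrow> r * t + s \<in> J"
  shows "smooth_map (top_of_set J') id (\<lambda>t::real. F (r * t + s :: real))"
  unfolding smooth_map_def
proof
  fix t assume t: "t \<in> topspace (top_of_set J')"
  then have "r * t + s \<in> topspace (top_of_set J)" using assms(2) by simp
  then obtain U W H where U: "openin (top_of_set J) U" "r * t + s \<in> U" "open W" "id ` U \<subseteq> W" "Cinf_on W H"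
      "\<forall>q\<in>U. F q = H (id q)" using assms(1) unfolding smooth_map_def by meson
  obtain G where G: "open G" "U = J \<inter> G" using U(1) by (auto simp: openin_open)
  let ?a = "\<lambda>t. s + t *\<^sub>R r"
  have op: "open (?a -` W)" "open (?a -` G)"
    using U G by (intro open_vimage; auto intro!: continuous_intros)+
  have "Cinf_on (?a -` W) (\<lambda>t. H (?a t))"
    by (rule Cinf_on_compose[OF op(1) U(3) _ U(5) Cinf_on_affine[OF op(1)]]) auto
  then show "\<exists>U W H. openin (top_of_set J') U \<and> t \<in> U \<and> open W \<and> id ` U \<subseteq> W \<and> Cinf_on W H \<and>
      (\<forall>q\<in>U. F (r * q + s) = H (id q))"
    using op U G t assms(2)
    by (intro exI[of _ "J' \<inter> ?a -` G"] exI[of _ "?a -` W"] exI[of _ "\<lambda>t. H (?a t)"])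
      (auto simp: algebra_simps)
qed

lemma smooth_curve_affine_reparam:
  assumes "smooth_curve T f J c" "\<And>t. t \<in> J' \<Longrightarrow> r * t + s \<in> J" "\<And>t. t \<in> J' \<Longrightarrow> c' t = c (r * t + s)"
  shows "smooth_curve T f J' c'"
  unfolding smooth_curve_def
proof
  have "continuous_map (top_of_set J') (top_of_set J) (\<lambda>t. r * t + s)"
    using assms(2) by (auto simp: continuous_map_in_subtopology intro!: continuous_intros)
  then have "continuous_map (top_of_set J') T (c \<circ> (\<lambda>t. r * t + s))"
    using assms(1) continuous_map_compose unfolding smooth_curve_def by blast
  then show "continuous_map (top_of_set J') T c'"
    by (rule continuous_map_eq) (use assms(3) in auto)
  have "smooth_map (top_of_set J') id (\<lambda>t. (f \<circ> c) (r * t + s))"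
    using smooth_map_affine_reparam[OF _ assms(2)] assms(1) unfolding smooth_curve_def by blast
  then show "smooth_map (top_of_set J') id (f \<circ> c')"
    by (rule smooth_map_cong) (use assms(3) in auto)
qed

lemma smooth_curve_subset: "smooth_curve T f J c \<Longrightarrow> J' \<subseteq> J \<Longrightarrow> smooth_curve T f J' c"
  by (rule smooth_curve_affine_reparam[where r = 1 and s = 0 and J = J]) auto

text \<open>The form in which piecewise smoothness is used: a property of intervals that is additive and holds
  inside the pieces holds on every subinterval of \<open>[0, 1]\<close>.\<close>

lemma subdivided_interval_induct:
  assumes "subdivided Q" "0 \<le> u" "u \<le> v" "v \<le> 1"
    and piece: "\<And>a b u v. Q {a..b} \<Longrightarrow> 0 \<le> a \<Longrightarrow> b \<le> 1 \<Longrightarrow> a < b \<Longrightarrow> a \<le> u \<Longrightarrow> u \<le> v \<Longrightarrow> v \<le> b \<Longrightarrow> P u v"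
    and trans: "\<And>u v w. 0 \<le> u \<Longrightarrow> u \<le> v \<Longrightarrow> v \<le> w \<Longrightarrow> w \<le> 1 \<Longrightarrow> P u v \<Longrightarrow> P v w \<Longrightarrow> P u w"
  shows "P u v"
proof -
  obtain N and s :: "nat \<Rightarrow> real" where s: "s 0 = 0" "s N = 1" "\<forall>i<N. s i < s (Suc i) \<and> Q {s i..s (Suc i)}"
    using assms(1) unfolding subdivided_def by blast
  have mono: "s i \<le> s j" if "i \<le> j" "j \<le> N" for i j
    using that
  proof (induction j)
    case (Suc j)
    then have "s j < s (Suc j)" "i \<noteq> Suc j \<Longrightarrow> s i \<le> s j" using s(3) by auto
    then show ?case by (cases "i = Suc j") auto
  qed simp
  have bd: "0 \<le> s i" "s i \<le> 1" if "i \<le> N" for i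
    using mono[of 0 i] mono[of i N] s that by auto
  have "N > 0" using s(1,2) by (cases N) auto
  have "\<forall>u v. 0 \<le> u \<longrightarrow> u \<le> v \<longrightarrow> v \<le> s i \<longrightarrow> P u v" if "i \<le> N" for i
    using that
  proof (induction i)
    case 0
    have "P 0 0" using piece[of "s 0" "s 1" 0 0] s \<open>N > 0\<close> bd[of 0] bd[of 1] by auto
    then show ?case using s(1) by (auto dest: order_antisym)
  next
    case (Suc i)
    have sm: "P u v" if "s i \<le> u" "u \<le> v" "v \<le> s (Suc i)" for u v
      using piece[of "s i" "s (Suc i)" u v] s(3) bd[of i] bd[of "Suc i"] that Suc.prems by auto
    show ?case
    proof (intro allI impI)
      fix u v assume uv: "0 \<le> u" "u \<le> v" "v \<le> s (Suc i)"
      consider "v \<le> s i" | "s i \<le> u" | "u \<le> s i" "s i \<le> v" by linarith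
      then show "P u v"
      proof cases
        case 3
        then show ?thesis
          using trans[of u "s i" v] Suc uv sm[of "s i" v] bd[of "Suc i"] by auto
      qed (use Suc uv sm in auto)
    qed
  qed
  from this[OF order_refl] show ?thesis using assms(2-4) s(2) by auto
qed

abbreviation speed :: "('a \<Rightarrow> 'e::euclidean_space) \<Rightarrow> (real \<Rightarrow> 'a) \<Rightarrow> real \<Rightarrow> real" where
  "speed f c t \<equiv> norm (vector_derivative (f \<circ> c) (at t))"

lemma smooth_curve_speed:
  assumes c: "smooth_curve T f {a..b} c" and ab: "a < b" and uv: "a \<le> u" "u \<le> v" "v \<le> b"
  shows "speed f c integrable_on {u..v}" "norm (f (c v) - f (c u)) \<le> integral {u..v} (speed f c)"
    and "\<And>t. t \<in> {a<..<b} \<Longrightarrow> (f \<circ> c) differentiable (at t)"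
proof -
  have sm: "smooth_map (top_of_set {a..b}) id (f \<circ> c)" using c by (simp add: smooth_curve_def)
  define D where "D t = vector_derivative (f \<circ> c) (at t within {a..b})" for t
  note D = smooth_map_interval_derivative[OF sm ab, folded D_def]
  have Di: "(f \<circ> c has_vector_derivative D t) (at t)" if "t \<in> {a<..<b}" for t
    using smooth_map_interval_has_vector_derivative_interior[OF sm that] by (simp add: D_def)
  then show "\<And>t. t \<in> {a<..<b} \<Longrightarrow> (f \<circ> c) differentiable (at t)"
    using differentiableI_vector by blast
  have sp: "speed f c t = norm (D t)" if "t \<in> {a<..<b}" for t
    using vector_derivative_at[OF Di[OF that]] by simp
  have cD: "continuous_on {u..v} D" using D(1) uv continuous_on_subset by fastforce
  then have I: "(\<lambda>t. norm (D t)) integrable_on {u..v}"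
    by (intro integrable_continuous_interval continuous_intros)
  show "speed f c integrable_on {u..v}"
    by (rule integrable_spike_finite[OF _ _ I, of "{a,b}"]) (use sp uv in auto)
  have "((D has_integral (f \<circ> c) v - (f \<circ> c) u) {u..v})"
  proof (rule fundamental_theorem_of_calculus[OF uv(2)])
    fix x assume "x \<in> {u..v}"
    then show "(f \<circ> c has_vector_derivative D x) (at x within {u..v})"
      using has_vector_derivative_within_subset[OF D(2)[of x], of "{u..v}"] uv by auto
  qed
  then have "norm ((f \<circ> c) v - (f \<circ> c) u) \<le> integral {u..v} (\<lambda>t. norm (D t))"
    using I integral_norm_bound_integral[of D "{u..v}" "\<lambda>t. norm (D t)"]
    by (metis has_integral_integrable_integral order_refl)
  also have "\<dots> = integral {u..v} (speed f c)"
    by (rule integral_spike[of "{a,b}"]) (use sp uv in auto)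
  finally show "norm (f (c v) - f (c u)) \<le> integral {u..v} (speed f c)" by simp
qed

lemma pw_smooth_curve_speed:
  assumes c: "pw_smooth_curve T f c" and uv: "0 \<le> u" "u \<le> v" "v \<le> 1"
  shows "speed f c integrable_on {u..v} \<and> norm (f (c v) - f (c u)) \<le> integral {u..v} (speed f c)"
proof (rule subdivided_interval_induct[OF c[unfolded pw_smooth_curve_def] uv])
  fix u v w assume *: "u \<le> v" "v \<le> w"
    "speed f c integrable_on {u..v} \<and> norm (f (c v) - f (c u)) \<le> integral {u..v} (speed f c)"
    "speed f c integrable_on {v..w} \<and> norm (f (c w) - f (c v)) \<le> integral {v..w} (speed f c)"
  have "speed f c integrable_on {u..w}" using Henstock_Kurzweil_Integration.integrable_combine[OF *(1,2) *(3)[THEN conjunct1] *(4)[THEN conjunct1]] .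
  moreover have "integral {u..w} (speed f c) = integral {u..v} (speed f c) + integral {v..w} (speed f c)"
    using Henstock_Kurzweil_Integration.integral_combine[OF *(1,2) calculation] by simp
  moreover have "norm (f (c w) - f (c u)) \<le> norm (f (c v) - f (c u)) + norm (f (c w) - f (c v))"
    using norm_triangle_ineq[of "f (c v) - f (c u)" "f (c w) - f (c v)"] by simp
  ultimately show "speed f c integrable_on {u..w} \<and> norm (f (c w) - f (c u)) \<le> integral {u..w} (speed f c)"
    using * by simp
qed (use smooth_curve_speed in blast)

lemma pw_smooth_curve_differentiable:
  assumes c: "pw_smooth_curve T f c"
  obtains S where "finite S" "\<And>t. t \<in> {0..1} - S \<Longrightarrow> (f \<circ> c) differentiable (at t)"
proof -
  have "\<exists>S. finite S \<and> (\<forall>t\<in>{0..1} - S. (f \<circ> c) differentiable (at t))"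
  proof (rule subdivided_interval_induct[OF c[unfolded pw_smooth_curve_def], of 0 1])
    fix a b u v assume *: "smooth_curve T f {a..b} c" "a < b" "a \<le> u" "u \<le> v" "v \<le> b"
    show "\<exists>S. finite S \<and> (\<forall>t\<in>{u..v} - S. (f \<circ> c) differentiable (at t))"
      using smooth_curve_speed(3)[OF *] * by (intro exI[of _ "{a,b}"]) auto
  next
    fix u v w assume *: "u \<le> v" "v \<le> w" "\<exists>S. finite S \<and> (\<forall>t\<in>{u..v} - S. (f \<circ> c) differentiable (at t))"
       "\<exists>S. finite S \<and> (\<forall>t\<in>{v..w} - S. (f \<circ> c) differentiable (at t))"
    then obtain S S' where S: "finite S" "\<forall>t\<in>{u..v} - S. (f \<circ> c) differentiable (at t)"
      "finite S'" "\<forall>t\<in>{v..w} - S'. (f \<circ> c) differentiable (at t)" by blast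
    show "\<exists>S. finite S \<and> (\<forall>t\<in>{u..w} - S. (f \<circ> c) differentiable (at t))"
    proof (intro exI[of _ "S \<union> S'"] conjI ballI)
      fix t assume t: "t \<in> {u..w} - (S \<union> S')"
      show "(f \<circ> c) differentiable (at t)"
      proof (cases "t \<le> v")
        case True then show ?thesis using S(2) t by auto
      next
        case False then show ?thesis using S(4) t by auto
      qed
    qed (use S in auto)
  qed auto
  then show thesis using that by blast
qed

text \<open>Lengths are invariant under affine changes of parameter. The exceptional set \<open>S\<close> contains the break
  points, where the two-sided derivative may fail to exist.\<close>

lemma speed_affine_reparam:
  assumes S: "finite S" "\<And>t. t \<in> {a..b} - S \<Longrightarrow> (f \<circ> c) differentiable (at t)"
    and I: "speed f c integrable_on {a..b}"
    and r: "r \<noteq> 0" "(\<lambda>x. (x - s) / r) ` {a..b} = {u..v}"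
    and c': "\<And>t. t \<in> {u<..<v} \<Longrightarrow> c' t = c (r * t + s)"
  shows "(speed f c' has_integral integral {a..b} (speed f c)) {u..v}"
proof -
  have "((\<lambda>x. speed f c (r *\<^sub>R x + s)) has_integral (1 / \<bar>r\<bar> ^ DIM(real)) *\<^sub>R integral {a..b} (speed f c))
      ((\<lambda>x. (1 / r) *\<^sub>R x + - ((1 / r) *\<^sub>R s)) ` cbox a b)"
    using I by (intro has_integral_affinity r) (auto intro: integrable_integral simp only: cbox_interval)
  moreover have "(\<lambda>x. (1 / r) *\<^sub>R x + - ((1 / r) *\<^sub>R s)) ` cbox a b = {u..v}"
    unfolding r(2)[symmetric] cbox_interval by (intro image_cong) (auto simp: field_simps r)
  ultimately have "((\<lambda>x. speed f c (r * x + s)) has_integral (1 / \<bar>r\<bar>) * integral {a..b} (speed f c)) {u..v}"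
    by simp
  from has_integral_mult_right[OF this, of "\<bar>r\<bar>"]
  have *: "((\<lambda>x. \<bar>r\<bar> * speed f c (r * x + s)) has_integral integral {a..b} (speed f c)) {u..v}"
    using r(1) by simp
  show ?thesis
  proof (rule has_integral_spike_finite[OF _ _ *])
    show "finite ({u,v} \<union> (\<lambda>x. (x - s) / r) ` S)" using S by auto
    fix t assume t: "t \<in> {u..v} - ({u,v} \<union> (\<lambda>x. (x - s) / r) ` S)"
    then obtain x where x: "x \<in> {a..b}" "t = (x - s) / r" using r(2) by blast
    then have rx: "r * t + s = x" using r(1) by simp
    have "x \<notin> S" using t x by blast
    then have "(f \<circ> c has_vector_derivative vector_derivative (f \<circ> c) (at x)) (at x)"
      using S(2) x(1) vector_derivative_works by blast
    moreover have "((\<lambda>t. r * t + s) has_vector_derivative r) (at t)"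
      by (auto intro!: derivative_eq_intros)
    ultimately have "((f \<circ> c) \<circ> (\<lambda>t. r * t + s) has_vector_derivative r *\<^sub>R vector_derivative (f \<circ> c) (at x)) (at t)"
      using vector_diff_chain_at[of "\<lambda>t. r * t + s" r t "f \<circ> c"] rx by simp
    then have "(f \<circ> c' has_vector_derivative r *\<^sub>R vector_derivative (f \<circ> c) (at x)) (at t)"
      by (rule has_vector_derivative_transform_within_open[of _ _ _ "{u<..<v}"]) (use t c' in auto)
    then show "speed f c' t = \<bar>r\<bar> * speed f c (r * t + s)"
      using vector_derivative_at rx by fastforce
  qed
qed

lemma riem_dist_le_curve_length:
  "pw_smooth_curve T f c \<Longrightarrow> c 0 = p \<Longrightarrow> c 1 = q \<Longrightarrow> riem_dist T f p q \<le> ereal (curve_length f c)"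
  unfolding riem_dist_def by (rule INF_lower) auto

lemma riem_dist_lessE:
  assumes "riem_dist T f p q < x"
  obtains c where "pw_smooth_curve T f c" "c 0 = p" "c 1 = q" "ereal (curve_length f c) < x"
  using assms unfolding riem_dist_def INF_less_iff by blast

lemma chord_le_curve_length:
  assumes "pw_smooth_curve T f c" "t \<in> {0..1}"
  shows "norm (f (c t) - f (c 0)) \<le> curve_length f c"
proof -
  have "norm (f (c t) - f (c 0)) \<le> integral {0..t} (speed f c)"
    using pw_smooth_curve_speed[OF assms(1), of 0 t] assms(2) by auto
  also have "\<dots> \<le> integral {0..1} (speed f c)"
    using pw_smooth_curve_speed[OF assms(1), of 0 t] pw_smooth_curve_speed[OF assms(1), of 0 1] assms(2)
    by (intro integral_subset_le) auto
  finally show ?thesis by (simp add: curve_length_def)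
qed

lemma chord_le_riem_dist: "ereal (norm (f p - f q)) \<le> riem_dist T f p q"
  unfolding riem_dist_def
  by (rule INF_greatest) (use chord_le_curve_length[where t = 1] in \<open>fastforce simp: norm_minus_commute\<close>)

lemma riem_dist_nonneg: "0 \<le> riem_dist T f p q"
  using chord_le_riem_dist[of f p q T] by (metis ereal_less_eq(5) norm_ge_zero order_trans)

lemma riem_dist_smooth_curve:
  assumes c: "smooth_curve T f {a..b} c" and uv: "a \<le> u" "u < v" "v \<le> b"
  shows "riem_dist T f (c u) (c v) \<le> ereal (integral {u..v} (speed f c))"
proof -
  let ?c = "\<lambda>t. c ((v - u) * t + u)"
  have "(v - u) * t + u \<in> {u..v}" if "t \<in> {0..1}" for t
  proof -
    have "(v - u) * t \<le> v - u" "0 \<le> (v - u) * t"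
      using that uv mult_left_le[of t "v - u"] mult_nonneg_nonneg[of "v - u" t] by auto
    then show ?thesis by simp
  qed
  then have "smooth_curve T f {0..1} ?c"
    using smooth_curve_affine_reparam[OF smooth_curve_subset[OF c, of "{u..v}"], of "{0..1}" "v - u" u] uv by auto
  then have pw: "pw_smooth_curve T f ?c"
    unfolding pw_smooth_curve_def subdivided_def
    by (intro exI[of _ 1] exI[of _ "\<lambda>i. real i"]) auto
  have img: "(\<lambda>x. (x - u) / (v - u)) ` {u..v} = {0..1}"
  proof -
    have "x \<in> (\<lambda>x. (x - u) / (v - u)) ` {u..v}" if x: "x \<in> {0..1}" for x
    proof (rule image_eqI)
      show "x = ((v - u) * x + u - u) / (v - u)" using uv by simp
      have "(v - u) * x \<le> v - u" "0 \<le> (v - u) * x"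
        using x uv mult_left_le[of x "v - u"] mult_nonneg_nonneg[of "v - u" x] by auto
      then show "(v - u) * x + u \<in> {u..v}" by simp
    qed
    then show ?thesis using uv by (auto simp: divide_simps)
  qed
  have "(speed f ?c has_integral integral {u..v} (speed f c)) {0..1}"
    by (rule speed_affine_reparam[of "{a,b}" u v f c "v - u" u])
      (use smooth_curve_speed[OF c, of u v] uv img in auto)
  then have "curve_length f ?c = integral {u..v} (speed f c)"
    unfolding curve_length_def by (rule integral_unique)
  then show ?thesis using riem_dist_le_curve_length[OF pw] by simp
qed

lemma riem_dist_self: "p \<in> topspace T \<Longrightarrow> riem_dist T f p p = 0"
proof -
  assume p: "p \<in> topspace T"
  have "smooth_curve T f {0..1} (\<lambda>_. p)"
    using p by (auto simp: smooth_curve_def o_def smooth_map_const)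
  then have "pw_smooth_curve T f (\<lambda>_. p)"
    unfolding pw_smooth_curve_def subdivided_def
    by (intro exI[of _ 1] exI[of _ "\<lambda>i. real i"]) auto
  from riem_dist_le_curve_length[OF this, of p p]
  have "riem_dist T f p p \<le> 0" by (simp add: curve_length_def o_def flip: zero_ereal_def)
  then show ?thesis using riem_dist_nonneg[of T f p p] by simp
qed

text \<open>Both curves are run through at double speed, one after the other.\<close>

lemma riem_dist_concat:
  assumes c1: "pw_smooth_curve T f c1" and c2: "pw_smooth_curve T f c2" and eq: "c1 1 = c2 0"
  shows "riem_dist T f (c1 0) (c2 1) \<le> ereal (curve_length f c1 + curve_length f c2)"
proof -
  define c where "c t = (if t \<le> 1/2 then c1 (2 * t + 0) else c2 (2 * t + - 1))" for t :: real
  obtain N1 and s1 :: "nat \<Rightarrow> real" where s1: "s1 0 = 0" "s1 N1 = 1"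
    "\<And>i. i < N1 \<Longrightarrow> s1 i < s1 (Suc i)" "\<And>i. i < N1 \<Longrightarrow> smooth_curve T f {s1 i..s1 (Suc i)} c1"
    using c1 unfolding pw_smooth_curve_def subdivided_def by blast
  obtain N2 and s2 :: "nat \<Rightarrow> real" where s2: "s2 0 = 0" "s2 N2 = 1"
    "\<And>i. i < N2 \<Longrightarrow> s2 i < s2 (Suc i)" "\<And>i. i < N2 \<Longrightarrow> smooth_curve T f {s2 i..s2 (Suc i)} c2"
    using c2 unfolding pw_smooth_curve_def subdivided_def by blast
  have mono1: "s1 i \<le> 1" if "i \<le> N1" for i
    using that
  proof (induction i rule: inc_induct)
    case (step n)
    then show ?case using s1(3)[of n] by linarith
  qed (simp add: s1)
  have mono2: "0 \<le> s2 i" if "i \<le> N2" for i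
    using that
  proof (induction i)
    case (Suc i)
    then show ?case using s2(3)[of i] by simp
  qed (simp add: s2)
  define s where "s i = (if i \<le> N1 then s1 i / 2 else (1 + s2 (i - N1)) / 2)" for i
  have piece: "s i < s (Suc i) \<and> smooth_curve T f {s i..s (Suc i)} c" if i: "i < N1 + N2" for i
  proof (cases "i < N1")
    case True
    have "smooth_curve T f {s i..s (Suc i)} c"
      by (rule smooth_curve_affine_reparam[OF s1(4)[OF True], of _ 2 0])
        (use True mono1[of "Suc i"] in \<open>auto simp: s_def c_def\<close>)
    then show ?thesis using s1(3)[OF True] True by (simp add: s_def)
  next
    case False
    define j where "j = i - N1"
    have j: "i = N1 + j" "j < N2" using False i by (auto simp: j_def)
    have si: "s i = (1 + s2 j) / 2" "s (Suc i) = (1 + s2 (Suc j)) / 2"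
      using j s1(2) s2(1) by (auto simp: s_def Suc_diff_le)
    have "smooth_curve T f {s i..s (Suc i)} c"
    proof (rule smooth_curve_affine_reparam[OF s2(4)[OF j(2)], of _ 2 "-1"])
      fix t assume t: "t \<in> {s i..s (Suc i)}"
      then show "2 * t + - 1 \<in> {s2 j..s2 (Suc j)}" using si by auto
      have "t \<ge> 1/2" using t si mono2[of j] j by auto
      then consider "t = 1/2" | "t > 1/2" by linarith
      then show "c t = c2 (2 * t + - 1)" 
      proof cases
        case 1 show ?thesis unfolding 1 c_def using eq by simp
      qed (auto simp: c_def)
    qed
    moreover have "s i < s (Suc i)" using si s2(3)[OF j(2)] by simp
    ultimately show ?thesis by blast
  qed
  have "N2 > 0" using s2(1,2) by (cases N2) auto
  then have pw: "pw_smooth_curve T f c"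
    unfolding pw_smooth_curve_def subdivided_def using s1(1) s2(2) piece
    by (intro exI[of _ "N1 + N2"] exI[of _ s]) (auto simp: s_def)
  obtain S1 where S1: "finite S1" "\<And>t. t \<in> {0..1} - S1 \<Longrightarrow> (f \<circ> c1) differentiable (at t)"
    using pw_smooth_curve_differentiable[OF c1] by blast
  obtain S2 where S2: "finite S2" "\<And>t. t \<in> {0..1} - S2 \<Longrightarrow> (f \<circ> c2) differentiable (at t)"
    using pw_smooth_curve_differentiable[OF c2] by blast
  have "(\<lambda>x. (x - 0) / 2) ` {0..1::real} = {0..1/2}"
    by (auto intro!: image_eqI[of _ _ "2 * _"])
  then have 1: "(speed f c has_integral curve_length f c1) {0..1/2}"
    unfolding curve_length_def
    by (intro speed_affine_reparam[OF S1, where r = 2 and s = 0])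
      (use pw_smooth_curve_speed[OF c1, of 0 1] in \<open>auto simp: c_def\<close>)
  have "(\<lambda>x. (x - - 1) / 2) ` {0..1::real} = {1/2..1}"
    by (auto intro!: image_eqI[of _ _ "2 * _ - 1"])
  then have 2: "(speed f c has_integral curve_length f c2) {1/2..1}"
    unfolding curve_length_def
    by (intro speed_affine_reparam[OF S2, where r = 2 and s = "-1"])
      (use pw_smooth_curve_speed[OF c2, of 0 1] in \<open>auto simp: c_def\<close>)
  have "(speed f c has_integral curve_length f c1 + curve_length f c2) {0..1}"
    by (rule has_integral_combine[OF _ _ 1 2]) auto
  then have "curve_length f c = curve_length f c1 + curve_length f c2"
    unfolding curve_length_def by (rule integral_unique)
  moreover have "c 0 = c1 0" "c 1 = c2 1" by (auto simp: c_def)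
  ultimately show ?thesis using riem_dist_le_curve_length[OF pw, of "c1 0" "c2 1"] by simp
qed

lemma riem_dist_triangle:
  "riem_dist T f p r \<le> riem_dist T f p q + riem_dist T f q r"
proof -
  have "riem_dist T f p r \<le> x + y" if x: "riem_dist T f p q < x" and y: "riem_dist T f q r < y" for x y
  proof -
    obtain c1 c2 where c: "pw_smooth_curve T f c1" "c1 0 = p" "c1 1 = q" "ereal (curve_length f c1) < x"
      "pw_smooth_curve T f c2" "c2 0 = q" "c2 1 = r" "ereal (curve_length f c2) < y"
      using riem_dist_lessE[OF x] riem_dist_lessE[OF y] by metis
    have "riem_dist T f p r \<le> ereal (curve_length f c1) + ereal (curve_length f c2)"
      using riem_dist_concat[OF c(1,5)] c by simp
    also have "\<dots> \<le> x + y" using c by (intro add_mono less_imp_le)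
    finally show ?thesis .
  qed
  note * = this
  show ?thesis
  proof (cases "riem_dist T f p q = \<infinity> \<or> riem_dist T f q r = \<infinity>")
    case True
    then show ?thesis using riem_dist_nonneg[of T f p q] riem_dist_nonneg[of T f q r] by auto
  next
    case False
    then obtain a b where ab: "riem_dist T f p q = ereal a" "riem_dist T f q r = ereal b"
      using riem_dist_nonneg[of T f p q] riem_dist_nonneg[of T f q r]
      by (cases "riem_dist T f p q"; cases "riem_dist T f q r") auto
    show ?thesis
    proof (rule ereal_le_epsilon2)
      fix e :: real assume "e > 0"
      then show "riem_dist T f p r \<le> riem_dist T f p q + riem_dist T f q r + ereal e"
        using *[of "ereal (a + e/2)" "ereal (b + e/2)"] ab by (simp add: algebra_simps)
    qed
  qed
qed

lemma riem_dist_le_reverse: "riem_dist T f q p \<le> riem_dist T f p q"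
  unfolding riem_dist_def[of T f p q]
proof (rule INF_greatest, clarify)
  fix c assume c: "pw_smooth_curve T f c"
  let ?c = "\<lambda>t. c (1 - t)"
  obtain N and s :: "nat \<Rightarrow> real" where s: "s 0 = 0" "s N = 1"
    "\<forall>i<N. s i < s (Suc i) \<and> smooth_curve T f {s i..s (Suc i)} c"
    using c unfolding pw_smooth_curve_def subdivided_def by blast
  have "1 - s (N - i) < 1 - s (N - Suc i) \<and> smooth_curve T f {1 - s (N - i)..1 - s (N - Suc i)} ?c" if "i < N" for i
  proof -
    have "Suc (N - Suc i) = N - i" using that by simp
    then have "s (N - Suc i) < s (N - i)" "smooth_curve T f {s (N - Suc i)..s (N - i)} c"
      using s(3) that by (metis diff_less zero_less_Suc order_le_less_trans zero_le)+
    then show ?thesis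
      using smooth_curve_affine_reparam[of T f "{s (N - Suc i)..s (N - i)}" c
        "{1 - s (N - i)..1 - s (N - Suc i)}" "-1" 1 ?c] by auto
  qed
  then have pw: "pw_smooth_curve T f ?c"
    unfolding pw_smooth_curve_def subdivided_def using s(1,2)
    by (intro exI[of _ N] exI[of _ "\<lambda>i. 1 - s (N - i)"]) auto
  obtain S where S: "finite S" "\<And>t. t \<in> {0..1} - S \<Longrightarrow> (f \<circ> c) differentiable (at t)"
    using pw_smooth_curve_differentiable[OF c] by blast
  have "(\<lambda>x. (x - 1) / - 1) ` {0..1::real} = {0..1}"
    by (auto intro!: image_eqI[of _ _ "1 - _"])
  then have "(speed f ?c has_integral integral {0..1} (speed f c)) {0..1}"
    by (intro speed_affine_reparam[OF S, where r = "-1" and s = 1])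
      (use pw_smooth_curve_speed[OF c, of 0 1] in auto)
  then have "curve_length f ?c = curve_length f c"
    unfolding curve_length_def by (rule integral_unique)
  then show "riem_dist T f (c 1) (c 0) \<le> ereal (curve_length f c)"
    using riem_dist_le_curve_length[OF pw, of "c 1" "c 0"] by simp
qed

lemma riem_dist_commute: "riem_dist T f p q = riem_dist T f q p"
  using riem_dist_le_reverse by (metis order_antisym)

text \<open>Applied to subintervals, this turns a curve of length close to the distance into points that divide
  the distance almost as prescribed.\<close>

lemma riem_dist_pw_smooth_curve:
  assumes c: "pw_smooth_curve T f c" and uv: "0 \<le> u" "u \<le> v" "v \<le> 1"
  shows "riem_dist T f (c u) (c v) \<le> ereal (integral {u..v} (speed f c))"
proof (rule subdivided_interval_induct[OF c[unfolded pw_smooth_curve_def] uv])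
  fix a b u v assume *: "smooth_curve T f {a..b} c" "a \<le> u" "u \<le> v" "v \<le> b"
  show "riem_dist T f (c u) (c v) \<le> ereal (integral {u..v} (speed f c))"
  proof (cases "u = v")
    case True
    have "c u \<in> topspace T"
      using * True unfolding smooth_curve_def continuous_map_def by auto
    then show ?thesis using True riem_dist_self[of "c v" T f] by (simp flip: zero_ereal_def)
  qed (use riem_dist_smooth_curve[OF *(1)] * in auto)
next
  fix u v w assume *: "0 \<le> u" "u \<le> v" "v \<le> w" "w \<le> 1"
    "riem_dist T f (c u) (c v) \<le> ereal (integral {u..v} (speed f c))"
    "riem_dist T f (c v) (c w) \<le> ereal (integral {v..w} (speed f c))"
  have "riem_dist T f (c u) (c w) \<le> riem_dist T f (c u) (c v) + riem_dist T f (c v) (c w)"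
    by (rule riem_dist_triangle)
  also have "\<dots> \<le> ereal (integral {u..v} (speed f c)) + ereal (integral {v..w} (speed f c))"
    using * by (intro add_mono)
  also have "\<dots> = ereal (integral {u..w} (speed f c))"
    using Henstock_Kurzweil_Integration.integral_combine[OF *(2,3), of "speed f c"]
      pw_smooth_curve_speed[OF c, of u w] * by auto
  finally show "riem_dist T f (c u) (c w) \<le> ereal (integral {u..w} (speed f c))" .
qed

section \<open>The theorem of Hopf and Rinow\<close>

text \<open>The theorem of Hopf, Rinow and Cohn-Vossen for spaces in which distances are infima of lengths;
  \<open>geod\<close> is the trace that such curves leave in the metric. If some closed ball about \<open>p\<close> is not compact,
  the radii of the compact ones have a supremum. The ball of this radius is totally bounded, hence
  compact by completeness, and local compactness allows a slightly larger radius.\<close>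

lemma (in Metric_space) compactin_mcball_of_almost_geodesic:
  assumes complete: mcomplete
    and loc: "\<And>x. x \<in> M \<Longrightarrow> \<exists>r>0. \<exists>K. compactin mtopology K \<and> mcball x r \<subseteq> K"
    and geod: "\<And>x y s t. x \<in> M \<Longrightarrow> y \<in> M \<Longrightarrow> 0 \<le> s \<Longrightarrow> 0 < t \<Longrightarrow> d x y < s + t \<Longrightarrow>
       \<exists>z\<in>M. d x z \<le> s \<and> d z y < t"
    and p: "p \<in> M"
  shows "compactin mtopology (mcball p R)"
proof (rule ccontr)
  assume R: "\<not> compactin mtopology (mcball p R)"
  define A where "A = {r. 0 \<le> r \<and> compactin mtopology (mcball p r)}"
  have mono: "compactin mtopology (mcball p s)" if "r \<in> A" "s \<le> r" for r s
    using closed_compactin[of mtopology "mcball p r" "mcball p s"] that mcball_subset_concentric[of s r p]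
    by (auto simp: A_def)
  have ltR: "r < R" if "r \<in> A" for r
    using mono[OF that, of R] R by force
  have "mcball p 0 = {p}"
  proof (intro equalityI subsetI)
    fix x assume "x \<in> mcball p 0"
    then have "x \<in> M" "d p x = 0" using nonneg[of p x] by auto
    then show "x \<in> {p}" using p zero[of p x] by simp
  qed (use p in auto)
  then have "0 \<in> A" using p by (simp add: A_def)
  have bdd: "bdd_above A" using ltR by (auto intro!: bdd_aboveI[of _ R] less_imp_le)
  define \<rho> where "\<rho> = Sup A"
  have \<rho>: "0 \<le> \<rho>" using cSup_upper[OF \<open>0 \<in> A\<close> bdd] by (simp add: \<rho>_def)
  define C where "C = mcball p \<rho>"
  have "mtotally_bounded C"
    unfolding mtotally_bounded_def
  proof (intro allI impI)
    fix e :: real assume e: "e > 0"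
    then obtain r where r: "r \<in> A" "\<rho> - e/2 < r"
      using less_cSup_iff[of A "\<rho> - e/2"] \<open>0 \<in> A\<close> bdd by (auto simp: \<rho>_def)
    have r\<rho>: "r \<le> \<rho>" using cSup_upper[OF r(1) bdd] by (simp add: \<rho>_def)
    have "mtotally_bounded (mcball p r)"
      using r by (auto simp: A_def intro: compactin_imp_mtotally_bounded)
    then obtain K where K: "finite K" "K \<subseteq> mcball p r" "mcball p r \<subseteq> (\<Union>x\<in>K. mball x (e/2))"
      using e unfolding mtotally_bounded_def by (meson half_gt_zero)
    \<comment> \<open>A point of \<open>C\<close> is within \<open>e/2\<close> of the ball of radius \<open>r\<close>, on a nearly shortest way to \<open>p\<close>.\<close>
    have "y \<in> (\<Union>x\<in>K. mball x e)" if y: "y \<in> C" for y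
    proof -
      have "y \<in> M" "d p y < r + e/2" using y r by (auto simp: C_def)
      then obtain z where z: "z \<in> M" "d p z \<le> r" "d z y < e/2"
        using geod[OF p, of y r "e/2"] r e by (auto simp: A_def)
      then have "z \<in> mcball p r" using p by auto
      then obtain x where x: "x \<in> K" "x \<in> M" "d x z < e/2" using K(3) by auto
      have "d x y \<le> d x z + d z y" using x z \<open>y \<in> M\<close> by (intro triangle)
      then show ?thesis using x z \<open>y \<in> M\<close> by auto
    qed
    then show "\<exists>K. finite K \<and> K \<subseteq> C \<and> C \<subseteq> (\<Union>x\<in>K. mball x e)"
      using K mcball_subset_concentric[OF r\<rho>, of p] unfolding C_def by blast
  qed
  then have C: "compactin mtopology C"
    using mtotally_bounded_eq_compact_closure_of[OF complete, of C] closure_of_eq[of mtopology C]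
    by (auto simp: C_def)
  obtain r K where rK: "\<And>x. x \<in> M \<Longrightarrow> r x > 0" "\<And>x. x \<in> M \<Longrightarrow> compactin mtopology (K x)"
     "\<And>x. x \<in> M \<Longrightarrow> mcball x (r x) \<subseteq> K x"
    using loc by metis
  define \<B> where "\<B> = (\<lambda>x. mball x (r x / 2)) ` C"
  have CM: "C \<subseteq> M" by (auto simp: C_def)
  have "C \<subseteq> \<Union>\<B>" using CM rK(1) by (force simp: \<B>_def)
  moreover have "\<forall>U\<in>\<B>. openin mtopology U" by (auto simp: \<B>_def)
  ultimately obtain \<F> where "finite \<F>" "\<F> \<subseteq> \<B>" "C \<subseteq> \<Union>\<F>"
    using C unfolding compactin_def by meson
  moreover from calculation obtain F where "finite F" "F \<subseteq> C" "\<F> = (\<lambda>x. mball x (r x / 2)) ` F"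
    unfolding \<B>_def using finite_subset_image by meson
  ultimately have F: "finite F" "F \<subseteq> C" "C \<subseteq> (\<Union>x\<in>F. mball x (r x / 2))" by simp_all
  have "p \<in> C" using p \<rho> by (simp add: C_def)
  then have "F \<noteq> {}" using F by auto
  define \<eta> where "\<eta> = Min ((\<lambda>x. r x / 2) ` F)"
  have "\<eta> \<in> (\<lambda>x. r x / 2) ` F" unfolding \<eta>_def using F(1) \<open>F \<noteq> {}\<close> by (intro Min_in) auto
  then have \<eta>: "\<eta> > 0" using F(2) CM rK(1) by fastforce
  have \<eta>_le: "\<eta> \<le> r x / 2" if "x \<in> F" for x
    unfolding \<eta>_def using F(1) that by (intro Min_le) auto
  \<comment> \<open>The finitely many compact sets cover \<open>C\<close> with margin \<open>\<eta>\<close>.\<close>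
  have sub: "mcball p (\<rho> + \<eta>/2) \<subseteq> \<Union>(K ` F)"
  proof
    fix y assume "y \<in> mcball p (\<rho> + \<eta>/2)"
    then have y: "y \<in> M" "d p y < \<rho> + \<eta>" using \<eta> by auto
    then obtain z where z: "z \<in> M" "d p z \<le> \<rho>" "d z y < \<eta>"
      using geod[OF p, of y \<rho> \<eta>] \<rho> \<eta> by auto
    then have "z \<in> C" using p by (auto simp: C_def)
    then obtain x where x: "x \<in> F" "x \<in> M" "d x z < r x / 2" using F by auto
    have "d x y \<le> d x z + d z y" using x z y by (intro triangle)
    then have "y \<in> mcball x (r x)" using x z y \<eta>_le[OF x(1)] by auto
    then show "y \<in> \<Union>(K ` F)" using rK(3)[OF x(2)] x(1) by blast
  qed
  have "compactin mtopology (\<Union>(K ` F))"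
    using F CM rK(2) by (intro compactin_Union) auto
  then have "compactin mtopology (mcball p (\<rho> + \<eta>/2))"
    using sub by (rule closed_compactin) auto
  then have "\<rho> + \<eta>/2 \<in> A" using \<rho> \<eta> by (simp add: A_def)
  from cSup_upper[OF this bdd] have "\<rho> + \<eta>/2 \<le> \<rho>" unfolding \<rho>_def .
  then show False using \<eta> by simp
qed

text \<open>Continuity of the derivative in the operator norm, from its continuity on the basis vectors.\<close>

lemma frechet_derivative_near:
  fixes H :: "'a::euclidean_space \<Rightarrow> 'b::euclidean_space"
  assumes H: "Cinf_on W H" and W: "open W" "x \<in> W" and e: "e > 0"
  obtains d where "d > 0" "ball x d \<subseteq> W"
    "\<And>y w. y \<in> ball x d \<Longrightarrow> norm (frechet_derivative H (at y) w - frechet_derivative H (at x) w) \<le> e * norm w"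
proof -
  let ?D = "\<lambda>y. frechet_derivative H (at y)"
  define e' where "e' = e / real DIM('a)"
  have e': "e' > 0" using e by (simp add: e'_def)
  have "\<exists>d>0. \<forall>y. dist y x < d \<longrightarrow> dist (?D y i) (?D x i) < e'" for i
  proof -
    have "isCont (\<lambda>y. ?D y i) x"
      using Cinf_on_continuous[OF Cinf_on_derivative(2)[OF H]] W continuous_on_eq_continuous_at by blast
    then show ?thesis using e' unfolding continuous_at_eps_delta by blast
  qed
  then obtain d where d: "\<And>i. d i > 0" "\<And>i y. dist y x < d i \<Longrightarrow> dist (?D y i) (?D x i) < e'" by metis
  obtain d0 where d0: "d0 > 0" "ball x d0 \<subseteq> W" using W open_contains_ball by blast
  define \<delta> where "\<delta> = min d0 (Min (d ` Basis))"
  have \<delta>: "\<delta> > 0" "\<And>i. i \<in> Basis \<Longrightarrow> \<delta> \<le> d i" "\<delta> \<le> d0"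
    using d(1) d0 by (auto simp: \<delta>_def min.coboundedI2)
  show thesis
  proof (rule that[OF \<delta>(1)])
    show sub: "ball x \<delta> \<subseteq> W" using d0 \<delta> by auto
    fix y w assume y: "y \<in> ball x \<delta>"
    have lin: "?D z w = (\<Sum>i\<in>Basis. (w \<bullet> i) *\<^sub>R ?D z i)" if "z \<in> W" for z
        by (intro linear_sum_Basis has_derivative_linear[OF Cinf_on_derivative(1)[OF H that]])
    have "?D y w - ?D x w = (\<Sum>i\<in>Basis. (w \<bullet> i) *\<^sub>R (?D y i - ?D x i))"
      using lin[of y] lin[of x] y sub W by (auto simp: sum_subtractf scaleR_diff_right)
    also have "norm \<dots> \<le> (\<Sum>i\<in>(Basis::'a set). norm w * e')"
    proof (rule sum_norm_le)
      fix i :: 'a assume i: "i \<in> Basis"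
      have "norm (?D y i - ?D x i) \<le> e'"
        using d(2)[of y i] y \<delta>(2)[OF i] by (auto simp: dist_norm norm_minus_commute)
      then show "norm ((w \<bullet> i) *\<^sub>R (?D y i - ?D x i)) \<le> norm w * e'"
        using Basis_le_norm[OF i, of w] by (simp add: mult_mono)
    qed
    also have "\<dots> = e * norm w" by (simp add: e'_def)
    finally show "norm (?D y w - ?D x w) \<le> e * norm w" .
  qed
qed

context
  fixes m :: nat and T :: "'a topology" and f :: "'a \<Rightarrow> 'e::euclidean_space" and U W V L \<phi> \<psi> g
  assumes lp: "local_param m T f U W V L \<phi> \<psi> g"
begin

text \<open>The image of a straight segment is a curve whose speed is almost constant near \<open>p\<close>.\<close>

lemma local_param_riem_dist:
  assumes p: "p \<in> U" and e: "e > 0"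
  obtains d where "d > 0" "\<And>w. w \<in> L \<Longrightarrow> norm w < d \<Longrightarrow> \<phi> (f p) + w \<in> V \<inter> L \<and>
     riem_dist T f p (g (\<phi> (f p) + w)) \<le> ereal (norm (frechet_derivative \<psi> (at (\<phi> (f p))) w) + e * norm w)"
proof -
  let ?x = "\<phi> (f p)" and ?D = "\<lambda>y. frechet_derivative \<psi> (at y)"
  have x: "?x \<in> V \<inter> L" "g ?x = p" using lp p by (auto simp: local_param_def)
  have V: "open V" "subspace L" "Cinf_on V \<psi>" using lp by (auto simp: local_param_def)
  obtain d where d: "d > 0" "ball ?x d \<subseteq> V" "\<And>y w. y \<in> ball ?x d \<Longrightarrow> norm (?D y w - ?D ?x w) \<le> e * norm w"
    using frechet_derivative_near[OF V(3,1) _ e] x by blast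
  show thesis
  proof (rule that[OF d(1)])
    fix w assume w: "w \<in> L" "norm w < d"
    have seg: "?x + t *\<^sub>R w \<in> ball ?x d" if "t \<in> {0..1}" for t
    proof -
      have "norm (t *\<^sub>R w) \<le> norm w" using that by (simp add: mult_left_le_one_le)
      then show ?thesis using w by (simp add: dist_norm)
    qed
    have segV: "?x + t *\<^sub>R w \<in> V \<inter> L" if "t \<in> {0..1}" for t
    proof
      show "?x + t *\<^sub>R w \<in> V" using seg[OF that] d(2) by blast
      show "?x + t *\<^sub>R w \<in> L" using x V(2) w by (auto intro!: subspace_add subspace_scale)
    qed
    let ?c = "\<lambda>t. g (?x + t *\<^sub>R w)"
    have sm: "smooth_curve T f {0..1} ?c"
      by (rule local_param_smooth_curve[OF lp segV])
    have sp: "speed f ?c t \<le> norm (?D ?x w) + e * norm w" if t: "t \<in> {0<..<1}" for t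
    proof -
      have tV: "?x + t *\<^sub>R w \<in> V" using segV t by auto
      have "((\<lambda>t. ?x + t *\<^sub>R w) has_vector_derivative w) (at t)"
        by (auto intro!: derivative_eq_intros)
      then have "(\<psi> \<circ> (\<lambda>t. ?x + t *\<^sub>R w) has_vector_derivative ?D (?x + t *\<^sub>R w) w) (at t)"
        using vector_derivative_diff_chain_within[of "\<lambda>t. ?x + t *\<^sub>R w" w t UNIV \<psi>] Cinf_on_derivative(1)[OF V(3) tV]
        by (auto intro: has_derivative_at_withinI)
      then have "((f \<circ> ?c) has_vector_derivative ?D (?x + t *\<^sub>R w) w) (at t)"
        by (rule has_vector_derivative_transform_within_open[of _ _ _ "{0<..<1}"])
          (use t segV lp in \<open>auto simp: local_param_def\<close>)
      then have "speed f ?c t = norm (?D (?x + t *\<^sub>R w) w)" by (simp add: vector_derivative_at)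
      also have "\<dots> \<le> norm (?D ?x w) + norm (?D (?x + t *\<^sub>R w) w - ?D ?x w)"
        by (rule norm_triangle_sub)
      also have "norm (?D (?x + t *\<^sub>R w) w - ?D ?x w) \<le> e * norm w"
        using d(3) seg t by auto
      finally show ?thesis by simp
    qed
    have "riem_dist T f (?c 0) (?c 1) \<le> ereal (integral {0..1} (speed f ?c))"
      by (rule riem_dist_smooth_curve[OF sm]) auto
    also have "integral {0..1} (speed f ?c) \<le> norm (?D ?x w) + e * norm w"
    proof -
      have I: "speed f ?c integrable_on {0..1}" using smooth_curve_speed(1)[OF sm, of 0 1] by simp
      have I': "(speed f ?c has_integral integral {0..1} (speed f ?c)) {0<..<1}"
        using I by (simp add: has_integral_open_interval[where 'a=real, unfolded box_real cbox_interval] integrable_integral)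
      have C: "((\<lambda>t::real. norm (?D ?x w) + e * norm w) has_integral norm (?D ?x w) + e * norm w) {0<..<1}"
        using has_integral_const_real[of "norm (?D ?x w) + e * norm w" 0 1]
        by (simp add: has_integral_open_interval[where 'a=real, unfolded box_real cbox_interval])
      show ?thesis by (rule has_integral_le[OF I' C sp])
    qed
    finally show "?x + w \<in> V \<inter> L \<and> riem_dist T f p (g (?x + w)) \<le> ereal (norm (?D ?x w) + e * norm w)"
      using x segV[of 1] by simp
  qed
qed

lemma local_param_ball_nhd:
  assumes "p \<in> U"
  shows "openin T {q \<in> U. \<phi> (f q) \<in> ball x e}"
proof -
  have U: "openin T U" "continuous_map (subtopology T U) euclidean f" "f ` U \<subseteq> W" "open W" "Cinf_on W \<phi>"
    using lp by (auto simp: local_param_def)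
  have ts: "topspace (subtopology T U) = U" using openin_subset[OF U(1)] by auto
  have "open (W \<inter> \<phi> -` ball x e)"
    using continuous_open_preimage[OF Cinf_on_continuous[OF U(5)] U(4) open_ball] .
  then have "openin (subtopology T U) {q \<in> U. f q \<in> W \<inter> \<phi> -` ball x e}"
    using openin_continuous_map_preimage[OF U(2), of "W \<inter> \<phi> -` ball x e"] unfolding ts by simp
  moreover have "{q \<in> U. f q \<in> W \<inter> \<phi> -` ball x e} = {q \<in> U. \<phi> (f q) \<in> ball x e}"
    using U(3) by auto
  ultimately show ?thesis using U(1) openin_trans_full by fastforce
qed

lemma local_param_compact_nhd:
  assumes p: "p \<in> U" and G: "openin T G" "p \<in> G"
  obtains e where "e > 0" "cball (\<phi> (f p)) e \<subseteq> V" "compactin T (g ` (cball (\<phi> (f p)) e \<inter> L))"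
    "g ` (cball (\<phi> (f p)) e \<inter> L) \<subseteq> G"
    "{q \<in> U. \<phi> (f q) \<in> ball (\<phi> (f p)) e} \<subseteq> g ` (cball (\<phi> (f p)) e \<inter> L)"
proof -
  let ?x = "\<phi> (f p)"
  have x: "?x \<in> V \<inter> L" "g ?x = p" using lp p by (auto simp: local_param_def)
  have V: "open V" "subspace L" "continuous_map (top_of_set (V \<inter> L)) T g"
    using lp by (auto simp: local_param_def)
  have "openin (top_of_set (V \<inter> L)) {y \<in> V \<inter> L. g y \<in> G}"
    using openin_continuous_map_preimage[OF V(3) G(1)] by simp
  then obtain O' where O': "open O'" "{y \<in> V \<inter> L. g y \<in> G} = (V \<inter> L) \<inter> O'" by (auto simp: openin_open)
  have "?x \<in> {y \<in> V \<inter> L. g y \<in> G}" using x G(2) by simp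
  then have xO: "?x \<in> O' \<inter> V" unfolding O'(2) by simp
  have "open (O' \<inter> V)" using O'(1) V(1) by (rule open_Int)
  then have "\<exists>e>0. cball ?x e \<subseteq> O' \<inter> V"
    unfolding open_contains_cball using xO by (rule bspec)
  then obtain e where e: "e > 0" "cball ?x e \<subseteq> O' \<inter> V" by (elim exE conjE)
  have "compact (cball ?x e \<inter> L)" by (intro compact_Int_closed compact_cball closed_subspace V(2))
  then have "compactin (top_of_set (V \<inter> L)) (cball ?x e \<inter> L)"
    using e by (auto simp: compactin_subtopology)
  then have "compactin T (g ` (cball ?x e \<inter> L))" using V(3) image_compactin by blast
  moreover have "g ` (cball ?x e \<inter> L) \<subseteq> G" using e O' by blast
  moreover have "q \<in> g ` (cball ?x e \<inter> L)" if "q \<in> U" "\<phi> (f q) \<in> ball ?x e" for q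
    by (rule image_eqI[of _ _ "\<phi> (f q)"]) (use that lp in \<open>auto simp: local_param_def\<close>)
  ultimately show thesis using that[OF e(1)] e by blast
qed

text \<open>A curve that leaves a compact neighbourhood of \<open>p\<close> meets its boundary, which has positive ambient
  distance from \<open>p\<close>; so it cannot be short. This works although \<open>f\<close> need not be injective: curves stay in
  \<open>M\<close>, and only points of the neighbourhood are compared.\<close>

lemma local_param_riem_dist_small:
  assumes Haus: "Hausdorff_space T" and p: "p \<in> U" and G: "openin T G" "p \<in> G"
  obtains r where "r > 0" "\<And>q. riem_dist T f p q < ereal r \<Longrightarrow> q \<in> G"
proof -
  let ?x = "\<phi> (f p)"
  obtain e where e: "e > 0" "cball ?x e \<subseteq> V" "compactin T (g ` (cball ?x e \<inter> L))"
    "g ` (cball ?x e \<inter> L) \<subseteq> G" "{q \<in> U. \<phi> (f q) \<in> ball ?x e} \<subseteq> g ` (cball ?x e \<inter> L)"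
    by (rule local_param_compact_nhd[OF p G])
  define I where "I = {q \<in> U. \<phi> (f q) \<in> ball ?x e}"
  define K where "K = g ` (cball ?x e \<inter> L)"
  have I: "openin T I" unfolding I_def by (rule local_param_ball_nhd[OF p])
  have K: "closedin T K" using compactin_imp_closedin[OF Haus] e(3) by (simp add: K_def)
  have IK: "I \<subseteq> K" using e(5) by (simp add: I_def K_def)
  have x: "?x \<in> V \<inter> L" "\<psi> ?x = f p" using lp p by (auto simp: local_param_def)
  have L: "subspace L" "Cinf_on V \<psi>" using lp by (auto simp: local_param_def)
  \<comment> \<open>The boundary of the compact neighbourhood stays away from \<open>f p\<close>.\<close>
  have "compact ((\<lambda>y. norm (\<psi> y - f p)) ` (sphere ?x e \<inter> L))"
  proof (rule compact_continuous_image)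
    have "sphere ?x e \<subseteq> V" using e(2) sphere_cball by blast
    then show "continuous_on (sphere ?x e \<inter> L) (\<lambda>y. norm (\<psi> y - f p))"
      by (intro continuous_intros continuous_on_subset[OF Cinf_on_continuous[OF L(2)]]) auto
    show "compact (sphere ?x e \<inter> L)" by (intro compact_Int_closed compact_sphere closed_subspace L(1))
  qed
  moreover have "norm (\<psi> y - f p) > 0" if "y \<in> sphere ?x e \<inter> L" for y
  proof -
    have "y \<in> V" using that e(2) sphere_cball by blast
    then have "\<phi> (\<psi> y) = y" using lp by (auto simp: local_param_def)
    then show ?thesis using that e(1) by auto
  qed
  ultimately obtain r where r: "r > 0" "\<And>y. y \<in> sphere ?x e \<inter> L \<Longrightarrow> r \<le> norm (\<psi> y - f p)"
  proof (cases "sphere ?x e \<inter> L = {}")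
    case True
    then show ?thesis using that[of 1] by auto
  next
    case False
    assume *: "compact ((\<lambda>y. norm (\<psi> y - f p)) ` (sphere ?x e \<inter> L))"
      "\<And>y. y \<in> sphere ?x e \<inter> L \<Longrightarrow> 0 < norm (\<psi> y - f p)"
    have "(\<lambda>y. norm (\<psi> y - f p)) ` (sphere ?x e \<inter> L) \<noteq> {}" using False by simp
    from compact_attains_inf[OF *(1) this]
    obtain z where z: "z \<in> sphere ?x e \<inter> L" "\<forall>y\<in>sphere ?x e \<inter> L. norm (\<psi> z - f p) \<le> norm (\<psi> y - f p)"
      by (elim bexE imageE) (simp only: ball_simps)
    then show ?thesis using that[of "norm (\<psi> z - f p)"] *(2) by blast
  qed
  show thesis
  proof (rule that[OF r(1)])
    fix q assume "riem_dist T f p q < ereal r"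
    then obtain c where c: "pw_smooth_curve T f c" "c 0 = p" "c 1 = q" "curve_length f c < r"
      using riem_dist_lessE by (metis less_ereal.simps(1))
    have far: "c t \<notin> K - I" if "t \<in> {0..1}" for t
    proof
      assume "c t \<in> K - I"
      then obtain y where y: "y \<in> cball ?x e \<inter> L" "c t = g y" "c t \<notin> I" by (auto simp: K_def)
      then have yV: "y \<in> V \<inter> L" using e(2) by blast
      then have gy: "g y \<in> U" "f (g y) = \<psi> y" "\<phi> (f (g y)) = y" using lp by (auto simp: local_param_def)
      then have "y \<notin> ball ?x e" using y by (auto simp: I_def)
      then have "y \<in> sphere ?x e \<inter> L" using y by auto
      then have "r \<le> norm (f (c t) - f p)" using r(2) gy y by auto
      also have "\<dots> \<le> curve_length f c" using chord_le_curve_length[OF c(1) that] c(2) by simp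
      finally show False using c(4) by simp
    qed
    have "c 0 \<in> I \<longrightarrow> c 1 \<in> I"
    proof (rule subdivided_interval_induct[OF c(1)[unfolded pw_smooth_curve_def], of 0 1])
      fix a b u v :: real assume *: "smooth_curve T f {a..b} c" "0 \<le> a" "b \<le> 1" "a \<le> u" "u \<le> v" "v \<le> b"
      have "connectedin T (c ` {u..v})"
        by (rule connectedin_continuous_map_image[of "top_of_set {a..b}"])
          (use * in \<open>auto simp: smooth_curve_def connectedin_subtopology\<close>)
      then have "\<not> (openin T I \<and> openin T (topspace T - K) \<and> c ` {u..v} \<subseteq> I \<union> (topspace T - K) \<and>
         I \<inter> (topspace T - K) \<inter> c ` {u..v} = {} \<and> I \<inter> c ` {u..v} \<noteq> {} \<and> (topspace T - K) \<inter> c ` {u..v} \<noteq> {})"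
        and sub: "c ` {u..v} \<subseteq> topspace T"
        unfolding connectedin by blast+
      moreover have "c ` {u..v} \<subseteq> I \<union> (topspace T - K)" using far * sub by (force simp: image_subset_iff)
      ultimately have "I \<inter> c ` {u..v} \<noteq> {} \<longrightarrow> (topspace T - K) \<inter> c ` {u..v} = {}"
        using I K IK by blast
      then show "c u \<in> I \<longrightarrow> c v \<in> I"
      proof -
        have "c v \<in> c ` {u..v}" "c u \<in> c ` {u..v}" using * by auto
        moreover have "c v \<notin> K - I" using far[of v] * by auto
        ultimately show ?thesis
          using \<open>I \<inter> c ` {u..v} \<noteq> {} \<longrightarrow> (topspace T - K) \<inter> c ` {u..v} = {}\<close> sub by blast
      qed
    qed auto
    moreover have "p \<in> I" using p e(1) by (simp add: I_def)
    ultimately have "q \<in> K" using c IK by auto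
    then show "q \<in> G" using e(4) by (auto simp: K_def)
  qed
qed

end

lemma immersed_submanifold_riem_dist_small:
  assumes "immersed_submanifold m T f" "openin T G" "p \<in> G"
  obtains r where "r > 0" "\<And>q. riem_dist T f p q < ereal r \<Longrightarrow> q \<in> G"
proof -
  have "p \<in> topspace T" using assms openin_subset by blast
  then obtain U W V L \<phi> \<psi> g where lp: "local_param m T f U W V L \<phi> \<psi> g" "p \<in> U"
    using local_param_exists[OF assms(1)] by metis
  show thesis
    using local_param_riem_dist_small[OF lp(1) _ lp(2) assms(2,3)] assms(1) that
    unfolding immersed_submanifold_def by blast
qed

lemma immersed_submanifold_nhd_riem_dist:
  assumes "immersed_submanifold m T f" "p \<in> topspace T" "r > 0"
  obtains G where "openin T G" "p \<in> G" "\<And>q. q \<in> G \<Longrightarrow> riem_dist T f p q < ereal r"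
proof -
  obtain U W V L \<phi> \<psi> g where lp: "local_param m T f U W V L \<phi> \<psi> g" "p \<in> U"
    using local_param_exists[OF assms(1,2)] by metis
  let ?x = "\<phi> (f p)"
  obtain d where d: "d > 0" "\<And>w. w \<in> L \<Longrightarrow> norm w < d \<Longrightarrow> ?x + w \<in> V \<inter> L \<and>
     riem_dist T f p (g (?x + w)) \<le> ereal (norm (frechet_derivative \<psi> (at ?x) w) + 1 * norm w)"
    using local_param_riem_dist[OF lp, of 1] by auto
  have "\<psi> differentiable at ?x"
    using lp Cinf_on_derivative(1)[of V \<psi> ?x] unfolding local_param_def differentiable_def by blast
  then have bl: "bounded_linear (frechet_derivative \<psi> (at ?x))"
    using frechet_derivative_works has_derivative_bounded_linear by blast
  then obtain K where K: "K > 0" "\<And>w. norm (frechet_derivative \<psi> (at ?x) w) \<le> norm w * K"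
    using bounded_linear.pos_bounded by blast
  define e where "e = min d (r / (K + 1))"
  have e: "e > 0" using d K assms by (simp add: e_def)
  show thesis
  proof (rule that[OF local_param_ball_nhd[OF lp]])
    show "p \<in> {q \<in> U. \<phi> (f q) \<in> ball ?x e}" using lp e by simp
    fix q assume q: "q \<in> {q \<in> U. \<phi> (f q) \<in> ball ?x e}"
    define w where "w = \<phi> (f q) - ?x"
    have w: "w \<in> L" "norm w < e" "g (?x + w) = q"
      using q lp by (auto simp: local_param_def w_def dist_norm norm_minus_commute intro!: subspace_diff)
    have "riem_dist T f p q \<le> ereal (norm (frechet_derivative \<psi> (at ?x) w) + 1 * norm w)"
      using d(2)[OF w(1)] w by (simp add: e_def)
    also have "norm (frechet_derivative \<psi> (at ?x) w) + 1 * norm w \<le> norm w * (K + 1)"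
      using K(2)[of w] by (simp add: algebra_simps)
    also have "norm w * (K + 1) < r"
      using w(2) K(1) by (simp add: e_def pos_less_divide_eq)
    finally show "riem_dist T f p q < ereal r" by simp
  qed
qed

text \<open>Since all distances are finite, the intrinsic distance is a metric. It induces the topology of \<open>M\<close>,
  and its balls are compact by the theorem of Hopf and Rinow.\<close>

theorem bounded_complete_imp_compact_space:
  assumes imm: "immersed_submanifold m T f" and compl: "riem_complete T f"
    and bdd: "\<And>p q. p \<in> topspace T \<Longrightarrow> q \<in> topspace T \<Longrightarrow> riem_dist T f p q \<le> ereal C"
  shows "compact_space T"
proof (cases "topspace T = {}")
  case True
  then show ?thesis by (simp add: compact_space_def)
next
  case False
  then obtain p0 where p0: "p0 \<in> topspace T" by blast
  define \<rho> where "\<rho> p q = real_of_ereal (riem_dist T f p q)" for p q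
  have \<rho>: "ereal (\<rho> p q) = riem_dist T f p q" if "p \<in> topspace T" "q \<in> topspace T" for p q
    using bdd[OF that] riem_dist_nonneg[of T f p q] unfolding \<rho>_def
    by (cases "riem_dist T f p q") auto
  interpret M: Metric_space "topspace T" \<rho>
  proof
    show "0 \<le> \<rho> p q" for p q
      unfolding \<rho>_def by (rule real_of_ereal_pos[OF riem_dist_nonneg])
    show "\<rho> p q = \<rho> q p" for p q unfolding \<rho>_def by (subst riem_dist_commute) simp
    show "\<rho> p q = 0 \<longleftrightarrow> p = q" if pq: "p \<in> topspace T" "q \<in> topspace T" for p q
    proof
      assume "p = q"
      then show "\<rho> p q = 0" using riem_dist_self[OF pq(1), of f] by (simp add: \<rho>_def)
    next
      assume 0: "\<rho> p q = 0"
      show "p = q"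
      proof (rule ccontr)
        assume "p \<noteq> q"
        then obtain G where G: "openin T G" "p \<in> G" "q \<notin> G"
          using imm pq unfolding immersed_submanifold_def Hausdorff_space_def disjnt_def by blast
        then obtain r where r: "r > 0" "\<And>q. riem_dist T f p q < ereal r \<Longrightarrow> q \<in> G"
          using immersed_submanifold_riem_dist_small[OF imm] by metis
        have "riem_dist T f p q < ereal r" using \<rho>[OF pq] 0 r(1) by (metis less_ereal.simps(1))
        then show False using r(2) G by blast
      qed
    qed
    show "\<rho> p r \<le> \<rho> p q + \<rho> q r" if "p \<in> topspace T" "q \<in> topspace T" "r \<in> topspace T" for p q r
    proof -
      have "ereal (\<rho> p r) \<le> ereal (\<rho> p q) + ereal (\<rho> q r)"
        using riem_dist_triangle[of T f p r q] \<rho> that by simp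
      then show ?thesis by simp
    qed
  qed
  have top: "M.mtopology = T"
    unfolding topology_eq
  proof (intro allI iffI)
    fix G assume G: "openin M.mtopology G"
    show "openin T G"
    proof (subst openin_subopen, intro ballI)
      fix p assume p: "p \<in> G"
      then obtain r where r: "r > 0" "M.mball p r \<subseteq> G" using G unfolding M.openin_mtopology by blast
      have pT: "p \<in> topspace T" using G p unfolding M.openin_mtopology by blast
      obtain G' where G': "openin T G'" "p \<in> G'" "\<And>q. q \<in> G' \<Longrightarrow> riem_dist T f p q < ereal r"
        using immersed_submanifold_nhd_riem_dist[OF imm pT r(1)] by metis
      have "G' \<subseteq> M.mball p r"
      proof
        fix q assume q: "q \<in> G'"
        then have qT: "q \<in> topspace T" using G'(1) openin_subset by blast
        show "q \<in> M.mball p r" using G'(3)[OF q] pT qT \<rho>[OF pT qT] by (metis M.in_mball less_ereal.simps(1))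
      qed
      then show "\<exists>G'. openin T G' \<and> p \<in> G' \<and> G' \<subseteq> G" using G' r by blast
    qed
  next
    fix G assume G: "openin T G"
    have "\<exists>r>0. M.mball p r \<subseteq> G" if pG: "p \<in> G" for p
    proof -
      obtain r where r: "r > 0" "\<And>q. riem_dist T f p q < ereal r \<Longrightarrow> q \<in> G"
        using immersed_submanifold_riem_dist_small[OF imm G pG] by metis
      have "M.mball p r \<subseteq> G"
        using r(2) \<rho> by (metis M.in_mball less_ereal.simps(1) subsetI)
      then show ?thesis using r(1) by blast
    qed
    then show "openin M.mtopology G" unfolding M.openin_mtopology using G openin_subset by blast
  qed
  have "M.mcomplete"
    unfolding M.mcomplete_def
  proof (intro allI impI)
    fix \<sigma> assume s: "M.MCauchy \<sigma>"
    then have ran: "range \<sigma> \<subseteq> topspace T" by (simp add: M.MCauchy_def)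
    then have sT: "\<sigma> i \<in> topspace T" for i by blast
    have "\<exists>N. \<forall>i\<ge>N. \<forall>j\<ge>N. riem_dist T f (\<sigma> i) (\<sigma> j) < ereal e" if "e > 0" for e
    proof -
      obtain N where "\<forall>n n'. N \<le> n \<longrightarrow> N \<le> n' \<longrightarrow> \<rho> (\<sigma> n) (\<sigma> n') < e" using s \<open>e > 0\<close> unfolding M.MCauchy_def by blast
      then show ?thesis using \<rho>[OF sT sT] by (metis less_ereal.simps(1))
    qed
    then obtain p where p: "p \<in> topspace T" "(\<lambda>i. riem_dist T f (\<sigma> i) p) \<longlonglongrightarrow> 0"
      using compl ran unfolding riem_complete_def by blast
    have "(\<lambda>i. ereal (\<rho> (\<sigma> i) p)) \<longlonglongrightarrow> ereal 0" using p \<rho>[OF sT p(1)] by (simp add: zero_ereal_def)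
    then have "(\<lambda>i. \<rho> (\<sigma> i) p) \<longlonglongrightarrow> 0" by (simp only: lim_ereal)
    then have "limitin M.mtopology \<sigma> p sequentially"
      using p sT by (simp add: M.limitin_metric_dist_null)
    then show "\<exists>x. limitin M.mtopology \<sigma> x sequentially" by blast
  qed
  then have "compactin M.mtopology (M.mcball p0 C)"
  proof (rule M.compactin_mcball_of_almost_geodesic[OF _ _ _ p0])
    fix p assume p: "p \<in> topspace T"
    obtain U W V L \<phi> \<psi> g where lp: "local_param m T f U W V L \<phi> \<psi> g" "p \<in> U"
      using local_param_exists[OF imm p] by metis
    let ?x = "\<phi> (f p)"
    obtain e where e: "e > 0" "cball ?x e \<subseteq> V" "compactin T (g ` (cball ?x e \<inter> L))"
      "g ` (cball ?x e \<inter> L) \<subseteq> topspace T" "{q \<in> U. \<phi> (f q) \<in> ball ?x e} \<subseteq> g ` (cball ?x e \<inter> L)"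
      by (rule local_param_compact_nhd[OF lp openin_topspace p])
    have "openin M.mtopology {q \<in> U. \<phi> (f q) \<in> ball ?x e}"
      unfolding top by (rule local_param_ball_nhd[OF lp])
    moreover have "p \<in> {q \<in> U. \<phi> (f q) \<in> ball ?x e}" using lp e by simp
    ultimately obtain r where "r > 0" "M.mcball p r \<subseteq> {q \<in> U. \<phi> (f q) \<in> ball ?x e}"
      unfolding M.openin_mtopology_mcball by blast
    then show "\<exists>r>0. \<exists>K. compactin M.mtopology K \<and> M.mcball p r \<subseteq> K"
      unfolding top using e by blast
  next
    fix x y s t assume *: "x \<in> topspace T" "y \<in> topspace T" "0 \<le> s" "0 < t" "\<rho> x y < s + t"
    have "riem_dist T f x y < ereal (s + t)" using * \<rho> by (metis less_ereal.simps(1))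
    then obtain c where c: "pw_smooth_curve T f c" "c 0 = x" "c 1 = y" "curve_length f c < s + t"
      using riem_dist_lessE by (metis less_ereal.simps(1))
    have I: "speed f c integrable_on {0..1}" using pw_smooth_curve_speed[OF c(1), of 0 1] by simp
    have len: "curve_length f c = integral {0..1} (speed f c)" by (simp add: curve_length_def)
    show "\<exists>z\<in>topspace T. \<rho> x z \<le> s \<and> \<rho> z y < t"
    proof (cases "curve_length f c \<le> s")
      case True
      have "riem_dist T f x y \<le> ereal s"
        using riem_dist_le_curve_length[OF c(1-3)] True by (metis ereal_less_eq(3) order_trans)
      then have "\<rho> x y \<le> s" using \<rho>[OF *(1,2)] by (simp flip: ereal_less_eq(3))
      moreover have "\<rho> y y = 0" using riem_dist_self[OF *(2), of f] by (simp add: \<rho>_def)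
      ultimately show ?thesis using * by (intro bexI[of _ y]) auto
    next
      case False
      have "\<exists>u\<ge>0. u \<le> 1 \<and> integral {0..u} (speed f c) = s"
        by (rule IVT') (use False * len indefinite_integral_continuous_1[OF I] in auto)
      then obtain u where u: "0 \<le> u" "u \<le> 1" "integral {0..u} (speed f c) = s" by blast
      have "integral {0..u} (speed f c) + integral {u..1} (speed f c) = integral {0..1} (speed f c)"
        by (rule Henstock_Kurzweil_Integration.integral_combine[OF u(1,2) I])
      then have u1: "integral {u..1} (speed f c) < t" using u len c(4) by simp
      have "\<forall>w\<in>{0..1}. c w \<in> topspace T"
      proof (rule subdivided_interval_induct[OF c(1)[unfolded pw_smooth_curve_def], of 0 1])
        fix a b u v :: real assume "smooth_curve T f {a..b} c" "a \<le> u" "v \<le> b"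
        then show "\<forall>w\<in>{u..v}. c w \<in> topspace T"
          unfolding smooth_curve_def continuous_map_def by auto
      next
        fix u v w :: real assume *: "\<forall>w\<in>{u..v}. c w \<in> topspace T" "\<forall>w\<in>{v..w}. c w \<in> topspace T"
        show "\<forall>w\<in>{u..w}. c w \<in> topspace T"
        proof
          fix x assume "x \<in> {u..w}"
          then show "c x \<in> topspace T" using * by (cases "x \<le> v") auto
        qed
      qed auto
      then have cu: "c u \<in> topspace T" using u by auto
      have "riem_dist T f (c 0) (c u) \<le> ereal s" "riem_dist T f (c u) (c 1) < ereal t"
        using riem_dist_pw_smooth_curve[OF c(1), of 0 u] riem_dist_pw_smooth_curve[OF c(1), of u 1] u u1
        by (auto intro: le_less_trans)
      then have "\<rho> x (c u) \<le> s" "\<rho> (c u) y < t"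
        using c(2,3) \<rho>[OF *(1) cu] \<rho>[OF cu *(2)] by (simp_all flip: ereal_less_eq(3) less_ereal.simps(1))
      then show ?thesis using cu by blast
    qed
  qed
  moreover have "M.mcball p0 C = topspace T"
  proof -
    have "\<rho> p0 q \<le> C" if "q \<in> topspace T" for q
      using bdd[OF p0 that] \<rho>[OF p0 that] by (metis ereal_less_eq(3))
    then show ?thesis using p0 by auto
  qed
  ultimately show ?thesis unfolding top by (simp add: compact_space_def)
qed

section \<open>The Gauss equation for submanifolds of the sphere\<close>

lemma has_tangential_derivative_unique:
  assumes "has_tangential_derivative T f h h' p" "has_tangential_derivative T f h k' p"
    "v \<in> tangent_space T f p"
  shows "h' v = k' v"
  using dir_deriv_eq[OF assms(1,3)] dir_deriv_eq[OF assms(2,3)] by simp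

text \<open>The ambient space is flat: the second derivative of \<open>Z\<close> along fields is a symmetric part \<open>Z2\<close> plus a
  term with the first derivative of \<open>Z\<close>.\<close>

lemma dir_deriv_field_has_tangential_derivative:
  assumes Z: "smooth_map (subtopology T U) f Z" and U: "openin T U" "p \<in> U"
  obtains Z' Z2 where "has_tangential_derivative T f Z Z' p" "\<And>v y. Z2 v y = Z2 y v"
    "\<And>Y Y' U'. has_tangential_derivative T f Y Y' p \<Longrightarrow> openin T U' \<Longrightarrow> p \<in> U' \<Longrightarrow>
       (\<And>q. q \<in> U' \<Longrightarrow> Y q \<in> tangent_space T f q) \<Longrightarrow>
       has_tangential_derivative T f (\<lambda>q. dir_deriv T f Z q (Y q)) (\<lambda>v. Z2 v (Y p) + Z' (Y' v)) p"
proof -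
  obtain V W H where V: "openin T V" "p \<in> V" "V \<subseteq> U" "open W" "f ` V \<subseteq> W" "Cinf_on W H" "\<And>q. q \<in> V \<Longrightarrow> Z q = H (f q)"
    using smooth_map_local[OF Z U] by metis
  have td: "has_tangential_derivative T f Z (frechet_derivative H (at (f q))) q" if "q \<in> V" for q
    by (rule has_tangential_derivativeI[OF V(1) that V(7) Cinf_on_derivative(1)[OF V(6)]]) (use V that in auto)
  define Z2 where "Z2 v y = frechet_derivative (\<lambda>z. frechet_derivative H (at z) y) (at (f p)) v" for v y
  show thesis
  proof (rule that[OF td[OF V(2)]])
    show "Z2 v y = Z2 y v" for v y
      unfolding Z2_def by (rule second_derivative_symmetric[OF V(6,4)]) (use V in auto)
    fix Y Y' U' assume Y: "has_tangential_derivative T f Y Y' p" "openin T U'" "p \<in> U'"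
       "\<And>q. q \<in> U' \<Longrightarrow> Y q \<in> tangent_space T f q"
    obtain UY HY where HY: "openin T UY" "p \<in> UY" "\<forall>q\<in>UY. Y q = HY (f q)" "(HY has_derivative Y') (at (f p))"
      using Y(1) unfolding has_tangential_derivative_def by blast
    show "has_tangential_derivative T f (\<lambda>q. dir_deriv T f Z q (Y q))
       (\<lambda>v. Z2 v (Y p) + frechet_derivative H (at (f p)) (Y' v)) p"
    proof (rule has_tangential_derivativeI)
      show "openin T (V \<inter> U' \<inter> UY)" "p \<in> V \<inter> U' \<inter> UY" using V Y HY by auto
      show "dir_deriv T f Z q (Y q) = frechet_derivative H (at (f q)) (HY (f q))" if "q \<in> V \<inter> U' \<inter> UY" for q
        using dir_deriv_eq[OF td[of q] Y(4)[of q]] HY(3) that by auto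
      have "f p \<in> W" "HY (f p) = Y p" using V HY by auto
      then show "((\<lambda>x. frechet_derivative H (at x) (HY x)) has_derivative
          (\<lambda>v. Z2 v (Y p) + frechet_derivative H (at (f p)) (Y' v))) (at (f p))"
        using has_derivative_directional[OF V(6,4) _ HY(4)] unfolding Z2_def by simp
    qed
  qed
qed

lemma stiefel_inner:
  "\<xi> \<in> stiefel n \<Longrightarrow> i < n \<Longrightarrow> j < n \<Longrightarrow> \<xi> i \<bullet> \<xi> j = (if i = j then 1 else 0)"
  by (simp add: stiefel_def)

lemma stiefel_inner_sum:
  assumes "\<xi> \<in> stiefel n" "i < n"
  shows "(\<Sum>j<n. c j *\<^sub>R \<xi> j) \<bullet> \<xi> i = c i"
proof -
  have "(\<Sum>j<n. c j *\<^sub>R \<xi> j) \<bullet> \<xi> i = (\<Sum>j<n. if j = i then c j else 0)"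
    unfolding inner_sum_left by (intro sum.cong) (use assms in \<open>auto simp: stiefel_inner\<close>)
  also have "\<dots> = c i" using assms by simp
  finally show ?thesis .
qed

lemma stiefel_span_representation:
  assumes "\<xi> \<in> stiefel n" "v \<in> span (\<xi> ` {..<n})"
  shows "v = (\<Sum>j<n. (v \<bullet> \<xi> j) *\<^sub>R \<xi> j)"
  using assms(2)
proof (induction rule: span_induct_alt)
  case (step c x y)
  then obtain i where i: "i < n" "x = \<xi> i" by auto
  have "(\<Sum>j<n. ((c *\<^sub>R x + y) \<bullet> \<xi> j) *\<^sub>R \<xi> j) = c *\<^sub>R (\<Sum>j<n. (x \<bullet> \<xi> j) *\<^sub>R \<xi> j) + (\<Sum>j<n. (y \<bullet> \<xi> j) *\<^sub>R \<xi> j)"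
    by (simp add: inner_add_left scaleR_add_left sum.distrib scaleR_sum_right)
  moreover have "(\<Sum>j<n. (x \<bullet> \<xi> j) *\<^sub>R \<xi> j) = (\<Sum>j<n. if j = i then \<xi> j else 0)"
    unfolding i(2) by (intro sum.cong) (use i assms(1) in \<open>auto simp: stiefel_inner\<close>)
  ultimately show ?case using step i by simp
qed simp

lemma stiefel_span_norm:
  assumes "\<xi> \<in> stiefel n" "v \<in> span (\<xi> ` {..<n})"
  shows "(\<Sum>j<n. (v \<bullet> \<xi> j)\<^sup>2) = (norm v)\<^sup>2"
proof -
  have "(norm v)\<^sup>2 = v \<bullet> (\<Sum>j<n. (v \<bullet> \<xi> j) *\<^sub>R \<xi> j)"
    using stiefel_span_representation[OF assms] by (simp add: power2_norm_eq_inner)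
  also have "\<dots> = (\<Sum>j<n. (v \<bullet> \<xi> j)\<^sup>2)" by (simp add: inner_sum_right power2_eq_square)
  finally show ?thesis by simp
qed

text \<open>The sum is the squared norm of the projection of \<open>v\<close> to the common span.\<close>

lemma stiefel_parseval:
  assumes "\<xi> \<in> stiefel n" "\<zeta> \<in> stiefel n" "span (\<xi> ` {..<n}) = span (\<zeta> ` {..<n})"
  shows "(\<Sum>j<n. (v \<bullet> \<xi> j)\<^sup>2) = (\<Sum>j<n. (v \<bullet> \<zeta> j)\<^sup>2)"
proof -
  define u where "u = (\<Sum>j<n. (v \<bullet> \<xi> j) *\<^sub>R \<xi> j)"
  have u: "u \<in> span (\<xi> ` {..<n})" unfolding u_def by (intro span_sum span_scale span_base) auto
  have uv: "u \<bullet> z = v \<bullet> z" if "z \<in> span (\<xi> ` {..<n})" for z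
  proof -
    have "u \<bullet> z = (\<Sum>j<n. (v \<bullet> \<xi> j) * (z \<bullet> \<xi> j))" by (simp add: u_def inner_sum_left inner_sum_right inner_commute)
    also have "\<dots> = v \<bullet> (\<Sum>j<n. (z \<bullet> \<xi> j) *\<^sub>R \<xi> j)" by (simp add: inner_sum_right mult.commute)
    finally show ?thesis using stiefel_span_representation[OF assms(1) that] by simp
  qed
  have "(\<Sum>j<n. (v \<bullet> \<xi> j)\<^sup>2) = (\<Sum>j<n. (u \<bullet> \<xi> j)\<^sup>2)"
    by (intro sum.cong refl) (simp add: uv span_base)
  also have "\<dots> = (norm u)\<^sup>2" by (rule stiefel_span_norm[OF assms(1) u])
  also have "\<dots> = (\<Sum>j<n. (u \<bullet> \<zeta> j)\<^sup>2)"
    using stiefel_span_norm[OF assms(2), of u] u assms(3) by simp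
  also have "\<dots> = (\<Sum>j<n. (v \<bullet> \<zeta> j)\<^sup>2)"
    by (intro sum.cong refl) (simp add: uv assms(3) span_base)
  finally show ?thesis .
qed

text \<open>Smooth orthonormal frames \<open>E\<close> of the tangent spaces and \<open>V\<close> of the normal spaces of \<open>M\<close> in the unit
  sphere, over the open set \<open>O'\<close>.\<close>

locale adapted_frame =
  fixes m n :: nat and T :: "'a topology" and f :: "'a \<Rightarrow> 'e::euclidean_space"
    and O' :: "'a set" and E V :: "'a \<Rightarrow> nat \<Rightarrow> 'e"
  assumes imm: "immersed_submanifold m T f"
    and op: "openin T O'"
    and smE: "a < m \<Longrightarrow> smooth_map (subtopology T O') f (\<lambda>q. E q a)"
    and smV: "j < n \<Longrightarrow> smooth_map (subtopology T O') f (\<lambda>q. V q j)"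
    and E: "q \<in> O' \<Longrightarrow> E q \<in> stiefel m" and V: "q \<in> O' \<Longrightarrow> V q \<in> stiefel n"
    and EV: "q \<in> O' \<Longrightarrow> a < m \<Longrightarrow> j < n \<Longrightarrow> E q a \<bullet> V q j = 0"
    and ff: "q \<in> O' \<Longrightarrow> f q \<bullet> f q = 1" and fE: "q \<in> O' \<Longrightarrow> a < m \<Longrightarrow> f q \<bullet> E q a = 0"
    and fV: "q \<in> O' \<Longrightarrow> j < n \<Longrightarrow> f q \<bullet> V q j = 0"
    and tangent: "q \<in> O' \<Longrightarrow> tangent_space T f q = span (E q ` {..<m})"
    and complete: "q \<in> O' \<Longrightarrow>
      v = (v \<bullet> f q) *\<^sub>R f q + (\<Sum>a<m. (v \<bullet> E q a) *\<^sub>R E q a) + (\<Sum>j<n. (v \<bullet> V q j) *\<^sub>R V q j)"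
begin

abbreviation "TS \<equiv> tangent_space T f"
abbreviation "D \<equiv> dir_deriv T f"

definition tproj :: "'a \<Rightarrow> 'e \<Rightarrow> 'e" where
  "tproj q v = (\<Sum>a<m. (v \<bullet> E q a) *\<^sub>R E q a)"

text \<open>The \<open>j\<close>-th component of the second fundamental form: for a tangent field \<open>Y\<close>, differentiating
  \<open>Y \<bullet> V\<^sub>j = 0\<close> gives \<open>D\<^sub>v Y \<bullet> V\<^sub>j = - Y \<bullet> D\<^sub>v V\<^sub>j\<close>.\<close>

definition B :: "'a \<Rightarrow> 'e \<Rightarrow> 'e \<Rightarrow> nat \<Rightarrow> real" where
  "B q v w j = - (w \<bullet> D (\<lambda>q. V q j) q v)"

lemma O'_top: "q \<in> O' \<Longrightarrow> q \<in> topspace T"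
  using openin_subset[OF op] by blast

lemma E_TS: "q \<in> O' \<Longrightarrow> a < m \<Longrightarrow> E q a \<in> TS q"
  by (simp add: tangent span_base)

lemma subspace_TS: "q \<in> O' \<Longrightarrow> subspace (TS q)"
  by (simp add: tangent)

lemma TS_orth:
  assumes q: "q \<in> O'" and v: "v \<in> TS q"
  shows "v \<bullet> f q = 0" "j < n \<Longrightarrow> v \<bullet> V q j = 0"
proof -
  have "v = (\<Sum>a<m. (v \<bullet> E q a) *\<^sub>R E q a)"
    using stiefel_span_representation[OF E[OF q]] v tangent[OF q] by blast
  then have "v \<bullet> z = (\<Sum>a<m. (v \<bullet> E q a) *\<^sub>R E q a) \<bullet> z" for z by (rule arg_cong)
  then have rep: "v \<bullet> z = (\<Sum>a<m. (v \<bullet> E q a) * (E q a \<bullet> z))" for z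
    unfolding inner_sum_left inner_scaleR_left .
  show "v \<bullet> f q = 0" unfolding rep[of "f q"]
    using fE[OF q] by (intro sum.neutral) (auto simp: inner_commute)
  show "v \<bullet> V q j = 0" if "j < n" unfolding rep[of "V q j"]
    using EV[OF q _ that] by (intro sum.neutral) auto
qed

lemma tproj_TS: "q \<in> O' \<Longrightarrow> tproj q v \<in> TS q"
  unfolding tproj_def by (intro subspace_sum subspace_TS subspace_scale E_TS) auto

lemma tproj_eq: "q \<in> O' \<Longrightarrow> tproj q v = v - (v \<bullet> f q) *\<^sub>R f q - (\<Sum>j<n. (v \<bullet> V q j) *\<^sub>R V q j)"
  using complete[of q v] by (simp add: tproj_def algebra_simps)

lemma TS_iff: "q \<in> O' \<Longrightarrow> v \<in> TS q \<longleftrightarrow> v \<bullet> f q = 0 \<and> (\<forall>j<n. v \<bullet> V q j = 0)"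
  using TS_orth tproj_eq[of q v] tproj_TS[of q v] by auto

lemma tproj_inner: "q \<in> O' \<Longrightarrow> e \<in> TS q \<Longrightarrow> tproj q v \<bullet> e = v \<bullet> e"
  using TS_orth[of q e] by (simp add: tproj_eq inner_diff_left inner_sum_left inner_commute[of _ e] inner_diff_right inner_sum_right)

lemma TS_eqI:
  assumes q: "q \<in> O'" and "v \<in> TS q" "w \<in> TS q" "\<And>a. a < m \<Longrightarrow> v \<bullet> E q a = w \<bullet> E q a"
  shows "v = w"
proof -
  have "v = (\<Sum>a<m. (v \<bullet> E q a) *\<^sub>R E q a)" "w = (\<Sum>a<m. (w \<bullet> E q a) *\<^sub>R E q a)"
    using stiefel_span_representation[OF E[OF q]] assms(2,3) tangent[OF q] by blast+
  then show ?thesis using assms(4) by (metis (no_types, lifting) lessThan_iff sum.cong)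
qed

lemma field_E: "a < m \<Longrightarrow> tangent_field T f O' (\<lambda>q. E q a)"
  unfolding tangent_field_def using smE E_TS by blast

lemma field_extension:
  assumes p: "p \<in> O'" and z: "z \<in> TS p"
  obtains Z where "tangent_field T f O' Z" "Z p = z"
proof
  show "tangent_field T f O' (\<lambda>q. \<Sum>a<m. (z \<bullet> E p a) *\<^sub>R E q a)"
    unfolding tangent_field_def
    by (intro conjI smooth_map_sum smooth_map_bilinear[OF bounded_bilinear_scaleR] smooth_map_const smE
        ballI subspace_sum subspace_TS subspace_scale E_TS) auto
  show "(\<Sum>a<m. (z \<bullet> E p a) *\<^sub>R E p a) = z"
    using stiefel_span_representation[OF E[OF p]] z tangent[OF p] by simp
qed

lemma V_derivative:
  assumes "p \<in> O'" "j < n"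
  obtains V' where "has_tangential_derivative T f (\<lambda>q. V q j) V' p" "\<And>v. v \<in> TS p \<Longrightarrow> D (\<lambda>q. V q j) p v = V' v"
  using smooth_map_dir_deriv[OF smV[OF assms(2)] op assms(1)] by blast

text \<open>In the Koszul formula all terms cancel except \<open>2 (D\<^sub>X Y) \<bullet> Z\<close>. Only differentiability at \<open>p\<close> is
  asked for, because the formula is also applied to fields \<open>\<nabla>\<^sub>Y Z\<close> and \<open>[X, Y]\<close>.\<close>

lemma levi_civita_eq:
  assumes p: "p \<in> O'" and U: "openin T U" "p \<in> U"
    and X: "has_tangential_derivative T f X X' p" "\<And>q. q \<in> U \<Longrightarrow> X q \<in> TS q"
    and Y: "has_tangential_derivative T f Y Y' p" "\<And>q. q \<in> U \<Longrightarrow> Y q \<in> TS q"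
  shows "levi_civita T f X Y p = tproj p (Y' (X p))"
proof -
  have XY: "X p \<in> TS p" "Y p \<in> TS p" using X Y U by auto
  have koszul: "D (\<lambda>q. Y q \<bullet> Z q) p (X p) + D (\<lambda>q. Z q \<bullet> X q) p (Y p) - D (\<lambda>q. X q \<bullet> Y q) p (Z p)
      + lie_bracket T f X Y p \<bullet> Z p - lie_bracket T f X Z p \<bullet> Y p - lie_bracket T f Y Z p \<bullet> X p
      = 2 * (Y' (X p) \<bullet> Z p)"
    if Z: "openin T U'" "p \<in> U'" "tangent_field T f U' Z" for U' Z
  proof -
    obtain Z' where Z': "has_tangential_derivative T f Z Z' p"
      using smooth_map_has_tangential_derivative[of T U' f Z] Z unfolding tangent_field_def by blast
    have Zp: "Z p \<in> TS p" using Z unfolding tangent_field_def by blast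
    note inner = has_tangential_derivative_bilinear[OF bounded_bilinear_inner]
    show ?thesis
      unfolding lie_bracket_def
        dir_deriv_eq[OF inner[OF Y(1) Z'] XY(1)] dir_deriv_eq[OF inner[OF Z' X(1)] XY(2)]
        dir_deriv_eq[OF inner[OF X(1) Y(1)] Zp] dir_deriv_eq[OF X(1) XY(2)] dir_deriv_eq[OF X(1) Zp]
        dir_deriv_eq[OF Y(1) XY(1)] dir_deriv_eq[OF Y(1) Zp] dir_deriv_eq[OF Z' XY(1)] dir_deriv_eq[OF Z' XY(2)]
      by (simp add: inner_diff_left inner_diff_right inner_commute)
  qed
  show ?thesis
    unfolding levi_civita_def
  proof (rule the_equality)
    show "tproj p (Y' (X p)) \<in> TS p \<and>
        (\<forall>U Z. openin T U \<and> p \<in> U \<and> tangent_field T f U Z \<longrightarrow>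
           2 * (tproj p (Y' (X p)) \<bullet> Z p) =
           D (\<lambda>q. Y q \<bullet> Z q) p (X p) + D (\<lambda>q. Z q \<bullet> X q) p (Y p) - D (\<lambda>q. X q \<bullet> Y q) p (Z p)
      + lie_bracket T f X Y p \<bullet> Z p - lie_bracket T f X Z p \<bullet> Y p - lie_bracket T f Y Z p \<bullet> X p)"
    proof (intro conjI allI impI tproj_TS p)
      fix U Z assume Z: "openin T U \<and> p \<in> U \<and> tangent_field T f U Z"
      then have "Z p \<in> TS p" unfolding tangent_field_def by blast
      then show "2 * (tproj p (Y' (X p)) \<bullet> Z p) =
           D (\<lambda>q. Y q \<bullet> Z q) p (X p) + D (\<lambda>q. Z q \<bullet> X q) p (Y p) - D (\<lambda>q. X q \<bullet> Y q) p (Z p)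
      + lie_bracket T f X Y p \<bullet> Z p - lie_bracket T f X Z p \<bullet> Y p - lie_bracket T f Y Z p \<bullet> X p"
        using koszul[of U Z] Z tproj_inner[OF p] by auto
    qed
  next
    fix w assume w: "w \<in> TS p \<and> (\<forall>U Z. openin T U \<and> p \<in> U \<and> tangent_field T f U Z \<longrightarrow>
           2 * (w \<bullet> Z p) =
           D (\<lambda>q. Y q \<bullet> Z q) p (X p) + D (\<lambda>q. Z q \<bullet> X q) p (Y p) - D (\<lambda>q. X q \<bullet> Y q) p (Z p)
      + lie_bracket T f X Y p \<bullet> Z p - lie_bracket T f X Z p \<bullet> Y p - lie_bracket T f Y Z p \<bullet> X p)"
    show "w = tproj p (Y' (X p))"
    proof (rule TS_eqI[OF p])
      fix a assume a: "a < m"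
      have "2 * (w \<bullet> E p a) = 2 * (Y' (X p) \<bullet> E p a)"
        using w[THEN conjunct2, rule_format, of O' "\<lambda>q. E q a"] op p field_E[OF a] koszul[OF op p field_E[OF a]]
        by simp
      then show "w \<bullet> E p a = tproj p (Y' (X p)) \<bullet> E p a"
        using tproj_inner[OF p E_TS[OF p a]] by simp
    qed (use w tproj_TS[OF p] in auto)
  qed
qed

text \<open>Differentiating \<open>Y \<bullet> f = 0\<close> and \<open>Y \<bullet> V\<^sub>j = 0\<close> shows that the normal components of the derivative of a
  tangent field depend on its value only.\<close>

lemma field_derivative_normal:
  assumes p: "p \<in> O'" and U: "openin T U" "p \<in> U"
    and Y: "has_tangential_derivative T f Y Y' p" "\<And>q. q \<in> U \<Longrightarrow> Y q \<in> TS q" and v: "v \<in> TS p"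
  shows "Y' v \<bullet> f p = - (Y p \<bullet> v)" "j < n \<Longrightarrow> Y' v \<bullet> V p j = B p v (Y p) j"
proof -
  note inner = has_tangential_derivative_bilinear[OF bounded_bilinear_inner]
  have UO: "openin T (U \<inter> O')" "p \<in> U \<inter> O'" using U p op by auto
  have 0: "has_tangential_derivative T f (\<lambda>q. 0::real) (\<lambda>v. 0) p"
    by (rule has_tangential_derivative_const[OF O'_top[OF p]])
  have "has_tangential_derivative T f (\<lambda>q. Y q \<bullet> f q) (\<lambda>v. 0) p"
    by (rule has_tangential_derivative_cong[OF 0 UO]) (use Y(2) TS_orth in auto)
  from has_tangential_derivative_unique[OF this inner[OF Y(1) has_tangential_derivative_immersion[OF O'_top[OF p]]] v]
  show "Y' v \<bullet> f p = - (Y p \<bullet> v)" by simp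
  assume j: "j < n"
  obtain V' where V': "has_tangential_derivative T f (\<lambda>q. V q j) V' p" "\<And>v. v \<in> TS p \<Longrightarrow> D (\<lambda>q. V q j) p v = V' v"
    using V_derivative[OF p j] by metis
  have "has_tangential_derivative T f (\<lambda>q. Y q \<bullet> V q j) (\<lambda>v. 0) p"
    by (rule has_tangential_derivative_cong[OF 0 UO]) (use Y(2) TS_orth j in auto)
  from has_tangential_derivative_unique[OF this inner[OF Y(1) V'(1)] v]
  show "Y' v \<bullet> V p j = B p v (Y p) j" by (simp add: B_def V'(2)[OF v])
qed

text \<open>In a parametrization, \<open>V\<^sub>j\<close> is orthogonal to the coordinate fields \<open>\<partial>\<^sub>b \<psi>\<close>. Differentiating this in the
  direction \<open>a\<close> shows that \<open>B\<^sub>j\<close> is \<open>V\<^sub>j \<bullet> \<partial>\<^sub>a \<partial>\<^sub>b \<psi>\<close>, which is symmetric.\<close>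

lemma B_symmetric:
  assumes p: "p \<in> O'" and v: "v \<in> TS p" and w: "w \<in> TS p" and j: "j < n"
  shows "B p v w j = B p w v j"
proof -
  obtain U W V0 L \<phi> \<psi> g where lp: "local_param m T f U W V0 L \<phi> \<psi> g" "p \<in> U"
    using local_param_exists[OF imm O'_top[OF p]] by metis
  let ?x = "\<phi> (f p)" and ?D = "\<lambda>x. frechet_derivative \<psi> (at x)"
  have V0: "open V0" "Cinf_on V0 \<psi>" "?x \<in> V0" "g ?x = p" using lp by (auto simp: local_param_def)
  have B: "B p (?D ?x a) (?D ?x b) j = V p j \<bullet> frechet_derivative (\<lambda>x. ?D x b) (at ?x) a" if ab: "a \<in> L" "b \<in> L" for a b
  proof -
    let ?c = "\<lambda>t. g (?x + t *\<^sub>R a)"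
    have c: "curve_through T f p (?D ?x a) ?c" by (rule local_param_curve_through[OF lp ab(1)])
    have TSa: "?D ?x a \<in> TS p" using c by (auto simp: tangent_space_def)
    obtain V' where V': "has_tangential_derivative T f (\<lambda>q. V q j) V' p" "\<And>v. v \<in> TS p \<Longrightarrow> D (\<lambda>q. V q j) p v = V' v"
      using V_derivative[OF p j] by metis
    have 1: "((\<lambda>t. V (?c t) j) has_vector_derivative V' (?D ?x a)) (at 0)"
      using has_tangential_derivative_curve[OF V'(1) c] by (simp add: o_def)
    have "((\<lambda>t. ?x + t *\<^sub>R a) has_vector_derivative a) (at 0)"
      by (auto intro!: derivative_eq_intros)
    then have 2: "((\<lambda>t. ?D (?x + t *\<^sub>R a) b) has_vector_derivative frechet_derivative (\<lambda>x. ?D x b) (at ?x) a) (at 0)"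
      using vector_derivative_diff_chain_within[of "\<lambda>t. ?x + t *\<^sub>R a" a 0 UNIV "\<lambda>x. ?D x b"]
        Cinf_on_derivative(1)[OF Cinf_on_derivative(2)[OF V0(2)] V0(3)]
      by (auto simp: o_def intro: has_derivative_at_withinI)
    have 3: "((\<lambda>t. V (?c t) j \<bullet> ?D (?x + t *\<^sub>R a) b) has_vector_derivative
        V p j \<bullet> frechet_derivative (\<lambda>x. ?D x b) (at ?x) a + V' (?D ?x a) \<bullet> ?D ?x b) (at 0)"
      using bounded_bilinear.has_vector_derivative[OF bounded_bilinear_inner 1 2] V0(4) by simp
    obtain d1 where d1: "d1 > 0" "\<And>s. \<bar>s\<bar> < d1 \<Longrightarrow> ?c s \<in> U \<inter> O'"
      using curve_through_stays[OF c, of "U \<inter> O'"] lp p op by (auto simp: local_param_def)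
    obtain d2 where d2: "d2 > 0" "ball ?x d2 \<subseteq> V0" using V0 open_contains_ball by blast
    define d where "d = min d1 (d2 / (norm a + 1))"
    have d: "d > 0" using d1 d2 by (auto simp: d_def intro!: divide_pos_pos add_nonneg_pos)
    have zero: "V (?c t) j \<bullet> ?D (?x + t *\<^sub>R a) b = 0" if t: "\<bar>t\<bar> < d" for t
    proof -
      have "\<bar>t\<bar> * norm a \<le> \<bar>t\<bar> * (norm a + 1)" by (simp add: mult_left_mono)
      also have "\<dots> < d2"
        using t norm_ge_zero[of a] by (simp add: d_def pos_less_divide_eq add_nonneg_pos)
      finally have xV: "?x + t *\<^sub>R a \<in> V0" using d2 by (auto simp: dist_norm subset_iff)
      have xL: "?x + t *\<^sub>R a \<in> L"
        using lp ab by (auto simp: local_param_def intro!: subspace_add subspace_scale)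
      have q: "?c t \<in> U" "?c t \<in> O'" using d1(2)[of t] t by (auto simp: d_def)
      have "\<phi> (f (?c t)) = ?x + t *\<^sub>R a"
        using lp xV xL by (auto simp: local_param_def)
      then have "?D (?x + t *\<^sub>R a) b \<in> TS (?c t)"
        using local_param_tangent_space[OF lp(1) q(1)] ab by auto
      from TS_orth(2)[OF q(2) this j] show ?thesis by (subst inner_commute)
    qed
    have "((\<lambda>t. 0::real) has_vector_derivative
        V p j \<bullet> frechet_derivative (\<lambda>x. ?D x b) (at ?x) a + V' (?D ?x a) \<bullet> ?D ?x b) (at 0)"
      by (rule has_vector_derivative_transform_within_open[OF 3, of "{-d<..<d}"]) (use d zero in auto)
    then have "V p j \<bullet> frechet_derivative (\<lambda>x. ?D x b) (at ?x) a + V' (?D ?x a) \<bullet> ?D ?x b = 0"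
      using vector_derivative_unique_at has_vector_derivative_const by blast
    then show ?thesis by (simp add: B_def V'(2)[OF TSa] inner_commute)
  qed
  obtain a b where ab: "a \<in> L" "v = ?D ?x a" "b \<in> L" "w = ?D ?x b"
    using v w local_param_tangent_space[OF lp] by auto
  show ?thesis
    unfolding ab(2,4) B[OF ab(1,3)] B[OF ab(3,1)] second_derivative_symmetric[OF V0(2,1,3), of b a] ..
qed

text \<open>The right hand side of the Gauss equation: the curvature tensor of the unit sphere plus the
  contribution of the second fundamental form.\<close>

definition gauss_rhs :: "'a \<Rightarrow> 'e \<Rightarrow> 'e \<Rightarrow> 'e \<Rightarrow> 'e \<Rightarrow> real" where
  "gauss_rhs p x y z e = (y \<bullet> z) * (x \<bullet> e) - (x \<bullet> z) * (y \<bullet> e)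
     + (\<Sum>j<n. B p y z j * B p x e j - B p x z j * B p y e j)"

text \<open>\<open>\<nabla>\<^sub>Y Z\<close> is \<open>D\<^sub>Y Z\<close> minus its normal components \<open>- Y \<bullet> Z\<close> and \<open>B\<^sub>j(Y, Z)\<close> along \<open>f\<close> and \<open>V\<^sub>j\<close>. When this is
  differentiated along \<open>X\<close> and paired with a tangent vector, only the derivatives of \<open>f\<close> and \<open>V\<^sub>j\<close>
  survive, not those of the coefficients.\<close>

lemma second_covariant_derivative:
  assumes p: "p \<in> O'" and U: "openin T U" "p \<in> U"
    and X: "tangent_field T f U X" and Y: "tangent_field T f U Y" "has_tangential_derivative T f Y Y' p"
    and Z: "tangent_field T f U Z"
    and G': "has_tangential_derivative T f (\<lambda>q. D Z q (Y q)) G' p" and e: "e \<in> TS p"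
  shows "levi_civita T f X (levi_civita T f Y Z) p \<in> TS p"
    and "levi_civita T f X (levi_civita T f Y Z) p \<bullet> e
     = G' (X p) \<bullet> e + (Y p \<bullet> Z p) * (X p \<bullet> e) + (\<Sum>j<n. B p (Y p) (Z p) j * B p (X p) e j)"
proof -
  have sm: "smooth_map (subtopology T U) f X" "smooth_map (subtopology T U) f Y" "smooth_map (subtopology T U) f Z"
    and TSs: "\<And>q. q \<in> U \<Longrightarrow> X q \<in> TS q" "\<And>q. q \<in> U \<Longrightarrow> Y q \<in> TS q" "\<And>q. q \<in> U \<Longrightarrow> Z q \<in> TS q"
    using X Y Z unfolding tangent_field_def by auto
  have UO: "openin T (U \<inter> O')" "p \<in> U \<inter> O'" using U p op by auto
  obtain X' where X': "has_tangential_derivative T f X X' p"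
    using smooth_map_has_tangential_derivative[OF sm(1) U] by metis
  have G: "levi_civita T f Y Z q = tproj q (D Z q (Y q))" if q: "q \<in> U \<inter> O'" for q
  proof -
    obtain Yq where Yq: "has_tangential_derivative T f Y Yq q"
      using smooth_map_has_tangential_derivative[OF sm(2) U(1)] q by blast
    obtain Zq where Zq: "has_tangential_derivative T f Z Zq q"
      using smooth_map_has_tangential_derivative[OF sm(3) U(1)] q by blast
    show ?thesis
      using levi_civita_eq[OF _ U(1) _ Yq TSs(2) Zq TSs(3)] dir_deriv_eq[OF Zq TSs(2)] q by simp
  qed
  have "\<forall>j. \<exists>V'. j < n \<longrightarrow> has_tangential_derivative T f (\<lambda>q. V q j) V' p \<and> (\<forall>v\<in>TS p. D (\<lambda>q. V q j) p v = V' v)"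
    using smooth_map_dir_deriv[OF smV op p] by blast
  from choice[OF this] obtain V' where V': "\<And>j. j < n \<Longrightarrow> has_tangential_derivative T f (\<lambda>q. V q j) (V' j) p"
    "\<And>j v. j < n \<Longrightarrow> v \<in> TS p \<Longrightarrow> D (\<lambda>q. V q j) p v = V' j v" by blast
  note inner = has_tangential_derivative_bilinear[OF bounded_bilinear_inner]
  note scale = has_tangential_derivative_bilinear[OF bounded_bilinear_scaleR]
  note imm' = has_tangential_derivative_immersion[OF O'_top[OF p]]
  define H' where "H' v = G' v - (((D Z p (Y p)) \<bullet> f p) *\<^sub>R v + (D Z p (Y p) \<bullet> v + G' v \<bullet> f p) *\<^sub>R f p)
       - (\<Sum>j<n. (D Z p (Y p) \<bullet> V p j) *\<^sub>R V' j v + (D Z p (Y p) \<bullet> V' j v + G' v \<bullet> V p j) *\<^sub>R V p j)" for v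
  have "has_tangential_derivative T f
      (\<lambda>q. D Z q (Y q) - (D Z q (Y q) \<bullet> f q) *\<^sub>R f q - (\<Sum>j<n. (D Z q (Y q) \<bullet> V q j) *\<^sub>R V q j)) H' p"
    unfolding H'_def
    by (intro has_tangential_derivative_diff has_tangential_derivative_sum scale inner imm' G' O'_top[OF p] V'(1)) auto
  then have H: "has_tangential_derivative T f (levi_civita T f Y Z) H' p"
    by (rule has_tangential_derivative_cong[OF _ UO]) (use G tproj_eq in auto)
  have HTS: "levi_civita T f Y Z q \<in> TS q" if "q \<in> U \<inter> O'" for q
    using G[OF that] tproj_TS that by simp
  have LC: "levi_civita T f X (levi_civita T f Y Z) p = tproj p (H' (X p))"
    by (rule levi_civita_eq[OF p UO X' _ H HTS]) (use TSs in auto)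
  then show "levi_civita T f X (levi_civita T f Y Z) p \<in> TS p" using tproj_TS[OF p] by simp
  obtain Z' where Z': "has_tangential_derivative T f Z Z' p"
    using smooth_map_has_tangential_derivative[OF sm(3) U] by metis
  have Yp: "Y p \<in> TS p" and Xp: "X p \<in> TS p" using TSs U by auto
  have DZ: "D Z p (Y p) \<bullet> f p = - (Y p \<bullet> Z p)" "\<And>j. j < n \<Longrightarrow> D Z p (Y p) \<bullet> V p j = B p (Y p) (Z p) j"
    using field_derivative_normal[OF p U Z' TSs(3) Yp] dir_deriv_eq[OF Z' Yp] by (auto simp: inner_commute)
  have "levi_civita T f X (levi_civita T f Y Z) p \<bullet> e = H' (X p) \<bullet> e"
    using LC tproj_inner[OF p e] by simp
  also have "\<dots> = G' (X p) \<bullet> e + (Y p \<bullet> Z p) * (X p \<bullet> e) - (\<Sum>j<n. B p (Y p) (Z p) j * (V' j (X p) \<bullet> e))"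
  proof -
    have "f p \<bullet> e = 0" "\<And>j. j < n \<Longrightarrow> V p j \<bullet> e = 0"
      using TS_orth[OF p e] by (auto simp: inner_commute)
    then show ?thesis
      unfolding H'_def by (simp add: inner_diff_left inner_add_left inner_sum_left DZ)
  qed
  also have "(\<Sum>j<n. B p (Y p) (Z p) j * (V' j (X p) \<bullet> e)) = - (\<Sum>j<n. B p (Y p) (Z p) j * B p (X p) e j)"
    unfolding sum_negf[symmetric] by (intro sum.cong) (auto simp: B_def V'(2)[OF _ Xp] inner_commute)
  finally show "levi_civita T f X (levi_civita T f Y Z) p \<bullet> e
     = G' (X p) \<bullet> e + (Y p \<bullet> Z p) * (X p \<bullet> e) + (\<Sum>j<n. B p (Y p) (Z p) j * B p (X p) e j)" by simp
qed

text \<open>The normal components of \<open>D\<^sub>X Y\<close> and \<open>D\<^sub>Y X\<close> agree, by the symmetry of \<open>B\<close>.\<close>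

lemma lie_bracket_TS:
  assumes p: "p \<in> O'" and U: "openin T U" "p \<in> U" and X: "tangent_field T f U X" and Y: "tangent_field T f U Y"
  shows "lie_bracket T f X Y p \<in> TS p"
proof -
  have sm: "smooth_map (subtopology T U) f X" "smooth_map (subtopology T U) f Y"
    and TSs: "\<And>q. q \<in> U \<Longrightarrow> X q \<in> TS q" "\<And>q. q \<in> U \<Longrightarrow> Y q \<in> TS q"
    using X Y unfolding tangent_field_def by auto
  obtain X' where X': "has_tangential_derivative T f X X' p"
    using smooth_map_has_tangential_derivative[OF sm(1) U] by metis
  obtain Y' where Y': "has_tangential_derivative T f Y Y' p"
    using smooth_map_has_tangential_derivative[OF sm(2) U] by metis
  have XY: "X p \<in> TS p" "Y p \<in> TS p" using TSs U by auto
  have "lie_bracket T f X Y p = Y' (X p) - X' (Y p)"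
    unfolding lie_bracket_def using dir_deriv_eq[OF X' XY(2)] dir_deriv_eq[OF Y' XY(1)] by simp
  then show ?thesis
    using field_derivative_normal[OF p U X' TSs(1) XY(2)] field_derivative_normal[OF p U Y' TSs(2) XY(1)]
      B_symmetric[OF p XY]
    by (simp add: TS_iff[OF p] inner_diff_left inner_diff_right inner_commute)
qed

text \<open>The tangential parts of the flat second derivatives cancel up to a derivative along \<open>[X, Y]\<close>, and the
  remaining terms come from the motion of the normal directions \<open>f\<close> and \<open>V\<^sub>j\<close>.\<close>

lemma curvature_of_fields:
  assumes p: "p \<in> O'" and U: "openin T U" "p \<in> U" and X: "tangent_field T f U X"
    and Y: "tangent_field T f U Y" and Z: "tangent_field T f U Z" and e: "e \<in> TS p"
  defines "R \<equiv> levi_civita T f X (levi_civita T f Y Z) p - levi_civita T f Y (levi_civita T f X Z) p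
          - levi_civita T f (lie_bracket T f X Y) Z p"
  shows "R \<in> TS p" "R \<bullet> e = gauss_rhs p (X p) (Y p) (Z p) e"
proof -
  have sm: "smooth_map (subtopology T U) f X" "smooth_map (subtopology T U) f Y" "smooth_map (subtopology T U) f Z"
    and TSs: "\<And>q. q \<in> U \<Longrightarrow> X q \<in> TS q" "\<And>q. q \<in> U \<Longrightarrow> Y q \<in> TS q" "\<And>q. q \<in> U \<Longrightarrow> Z q \<in> TS q"
    using X Y Z unfolding tangent_field_def by auto
  have UO: "openin T (U \<inter> O')" "p \<in> U \<inter> O'" using U p op by auto
  have XY: "X p \<in> TS p" "Y p \<in> TS p" using TSs U by auto
  obtain X' X2 where X': "has_tangential_derivative T f X X' p"
    and X2: "\<And>Y Y' U'. has_tangential_derivative T f Y Y' p \<Longrightarrow> openin T U' \<Longrightarrow> p \<in> U' \<Longrightarrow>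
       (\<And>q. q \<in> U' \<Longrightarrow> Y q \<in> TS q) \<Longrightarrow>
       has_tangential_derivative T f (\<lambda>q. D X q (Y q)) (\<lambda>v. X2 v (Y p) + X' (Y' v)) p"
    by (rule dir_deriv_field_has_tangential_derivative[OF sm(1) U]) blast
  obtain Y' Y2 where Y': "has_tangential_derivative T f Y Y' p"
    and Y2: "\<And>X X' U'. has_tangential_derivative T f X X' p \<Longrightarrow> openin T U' \<Longrightarrow> p \<in> U' \<Longrightarrow>
       (\<And>q. q \<in> U' \<Longrightarrow> X q \<in> TS q) \<Longrightarrow>
       has_tangential_derivative T f (\<lambda>q. D Y q (X q)) (\<lambda>v. Y2 v (X p) + Y' (X' v)) p"
    by (rule dir_deriv_field_has_tangential_derivative[OF sm(2) U]) blast
  obtain Z' Z2 where Z': "has_tangential_derivative T f Z Z' p" and sym: "\<And>v y. Z2 v y = Z2 y v"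
    and Z2: "\<And>Y Y' U'. has_tangential_derivative T f Y Y' p \<Longrightarrow> openin T U' \<Longrightarrow> p \<in> U' \<Longrightarrow>
       (\<And>q. q \<in> U' \<Longrightarrow> Y q \<in> TS q) \<Longrightarrow>
       has_tangential_derivative T f (\<lambda>q. D Z q (Y q)) (\<lambda>v. Z2 v (Y p) + Z' (Y' v)) p"
    by (rule dir_deriv_field_has_tangential_derivative[OF sm(3) U]) blast
  note 1 = second_covariant_derivative[OF p U X Y Y' Z Z2[OF Y' U TSs(2)] e]
  note 2 = second_covariant_derivative[OF p U Y X X' Z Z2[OF X' U TSs(1)] e]
  have br: "has_tangential_derivative T f (lie_bracket T f X Y)
      (\<lambda>v. (Y2 v (X p) + Y' (X' v)) - (X2 v (Y p) + X' (Y' v))) p"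
    unfolding lie_bracket_def[abs_def]
    by (intro has_tangential_derivative_diff Y2[OF X' U TSs(1)] X2[OF Y' U TSs(2)])
  have 3: "levi_civita T f (lie_bracket T f X Y) Z p = tproj p (Z' (lie_bracket T f X Y p))"
    by (rule levi_civita_eq[OF p UO br _ Z']) (use lie_bracket_TS[OF _ U(1) _ X Y] TSs in auto)
  have 4: "lie_bracket T f X Y p = Y' (X p) - X' (Y p)"
    unfolding lie_bracket_def using dir_deriv_eq[OF X' XY(2)] dir_deriv_eq[OF Y' XY(1)] by simp
  show "R \<in> TS p" unfolding R_def
    using 1(1) 2(1) 3 tproj_TS[OF p] subspace_TS[OF p] by (auto intro!: subspace_diff)
  have lin: "Z' (a - b) = Z' a - Z' b" for a b
    using has_tangential_derivative_linear[OF Z'] by (simp add: linear_diff)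
  have "R \<bullet> e = (levi_civita T f X (levi_civita T f Y Z) p \<bullet> e) - (levi_civita T f Y (levi_civita T f X Z) p \<bullet> e)
      - Z' (Y' (X p) - X' (Y p)) \<bullet> e"
    unfolding R_def inner_diff_left 3 tproj_inner[OF p e] 4 ..
  also have "\<dots> = gauss_rhs p (X p) (Y p) (Z p) e"
    using 1(2) 2(2) sym[of "X p" "Y p"]
    by (simp add: lin gauss_rhs_def sum_subtractf inner_diff_left inner_add_left)
  finally show "R \<bullet> e = gauss_rhs p (X p) (Y p) (Z p) e" .
qed

lemma gauss_equation:
  assumes p: "p \<in> O'" and x: "x \<in> TS p" and y: "y \<in> TS p" and z: "z \<in> TS p" and e: "e \<in> TS p"
  shows "riem_curvature T f p x y z \<bullet> e = gauss_rhs p x y z e"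
proof -
  let ?R = "\<lambda>X Y Z. levi_civita T f X (levi_civita T f Y Z) p - levi_civita T f Y (levi_civita T f X Z) p
          - levi_civita T f (lie_bracket T f X Y) Z p"
  obtain X Y Z where F: "tangent_field T f O' X" "X p = x" "tangent_field T f O' Y" "Y p = y"
    "tangent_field T f O' Z" "Z p = z"
    using field_extension[OF p] x y z by metis
  have "riem_curvature T f p x y z = ?R X Y Z"
    unfolding riem_curvature_def
  proof (rule the_equality, intro allI impI)
    fix U' X' Y' Z' assume *: "openin T U' \<and> p \<in> U' \<and> tangent_field T f U' X' \<and> tangent_field T f U' Y' \<and>
       tangent_field T f U' Z' \<and> X' p = x \<and> Y' p = y \<and> Z' p = z"
    show "?R X Y Z = ?R X' Y' Z'"
    proof (rule TS_eqI[OF p])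
      show "?R X Y Z \<in> TS p" by (rule curvature_of_fields(1)[OF p op p F(1,3,5) e])
      show "?R X' Y' Z' \<in> TS p" using curvature_of_fields(1)[OF p, of U' X' Y' Z' e] * e by blast
      fix a assume "a < m"
      then have a: "E p a \<in> TS p" by (rule E_TS[OF p])
      show "?R X Y Z \<bullet> E p a = ?R X' Y' Z' \<bullet> E p a"
        using curvature_of_fields(2)[OF p op p F(1,3,5) a] curvature_of_fields(2)[OF p _ _ _ _ _ a, of U' X' Y' Z'] * F
        by simp
    qed
  next
    fix w assume "\<forall>U X Y Z. openin T U \<and> p \<in> U \<and>
        tangent_field T f U X \<and> tangent_field T f U Y \<and> tangent_field T f U Z \<and>
        X p = x \<and> Y p = y \<and> Z p = z \<longrightarrow> w = ?R X Y Z"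
    then show "w = ?R X Y Z" using op p F by blast
  qed
  then show ?thesis using curvature_of_fields(2)[OF p op p F(1,3,5) e] F by simp
qed

lemma sphere_normal_space_eq:
  assumes p: "p \<in> O'"
  shows "v \<in> sphere_normal_space T f p \<longleftrightarrow> v \<bullet> f p = 0 \<and> (\<forall>e\<in>TS p. v \<bullet> e = 0)"
  unfolding sphere_normal_space_def orthogonal_comp_def real_inner_class.orthogonal_def
  by (auto simp: inner_commute)

text \<open>The normal space of \<open>M\<close> in the sphere is spanned by the \<open>V\<^sub>j\<close>.\<close>

lemma orth_proj_sphere_normal_space:
  assumes p: "p \<in> O'"
  shows "orth_proj (sphere_normal_space T f p) v = (\<Sum>j<n. (v \<bullet> V p j) *\<^sub>R V p j)"
  unfolding orth_proj_def
proof (rule the_equality)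
  let ?N = "sphere_normal_space T f p"
  have VN: "V p j \<in> ?N" if "j < n" for j
    unfolding sphere_normal_space_eq[OF p] using fV[OF p that] TS_orth(2)[OF p _ that] by (simp add: inner_commute)
  have N: "subspace ?N" unfolding sphere_normal_space_def by (rule subspace_orthogonal_comp)
  have tf: "v - (\<Sum>j<n. (v \<bullet> V p j) *\<^sub>R V p j) = (v \<bullet> f p) *\<^sub>R f p + tproj p v"
    unfolding tproj_eq[OF p] by simp
  show "(\<Sum>j<n. (v \<bullet> V p j) *\<^sub>R V p j) \<in> ?N \<and> v - (\<Sum>j<n. (v \<bullet> V p j) *\<^sub>R V p j) \<in> orthogonal_comp ?N"
  proof
    show "(\<Sum>j<n. (v \<bullet> V p j) *\<^sub>R V p j) \<in> ?N"
      by (intro subspace_sum[OF N] subspace_scale[OF N] VN) auto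
    show "v - (\<Sum>j<n. (v \<bullet> V p j) *\<^sub>R V p j) \<in> orthogonal_comp ?N"
      unfolding tf orthogonal_comp_def real_inner_class.orthogonal_def
      using tproj_TS[OF p] by (auto simp: sphere_normal_space_eq[OF p] inner_add_right)
  qed
  fix u assume u: "u \<in> ?N \<and> v - u \<in> orthogonal_comp ?N"
  then have "(v - u) \<bullet> V p j = 0" if "j < n" for j
    using VN[OF that] by (auto simp: orthogonal_comp_def real_inner_class.orthogonal_def inner_commute)
  then have "v \<bullet> V p j = u \<bullet> V p j" if "j < n" for j using that by (simp add: inner_diff_left)
  moreover have "u = (\<Sum>j<n. (u \<bullet> V p j) *\<^sub>R V p j)"
  proof -
    have "u \<bullet> f p = 0" "\<And>a. a < m \<Longrightarrow> u \<bullet> E p a = 0"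
      using u E_TS[OF p] unfolding sphere_normal_space_eq[OF p] by auto
    then show ?thesis using complete[OF p, of u] by simp
  qed
  ultimately show "u = (\<Sum>j<n. (v \<bullet> V p j) *\<^sub>R V p j)"
    by (metis (no_types, lifting) lessThan_iff sum.cong)
qed

lemma second_fundamental_form_eq:
  assumes p: "p \<in> O'" and x: "x \<in> TS p" and y: "y \<in> TS p"
  shows "second_fundamental_form T f p x y = (\<Sum>j<n. B p x y j *\<^sub>R V p j)"
proof -
  have *: "orth_proj (sphere_normal_space T f p) (D Y p x) = (\<Sum>j<n. B p x y j *\<^sub>R V p j)"
    if Y: "openin T U" "p \<in> U" "tangent_field T f U Y" "Y p = y" for U Y
  proof -
    have sm: "smooth_map (subtopology T U) f Y" and TSs: "\<And>q. q \<in> U \<Longrightarrow> Y q \<in> TS q"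
      using Y unfolding tangent_field_def by auto
    obtain Y' where Y': "has_tangential_derivative T f Y Y' p"
      using smooth_map_has_tangential_derivative[OF sm Y(1,2)] by metis
    show ?thesis
      unfolding orth_proj_sphere_normal_space[OF p] dir_deriv_eq[OF Y' x]
      using field_derivative_normal(2)[OF p Y(1,2) Y' TSs x] Y(4) by simp
  qed
  obtain Y where Y: "tangent_field T f O' Y" "Y p = y" using field_extension[OF p y] by metis
  show ?thesis
    unfolding second_fundamental_form_def
  proof (rule the_equality)
    show "\<forall>U Y. openin T U \<and> p \<in> U \<and> tangent_field T f U Y \<and> Y p = y \<longrightarrow>
       (\<Sum>j<n. B p x y j *\<^sub>R V p j) = orth_proj (sphere_normal_space T f p) (D Y p x)"
      using * by metis
    fix w assume "\<forall>U Y. openin T U \<and> p \<in> U \<and> tangent_field T f U Y \<and> Y p = y \<longrightarrow>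
       w = orth_proj (sphere_normal_space T f p) (D Y p x)"
    then show "w = (\<Sum>j<n. B p x y j *\<^sub>R V p j)" using *[OF op p Y] op p Y by metis
  qed
qed

text \<open>The squared norm of the differential of the Gauss map in the direction \<open>v\<close>.\<close>

definition S :: "'a \<Rightarrow> 'e \<Rightarrow> real" where
  "S p v = (\<Sum>j<n. \<Sum>a<m. (D (\<lambda>q. V q j) p v \<bullet> E p a)\<^sup>2)"

text \<open>In the sum over an orthonormal basis \<open>e\<close> of the Gauss equation, the terms with \<open>B(X, X)\<close> contain the
  traces of the \<open>B\<^sub>j\<close>, that is, the mean curvature.\<close>

theorem ricci_minimal:
  assumes p: "p \<in> O'" and minimal: "minimal_in_sphere m T f"
    and X: "X \<in> TS p" "norm X = 1"
  shows "ricci m T f p X X = real m - 1 - S p X"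
proof -
  define e where "e = (SOME e. orthonormal_basis m (TS p) e)"
  have "orthonormal_basis m (TS p) (E p)"
    using E[OF p] tangent[OF p] by (simp add: orthonormal_basis_def)
  then have "orthonormal_basis m (TS p) e" unfolding e_def by (rule someI[of "orthonormal_basis m (TS p)"])
  then have e: "e \<in> stiefel m" "span (e ` {..<m}) = TS p" by (auto simp: orthonormal_basis_def)
  have eTS: "e i \<in> TS p" if "i < m" for i
    using span_base[of "e i" "e ` {..<m}"] that unfolding e(2) by simp
  have tr: "(\<Sum>i<m. B p (e i) (e i) j) = 0" if j: "j < n" for j
  proof -
    have "(\<Sum>i<m. second_fundamental_form T f p (e i) (e i)) = 0"
      using minimal O'_top[OF p] unfolding minimal_in_sphere_def e_def Let_def by blast
    then have "0 = (\<Sum>i<m. second_fundamental_form T f p (e i) (e i)) \<bullet> V p j" by simp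
    also have "\<dots> = (\<Sum>i<m. (\<Sum>j<n. B p (e i) (e i) j *\<^sub>R V p j) \<bullet> V p j)"
      unfolding inner_sum_left[of _ "{..<m}"]
      by (intro sum.cong refl arg_cong2[where f = inner] second_fundamental_form_eq p eTS) auto
    also have "\<dots> = (\<Sum>i<m. B p (e i) (e i) j)"
      by (intro sum.cong refl stiefel_inner_sum[OF V[OF p] j])
    finally show ?thesis by simp
  qed
  have XX: "X \<bullet> X = 1" using X(2) by (simp add: power2_norm_eq_inner[symmetric])
  have Xe: "(\<Sum>i<m. (X \<bullet> e i)\<^sup>2) = 1"
    using stiefel_span_norm[OF e(1), of X] X e(2) by simp
  have "ricci m T f p X X = (\<Sum>i<m. gauss_rhs p (e i) X X (e i))"
    unfolding ricci_def e_def[symmetric] Let_def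
    by (intro sum.cong refl gauss_equation p eTS X) auto
  also have "\<dots> = (\<Sum>i<m. 1 - (X \<bullet> e i)\<^sup>2 + (\<Sum>j<n. B p X X j * B p (e i) (e i) j - (B p X (e i) j)\<^sup>2))"
  proof (intro sum.cong refl)
    fix i assume "i \<in> {..<m}"
    then have i: "i < m" by simp
    have "e i \<bullet> e i = 1" using stiefel_inner[OF e(1) i i] by simp
    then show "gauss_rhs p (e i) X X (e i) = 1 - (X \<bullet> e i)\<^sup>2 + (\<Sum>j<n. B p X X j * B p (e i) (e i) j - (B p X (e i) j)\<^sup>2)"
      unfolding gauss_rhs_def XX using B_symmetric[OF p eTS[OF i] X(1)]
      by (simp add: power2_eq_square inner_commute)
  qed
  also have "\<dots> = real m - 1 + (\<Sum>j<n. B p X X j * (\<Sum>i<m. B p (e i) (e i) j)) - (\<Sum>j<n. \<Sum>i<m. (B p X (e i) j)\<^sup>2)"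
    by (simp add: sum.distrib sum_subtractf Xe sum_distrib_left sum.swap[of _ "{..<m}" "{..<n}"])
  also have "(\<Sum>j<n. B p X X j * (\<Sum>i<m. B p (e i) (e i) j)) = 0" using tr by simp
  also have "(\<Sum>j<n. \<Sum>i<m. (B p X (e i) j)\<^sup>2) = S p X"
    unfolding S_def
  proof (rule sum.cong[OF refl])
    fix j
    have "(\<Sum>i<m. (B p X (e i) j)\<^sup>2) = (\<Sum>i<m. (D (\<lambda>q. V q j) p X \<bullet> e i)\<^sup>2)"
      by (simp add: B_def inner_commute)
    also have "\<dots> = (\<Sum>a<m. (D (\<lambda>q. V q j) p X \<bullet> E p a)\<^sup>2)"
      by (rule stiefel_parseval[OF e(1) E[OF p]]) (simp add: e(2) tangent[OF p])
    finally show "(\<Sum>i<m. (B p X (e i) j)\<^sup>2) = (\<Sum>a<m. (D (\<lambda>q. V q j) p X \<bullet> E p a)\<^sup>2)" .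
  qed
  finally show ?thesis by simp
qed

end

section \<open>Principal angles and the canonical metric of the Grassmannian\<close>

lemma gram_mat_carrier [simp]: "gram_mat n \<xi> \<zeta> \<in> carrier_mat n n"
  by (simp add: gram_mat_def)

lemma gram_mat_mult_carrier [simp]: "gram_mat n \<xi> \<zeta> * gram_mat n \<xi>' \<zeta>' \<in> carrier_mat n n"
  by (rule mult_carrier_mat[of _ n n]) simp_all

lemma index_mult_mat_sum:
  assumes "M \<in> carrier_mat n n" "N \<in> carrier_mat n n" "i < n" "j < n"
  shows "(M * N) $$ (i, j) = (\<Sum>k<n. M $$ (i, k) * N $$ (k, j))"
  using assms by (auto simp: scalar_prod_def lessThan_atLeast0 intro!: sum.cong)

text \<open>Gram matrices of frames of the same plane are the coordinate changes between them.\<close>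

lemma gram_mat_mult:
  assumes \<zeta>: "\<zeta> \<in> stiefel n" and \<xi>: "\<And>i. i < n \<Longrightarrow> \<xi> i \<in> span (\<zeta> ` {..<n})"
  shows "gram_mat n \<xi> \<zeta> * gram_mat n \<zeta> \<eta> = gram_mat n \<xi> \<eta>"
proof (rule eq_matI)
  fix i j assume "i < dim_row (gram_mat n \<xi> \<eta>)" "j < dim_col (gram_mat n \<xi> \<eta>)"
  then have ij: "i < n" "j < n" by (auto simp: gram_mat_def)
  have "\<xi> i \<bullet> \<eta> j = (\<Sum>k<n. (\<xi> i \<bullet> \<zeta> k) *\<^sub>R \<zeta> k) \<bullet> \<eta> j"
    using stiefel_span_representation[OF \<zeta> \<xi>[OF ij(1)]] by (rule arg_cong)
  then show "(gram_mat n \<xi> \<zeta> * gram_mat n \<zeta> \<eta>) $$ (i, j) = gram_mat n \<xi> \<eta> $$ (i, j)"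
    using ij by (subst index_mult_mat_sum[of _ n]) (auto simp: gram_mat_def inner_sum_left)
qed (auto simp: gram_mat_def)

lemma gram_mat_self: "\<xi> \<in> stiefel n \<Longrightarrow> gram_mat n \<xi> \<xi> = 1\<^sub>m n"
  by (rule eq_matI) (auto simp: gram_mat_def stiefel_inner)

lemma gram_mat_transpose: "transpose_mat (gram_mat n \<xi> \<zeta>) = gram_mat n \<zeta> \<xi>"
  by (rule eq_matI) (auto simp: gram_mat_def inner_commute)

lemma det_gram_mat_mult:
  assumes "\<zeta> \<in> stiefel n" "\<And>i. i < n \<Longrightarrow> \<xi> i \<in> span (\<zeta> ` {..<n})"
  shows "Determinant.det (gram_mat n \<xi> \<eta>) = Determinant.det (gram_mat n \<xi> \<zeta>) * Determinant.det (gram_mat n \<zeta> \<eta>)"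
  using det_mult[of "gram_mat n \<xi> \<zeta>" n "gram_mat n \<zeta> \<eta>"] gram_mat_mult[OF assms] by simp

lemma oriented_span_eqI:
  assumes \<xi>: "\<xi> \<in> stiefel n" and \<zeta>: "\<zeta> \<in> oriented_span n \<xi>"
  shows "oriented_span n \<zeta> = oriented_span n \<xi>"
proof -
  have z: "\<zeta> \<in> stiefel n" "span (\<zeta> ` {..<n}) = span (\<xi> ` {..<n})" "Determinant.det (gram_mat n \<xi> \<zeta>) > 0"
    using \<zeta> by (auto simp: oriented_span_def)
  have sp: "\<xi> i \<in> span (\<zeta> ` {..<n})" if "i < n" for i
    unfolding z(2) using that by (intro span_base) auto
  have "Determinant.det (gram_mat n \<xi> \<eta>) > 0 \<longleftrightarrow> Determinant.det (gram_mat n \<zeta> \<eta>) > 0" for \<eta>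
    by (subst det_gram_mat_mult[OF z(1) sp]) (use z(3) in \<open>simp_all add: zero_less_mult_iff\<close>)
  then show ?thesis unfolding oriented_span_def z(2) by simp
qed

lemma oriented_grassmannian_member:
  assumes "P \<in> oriented_grassmannian n" "\<xi> \<in> P"
  shows "\<xi> \<in> stiefel n" "P = oriented_span n \<xi>"
proof -
  obtain \<zeta> where z: "\<zeta> \<in> stiefel n" "P = oriented_span n \<zeta>"
    using assms(1) unfolding oriented_grassmannian_def by (elim imageE)
  then show "\<xi> \<in> stiefel n" using assms(2) by (simp add: oriented_span_def)
  show "P = oriented_span n \<xi>" using oriented_span_eqI[OF z(1)] assms(2) unfolding z(2) by simp
qed

text \<open>Frames vanish beyond index \<open>n\<close>, so the whole range of every frame in \<open>P\<close> lies in the span.\<close>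

lemma plane_eq_span:
  assumes "P \<in> oriented_grassmannian n" "\<xi> \<in> P"
  shows "plane P = span (\<xi> ` {..<n})"
proof -
  have P: "P = oriented_span n \<xi>" using oriented_grassmannian_member[OF assms] by blast
  have "range \<zeta> \<subseteq> span (\<xi> ` {..<n})" if "\<zeta> \<in> P" for \<zeta>
  proof
    fix v assume "v \<in> range \<zeta>"
    then obtain i where i: "v = \<zeta> i" by blast
    have z: "\<zeta> \<in> stiefel n" "span (\<zeta> ` {..<n}) = span (\<xi> ` {..<n})" using that by (auto simp: P oriented_span_def)
    show "v \<in> span (\<xi> ` {..<n})"
    proof (cases "i < n")
      case True
      then show ?thesis unfolding i z(2)[symmetric] by (intro span_base) auto
    next
      case False
      then show ?thesis using z(1) by (simp add: i stiefel_def span_zero)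
    qed
  qed
  then have "(\<Union>\<zeta>\<in>P. range \<zeta>) \<subseteq> span (\<xi> ` {..<n})" by blast
  then have "plane P \<subseteq> span (\<xi> ` {..<n})" unfolding plane_def by (rule span_minimal) simp
  moreover have "span (\<xi> ` {..<n}) \<subseteq> plane P"
    unfolding plane_def by (rule span_mono) (use assms(2) in auto)
  ultimately show ?thesis by blast
qed

text \<open>For an orthonormal frame \<open>\<xi>\<close>, the component orthogonal to the plane that it spans.\<close>

definition normal_part :: "nat \<Rightarrow> (nat \<Rightarrow> 'e::euclidean_space) \<Rightarrow> 'e \<Rightarrow> 'e" where
  "normal_part n \<xi> v = v - (\<Sum>i<n. (v \<bullet> \<xi> i) *\<^sub>R \<xi> i)"

text \<open>The chordal distance of the two planes, the root of the sum of the squared sines of the principal angles.\<close>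

definition frame_chord :: "nat \<Rightarrow> (nat \<Rightarrow> 'e::euclidean_space) \<Rightarrow> (nat \<Rightarrow> 'e) \<Rightarrow> real" where
  "frame_chord n \<xi> \<zeta> = sqrt (\<Sum>j<n. (norm (normal_part n \<xi> (\<zeta> j)))\<^sup>2)"

lemma bounded_linear_normal_part: "bounded_linear (normal_part n \<xi>)"
  unfolding normal_part_def[abs_def]
  by (intro bounded_linear_sub bounded_linear_ident bounded_linear_sum
      bounded_linear_compose[OF bounded_linear_scaleR_left bounded_linear_inner_left])

lemma normal_part_norm:
  assumes "\<xi> \<in> stiefel n"
  shows "(norm (normal_part n \<xi> v))\<^sup>2 = (norm v)\<^sup>2 - (\<Sum>i<n. (v \<bullet> \<xi> i)\<^sup>2)"
proof -
  let ?u = "\<Sum>i<n. (v \<bullet> \<xi> i) *\<^sub>R \<xi> i"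
  have vu: "v \<bullet> ?u = (\<Sum>i<n. (v \<bullet> \<xi> i)\<^sup>2)" by (simp add: inner_sum_right power2_eq_square)
  have "?u \<bullet> ?u = (\<Sum>i<n. (v \<bullet> \<xi> i) * (?u \<bullet> \<xi> i))" by (simp only: inner_sum_right inner_scaleR_right)
  also have "\<dots> = (\<Sum>i<n. (v \<bullet> \<xi> i)\<^sup>2)"
    by (rule sum.cong[OF refl]) (use stiefel_inner_sum[OF assms] in \<open>simp add: power2_eq_square\<close>)
  finally have uu: "?u \<bullet> ?u = (\<Sum>i<n. (v \<bullet> \<xi> i)\<^sup>2)" .
  show ?thesis
    unfolding normal_part_def power2_norm_eq_inner inner_diff_left inner_diff_right uu vu inner_commute[of ?u v] by simp
qed

lemma normal_part_frame: "\<xi> \<in> stiefel n \<Longrightarrow> j < n \<Longrightarrow> normal_part n \<xi> (\<xi> j) = 0"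
  using stiefel_span_representation[of \<xi> n "\<xi> j"] by (simp add: normal_part_def span_base)

lemma frame_chord_squared:
  assumes "\<xi> \<in> stiefel n" "\<zeta> \<in> stiefel n"
  shows "(frame_chord n \<xi> \<zeta>)\<^sup>2 = real n - (\<Sum>i<n. \<Sum>j<n. (\<xi> i \<bullet> \<zeta> j)\<^sup>2)"
proof -
  have "(frame_chord n \<xi> \<zeta>)\<^sup>2 = (\<Sum>j<n. (norm (normal_part n \<xi> (\<zeta> j)))\<^sup>2)"
    unfolding frame_chord_def by (intro real_sqrt_pow2 sum_nonneg) auto
  also have "\<dots> = (\<Sum>j<n. 1 - (\<Sum>i<n. (\<xi> i \<bullet> \<zeta> j)\<^sup>2))"
  proof (rule sum.cong[OF refl])
    fix j assume "j \<in> {..<n}"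
    then have "(norm (\<zeta> j))\<^sup>2 = 1" using stiefel_inner[OF assms(2), of j j] by (simp add: power2_norm_eq_inner)
    then show "(norm (normal_part n \<xi> (\<zeta> j)))\<^sup>2 = 1 - (\<Sum>i<n. (\<xi> i \<bullet> \<zeta> j)\<^sup>2)"
      unfolding normal_part_norm[OF assms(1)] by (simp add: inner_commute)
  qed
  also have "\<dots> = real n - (\<Sum>i<n. \<Sum>j<n. (\<xi> i \<bullet> \<zeta> j)\<^sup>2)"
    by (subst sum.swap) (simp add: sum_subtractf)
  finally show ?thesis .
qed

lemma frame_chord_nonneg: "0 \<le> frame_chord n \<xi> \<zeta>"
  unfolding frame_chord_def by (intro real_sqrt_ge_zero sum_nonneg) auto

text \<open>The sum of the squares of all cosines is basis independent in each of its two arguments.\<close>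

lemma frame_chord_cong:
  assumes "\<xi> \<in> stiefel n" "\<xi>' \<in> stiefel n" "span (\<xi> ` {..<n}) = span (\<xi>' ` {..<n})"
    and "\<zeta> \<in> stiefel n" "\<zeta>' \<in> stiefel n" "span (\<zeta> ` {..<n}) = span (\<zeta>' ` {..<n})"
  shows "frame_chord n \<xi> \<zeta> = frame_chord n \<xi>' \<zeta>'"
proof -
  have "(\<Sum>i<n. \<Sum>j<n. (\<xi> i \<bullet> \<zeta> j)\<^sup>2) = (\<Sum>i<n. \<Sum>j<n. (\<xi> i \<bullet> \<zeta>' j)\<^sup>2)"
    by (intro sum.cong[OF refl] stiefel_parseval assms)
  also have "\<dots> = (\<Sum>j<n. \<Sum>i<n. (\<zeta>' j \<bullet> \<xi> i)\<^sup>2)" by (subst sum.swap) (simp add: inner_commute)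
  also have "\<dots> = (\<Sum>j<n. \<Sum>i<n. (\<zeta>' j \<bullet> \<xi>' i)\<^sup>2)"
    by (intro sum.cong[OF refl] stiefel_parseval assms)
  also have "\<dots> = (\<Sum>i<n. \<Sum>j<n. (\<xi>' i \<bullet> \<zeta>' j)\<^sup>2)" by (subst sum.swap) (simp add: inner_commute)
  finally have "(frame_chord n \<xi> \<zeta>)\<^sup>2 = (frame_chord n \<xi>' \<zeta>')\<^sup>2"
    using assms by (simp add: frame_chord_squared)
  then show ?thesis using frame_chord_nonneg power2_eq_iff_nonneg by blast
qed

text \<open>A Schur triangulation has the eigenvalues on its diagonal, and the trace is invariant under similarity.\<close>

lemma trace_eq_sum_eigenvalues:
  fixes A :: "real Matrix.mat"
  assumes A: "A \<in> carrier_mat n n" and c: "char_poly A = (\<Prod>i<n. [:- a i, 1:])"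
  shows "(\<Sum>i<n. a i) = (\<Sum>i<n. A $$ (i, i))"
proof -
  define es where "es = map a [0..<n]"
  have "char_poly A = (\<Prod>e\<leftarrow>es. [:- e, 1:])"
    unfolding c es_def by (simp add: prod.list_conv_set_nth lessThan_atLeast0)
  moreover obtain B P Q where BPQ: "schur_decomposition A es = (B, P, Q)" by (cases "schur_decomposition A es") auto
  ultimately have B: "similar_mat_wit A B P Q" "diag_mat B = es"
    using schur_decomposition[OF A] by auto
  then have car: "B \<in> carrier_mat n n" "P \<in> carrier_mat n n" "Q \<in> carrier_mat n n"
    and QP: "Q * P = 1\<^sub>m n" and APBQ: "A = P * B * Q"
    using A unfolding similar_mat_wit_def by (auto simp: Let_def)
  have Bii: "B $$ (i, i) = a i" if "i < n" for i
  proof -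
    have "diag_mat B ! i = es ! i" using B(2) by simp
    then show ?thesis using that car by (simp add: diag_mat_def es_def)
  qed
  have "(\<Sum>i<n. A $$ (i, i)) = (\<Sum>i<n. \<Sum>k<n. (\<Sum>j<n. P $$ (i, j) * B $$ (j, k)) * Q $$ (k, i))"
  proof (rule sum.cong[OF refl])
    fix i assume "i \<in> {..<n}"
    then have i: "i < n" by simp
    have "A $$ (i, i) = (\<Sum>k<n. (P * B) $$ (i, k) * Q $$ (k, i))"
      unfolding APBQ using car i by (intro index_mult_mat_sum mult_carrier_mat[of _ n n]) auto
    also have "\<dots> = (\<Sum>k<n. (\<Sum>j<n. P $$ (i, j) * B $$ (j, k)) * Q $$ (k, i))"
      by (rule sum.cong[OF refl]) (simp add: index_mult_mat_sum[OF car(2,1) i] del: index_mult_mat)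
    finally show "A $$ (i, i) = (\<Sum>k<n. (\<Sum>j<n. P $$ (i, j) * B $$ (j, k)) * Q $$ (k, i))" .
  qed
  also have "\<dots> = (\<Sum>j<n. \<Sum>k<n. B $$ (j, k) * (\<Sum>i<n. Q $$ (k, i) * P $$ (i, j)))"
    unfolding sum_distrib_left sum_distrib_right
    by (subst sum.swap, subst (2) sum.swap, subst sum.swap) (simp add: mult_ac)
  also have "\<dots> = (\<Sum>j<n. \<Sum>k<n. B $$ (j, k) * (if k = j then 1 else 0))"
  proof (intro sum.cong refl)
    fix j k assume jk: "j \<in> {..<n}" "k \<in> {..<n}"
    have "(\<Sum>i<n. Q $$ (k, i) * P $$ (i, j)) = (Q * P) $$ (k, j)"
      using jk car by (subst index_mult_mat_sum[of _ n]) auto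
    then show "B $$ (j, k) * (\<Sum>i<n. Q $$ (k, i) * P $$ (i, j)) = B $$ (j, k) * (if k = j then 1 else 0)"
      using jk unfolding QP by simp
  qed
  also have "\<dots> = (\<Sum>j<n. a j)"
    by (intro sum.cong refl) (simp add: Bii if_distrib sum.delta cong: if_cong)
  finally show ?thesis by simp
qed

text \<open>The right hand side depends only on the polynomial, so symmetric functions of the roots are well
  defined whatever their enumeration.\<close>

lemma sum_over_roots:
  fixes a :: "nat \<Rightarrow> real" and h :: "real \<Rightarrow> real"
  shows "(\<Sum>i<n. h (a i)) = sum_mset (image_mset h (proots (\<Prod>i<n. [:- a i, 1:])))"
proof (induction n)
  case (Suc n)
  have nz: "(\<Prod>i<n. [:- a i, 1:]) \<noteq> 0" by (simp add: prod_zero_iff)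
  have "[:- a n, 1:] \<noteq> 0" by simp
  then show ?case
    unfolding prod.lessThan_Suc sum.lessThan_Suc proots_mult[OF nz \<open>[:- a n, 1:] \<noteq> 0\<close>] Suc by simp
qed simp

text \<open>The cosines of the principal angles: \<open>\<alpha> \<alpha>\<^sup>T\<close> is symmetric with eigenvalues in \<open>[0, 1]\<close>, because
  \<open>\<alpha>\<^sup>T\<close> is the matrix of the orthogonal projection of one plane to the other.\<close>

lemma principal_cosines_exist:
  assumes \<xi>: "\<xi> \<in> stiefel n" and \<zeta>: "\<zeta> \<in> stiefel n"
  defines "A \<equiv> gram_mat n \<xi> \<zeta> * transpose_mat (gram_mat n \<xi> \<zeta>)"
  obtains \<mu> :: "nat \<Rightarrow> real" where "\<And>i. i < n \<Longrightarrow> 0 \<le> \<mu> i \<and> \<mu> i \<le> 1"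
    "char_poly A = (\<Prod>i<n. [:- ((\<mu> i)\<^sup>2), 1:])"
proof -
  interpret hp: map_poly_inj_comm_ring_hom complex_of_real ..
  have A: "A \<in> carrier_mat n n" by (simp add: A_def gram_mat_transpose)
  have Aij: "A $$ (i, j) = (\<Sum>k<n. (\<xi> i \<bullet> \<zeta> k) * (\<xi> j \<bullet> \<zeta> k))" if "i < n" "j < n" for i j
    unfolding A_def gram_mat_transpose using that
    by (subst index_mult_mat_sum[of _ n]) (auto simp: gram_mat_def inner_commute)
  define Ac where "Ac = map_mat complex_of_real A"
  have Ac: "Ac \<in> carrier_mat n n" using A by (simp add: Ac_def)
  obtain as where as: "char_poly Ac = (\<Prod>a\<leftarrow>as. [:- a, 1:])" "length as = n"
    using char_poly_factorized[OF Ac] by blast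
  have root: "\<exists>r. a = complex_of_real r \<and> 0 \<le> r \<and> r \<le> 1" if a: "a \<in> set as" for a
  proof -
    have "poly (char_poly Ac) a = 0"
      unfolding as(1) using a by (simp add: poly_prod_list prod_list_zero_iff image_iff)
    then have "eigenvalue Ac a" using eigenvalue_root_char_poly[OF Ac] by simp
    then obtain v where v: "v \<in> carrier_vec n" "v \<noteq> 0\<^sub>v n" "Ac *\<^sub>v v = a \<cdot>\<^sub>v v"
      using Ac unfolding eigenvalue_def eigenvector_def by auto
    define c where "c i = v $ i" for i
    have eq: "(\<Sum>j<n. complex_of_real (A $$ (i, j)) * c j) = a * c i" if i: "i < n" for i
    proof -
      have "(Ac *\<^sub>v v) $ i = (\<Sum>j<n. complex_of_real (A $$ (i, j)) * c j)"
        using i v(1) A by (auto simp: scalar_prod_def lessThan_atLeast0 Ac_def c_def intro!: sum.cong)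
      then show ?thesis using i v by (simp add: c_def)
    qed
    \<comment> \<open>Pairing the eigenvector equation with \<open>c\<close> gives \<open>a \<bar>c\<bar>\<^sup>2 = \<bar>w\<bar>\<^sup>2\<close> for the projection \<open>w\<close> of \<open>c\<close>.\<close>
    define w where "w k = (\<Sum>i<n. complex_of_real (\<xi> i \<bullet> \<zeta> k) * c i)" for k
    define W where "W = (\<Sum>k<n. (cmod (w k))\<^sup>2)"
    define C where "C = (\<Sum>i<n. (cmod (c i))\<^sup>2)"
    have "(\<Sum>i<n. cnj (c i) * (\<Sum>j<n. complex_of_real (A $$ (i, j)) * c j)) = (\<Sum>i<n. cnj (c i) * (a * c i))"
      by (intro sum.cong refl) (simp add: eq)
    also have "\<dots> = a * complex_of_real C"
      unfolding C_def of_real_sum sum_distrib_left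
      by (intro sum.cong refl) (simp add: complex_norm_square del: of_real_power)
    also have "(\<Sum>i<n. cnj (c i) * (\<Sum>j<n. complex_of_real (A $$ (i, j)) * c j)) = complex_of_real W"
    proof -
      have "(\<Sum>i<n. cnj (c i) * (\<Sum>j<n. complex_of_real (A $$ (i, j)) * c j))
          = (\<Sum>i<n. \<Sum>j<n. \<Sum>k<n. cnj (c i) * complex_of_real (\<xi> i \<bullet> \<zeta> k) * (complex_of_real (\<xi> j \<bullet> \<zeta> k) * c j))"
        unfolding sum_distrib_left by (intro sum.cong refl) (simp add: Aij sum_distrib_left sum_distrib_right mult_ac)
      also have "\<dots> = (\<Sum>k<n. \<Sum>i<n. \<Sum>j<n. cnj (c i) * complex_of_real (\<xi> i \<bullet> \<zeta> k) * (complex_of_real (\<xi> j \<bullet> \<zeta> k) * c j))"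
        by (subst (2) sum.swap, subst sum.swap) simp
      also have "\<dots> = (\<Sum>k<n. cnj (w k) * w k)"
        unfolding w_def cnj_sum sum_product by (intro sum.cong refl) simp
      also have "\<dots> = complex_of_real W"
        unfolding W_def of_real_sum
        by (intro sum.cong refl) (simp add: complex_norm_square mult.commute del: of_real_power)
      finally show ?thesis .
    qed
    finally have aC: "complex_of_real W = a * complex_of_real C" .
    have "C > 0"
    proof -
      obtain i where "i < n" "c i \<noteq> 0"
      proof (rule ccontr)
        assume "\<not> thesis"
        then have "v = 0\<^sub>v n" using v(1) that by (intro eq_vecI) (auto simp: c_def)
        then show False using v(2) by blast
      qed
      then have "0 < (cmod (c i))\<^sup>2" by simp
      also have "\<dots> \<le> C" unfolding C_def using \<open>i < n\<close> by (intro member_le_sum) auto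
      finally show ?thesis .
    qed
    have "W \<le> C"
    proof -
      define x y where "x = (\<Sum>i<n. Re (c i) *\<^sub>R \<xi> i)" and "y = (\<Sum>i<n. Im (c i) *\<^sub>R \<xi> i)"
      have w: "Re (w k) = x \<bullet> \<zeta> k" "Im (w k) = y \<bullet> \<zeta> k" for k
        by (auto simp: w_def x_def y_def inner_sum_left mult.commute)
      have bessel: "(\<Sum>k<n. (u \<bullet> \<zeta> k)\<^sup>2) \<le> (norm u)\<^sup>2" for u
        using normal_part_norm[OF \<zeta>, of u] by (smt (verit) zero_le_power2)
      have nrm: "(norm (\<Sum>i<n. r i *\<^sub>R \<xi> i))\<^sup>2 = (\<Sum>i<n. (r i)\<^sup>2)" for r :: "nat \<Rightarrow> real"
      proof -
        have "(\<Sum>i<n. r i *\<^sub>R \<xi> i) \<in> span (\<xi> ` {..<n})" by (intro span_sum span_scale span_base) auto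
        from stiefel_span_norm[OF \<xi> this] show ?thesis
          using stiefel_inner_sum[OF \<xi>, of _ r] by simp
      qed
      have "W = (\<Sum>k<n. (x \<bullet> \<zeta> k)\<^sup>2) + (\<Sum>k<n. (y \<bullet> \<zeta> k)\<^sup>2)"
        by (simp add: W_def cmod_power2 w sum.distrib)
      also have "\<dots> \<le> (norm x)\<^sup>2 + (norm y)\<^sup>2" by (intro add_mono bessel)
      also have "\<dots> = C" by (simp add: x_def y_def nrm C_def cmod_power2 sum.distrib)
      finally show ?thesis .
    qed
    have "W \<ge> 0" unfolding W_def by (intro sum_nonneg) auto
    have "a = complex_of_real (W / C)" using aC \<open>C > 0\<close> by (simp add: field_simps)
    then show ?thesis using \<open>W \<ge> 0\<close> \<open>W \<le> C\<close> \<open>C > 0\<close> by (intro exI[of _ "W / C"]) auto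
  qed
  then obtain r where r: "\<And>a. a \<in> set as \<Longrightarrow> a = complex_of_real (r a) \<and> 0 \<le> r a \<and> r a \<le> 1" by metis
  define \<mu> where "\<mu> i = sqrt (r (as ! i))" for i
  have rI: "as ! i = complex_of_real ((\<mu> i)\<^sup>2)" "0 \<le> r (as ! i)" "r (as ! i) \<le> 1" if "i < n" for i
    using r[of "as ! i"] that as(2) by (auto simp: \<mu>_def)
  show thesis
  proof (rule that[of \<mu>])
    show "0 \<le> \<mu> i \<and> \<mu> i \<le> 1" if "i < n" for i
      using rI[OF that] by (simp add: \<mu>_def)
    have "map_poly complex_of_real (char_poly A) = (\<Prod>a\<leftarrow>as. [:- a, 1:])"
      using as(1) unfolding Ac_def by (simp only: of_real_hom.char_poly_hom[OF A])
    also have "\<dots> = (\<Prod>i<n. [:- (as ! i), 1:])"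
      using as(2) by (simp add: prod.list_conv_set_nth lessThan_atLeast0)
    also have "\<dots> = (\<Prod>i<n. map_poly complex_of_real [:- ((\<mu> i)\<^sup>2), 1:])"
      by (intro prod.cong refl) (simp add: rI(1))
    also have "\<dots> = map_poly complex_of_real (\<Prod>i<n. [:- ((\<mu> i)\<^sup>2), 1:])"
      by (simp add: hp.hom_prod)
    finally show "char_poly A = (\<Prod>i<n. [:- ((\<mu> i)\<^sup>2), 1:])" by simp
  qed
qed

text \<open>Changing the frame of the second plane does not affect \<open>\<alpha> \<alpha>\<^sup>T\<close>, and changing that of the first conjugates it.\<close>

lemma char_poly_gram_cong:
  assumes "\<xi> \<in> stiefel n" "\<xi>' \<in> stiefel n" "span (\<xi> ` {..<n}) = span (\<xi>' ` {..<n})"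
    and "\<zeta> \<in> stiefel n" "\<zeta>' \<in> stiefel n" "span (\<zeta> ` {..<n}) = span (\<zeta>' ` {..<n})"
  shows "char_poly (gram_mat n \<xi> \<zeta> * transpose_mat (gram_mat n \<xi> \<zeta>))
       = char_poly (gram_mat n \<xi>' \<zeta>' * transpose_mat (gram_mat n \<xi>' \<zeta>'))"
proof (rule char_poly_similar, rule similar_matI)
  let ?G = "gram_mat n"
  have sp: "\<And>i. i < n \<Longrightarrow> \<xi> i \<in> span (\<xi>' ` {..<n})" "\<And>i. i < n \<Longrightarrow> \<xi>' i \<in> span (\<xi> ` {..<n})"
     "\<And>i. i < n \<Longrightarrow> \<zeta> i \<in> span (\<zeta>' ` {..<n})" "\<And>i. i < n \<Longrightarrow> \<zeta>' i \<in> span (\<zeta> ` {..<n})"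
    using assms(3,6) by (metis imageI lessThan_iff span_base)+
  show "{?G \<xi> \<zeta> * transpose_mat (?G \<xi> \<zeta>), ?G \<xi>' \<zeta>' * transpose_mat (?G \<xi>' \<zeta>'), ?G \<xi> \<xi>', ?G \<xi>' \<xi>} \<subseteq> carrier_mat n n"
    by (simp add: gram_mat_transpose)
  show "?G \<xi> \<xi>' * ?G \<xi>' \<xi> = 1\<^sub>m n" "?G \<xi>' \<xi> * ?G \<xi> \<xi>' = 1\<^sub>m n"
    using gram_mat_mult[OF assms(2) sp(1)] gram_mat_mult[OF assms(1) sp(2)] gram_mat_self assms by simp_all
  have 1: "?G \<xi> \<xi>' * ?G \<xi>' \<eta> = ?G \<xi> \<eta>" for \<eta> by (rule gram_mat_mult[OF assms(2) sp(1)])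
  have 2: "?G \<eta> \<xi>' * ?G \<xi>' \<xi> = ?G \<eta> \<xi>" for \<eta>
  proof -
    have "?G \<eta> \<xi>' * ?G \<xi>' \<xi> = transpose_mat (?G \<xi> \<xi>' * ?G \<xi>' \<eta>)"
      by (subst transpose_mult[of _ n n _ n]) (auto simp: gram_mat_transpose)
    then show ?thesis by (simp add: 1 gram_mat_transpose)
  qed
  have 3: "?G \<eta> \<zeta>' * ?G \<zeta>' \<zeta> = ?G \<eta> \<zeta>" for \<eta>
  proof -
    have "?G \<eta> \<zeta>' * ?G \<zeta>' \<zeta> = transpose_mat (?G \<zeta> \<zeta>' * ?G \<zeta>' \<eta>)"
      by (subst transpose_mult[of _ n n _ n]) (auto simp: gram_mat_transpose)
    then show ?thesis by (simp add: gram_mat_mult[OF assms(5) sp(3)] gram_mat_transpose)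
  qed
  have "?G \<xi> \<xi>' * (?G \<xi>' \<zeta>' * ?G \<zeta>' \<xi>') * ?G \<xi>' \<xi> = (?G \<xi> \<xi>' * ?G \<xi>' \<zeta>') * (?G \<zeta>' \<xi>' * ?G \<xi>' \<xi>)"
    by (simp add: assoc_mult_mat[of _ n n _ n _ n])
  also have "\<dots> = ?G \<xi> \<zeta>' * ?G \<zeta>' \<xi>" by (simp only: 1 2)
  also have "\<dots> = ?G \<xi> \<zeta>' * (?G \<zeta>' \<zeta> * ?G \<zeta> \<xi>)" by (simp only: gram_mat_mult[OF assms(4) sp(4)])
  also have "\<dots> = (?G \<xi> \<zeta>' * ?G \<zeta>' \<zeta>) * ?G \<zeta> \<xi>"
    by (simp add: assoc_mult_mat[of _ n n _ n _ n])
  also have "\<dots> = ?G \<xi> \<zeta> * ?G \<zeta> \<xi>" by (simp only: 3)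
  finally show "?G \<xi> \<zeta> * transpose_mat (?G \<xi> \<zeta>) = ?G \<xi> \<xi>' * (?G \<xi>' \<zeta>' * transpose_mat (?G \<xi>' \<zeta>')) * ?G \<xi>' \<xi>"
    by (simp add: gram_mat_transpose)
qed

text \<open>The principal cosines of one pair of frames compute \<open>d\<^sub>c\<close>, and the trace of \<open>\<alpha> \<alpha>\<^sup>T\<close> relates them to the
  chordal distance.\<close>

lemma d_c_eq:
  assumes P: "P \<in> oriented_grassmannian n" "\<xi> \<in> P" and Q: "Q \<in> oriented_grassmannian n" "\<zeta> \<in> Q"
  obtains \<mu> :: "nat \<Rightarrow> real" where "\<And>i. i < n \<Longrightarrow> 0 \<le> \<mu> i \<and> \<mu> i \<le> 1"
    "(frame_chord n \<xi> \<zeta>)\<^sup>2 = (\<Sum>i<n. 1 - (\<mu> i)\<^sup>2)" "d_c n P Q = sqrt (\<Sum>i<n. (arccos (\<mu> i))\<^sup>2)"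
proof -
  have \<xi>: "\<xi> \<in> stiefel n" "P = oriented_span n \<xi>" and \<zeta>: "\<zeta> \<in> stiefel n" "Q = oriented_span n \<zeta>"
    using oriented_grassmannian_member P Q by blast+
  let ?A = "\<lambda>\<xi> \<zeta>. gram_mat n \<xi> \<zeta> * transpose_mat (gram_mat n \<xi> \<zeta>)"
  obtain \<mu> where \<mu>: "\<And>i. i < n \<Longrightarrow> 0 \<le> \<mu> i \<and> \<mu> i \<le> 1" "char_poly (?A \<xi> \<zeta>) = (\<Prod>i<n. [:- ((\<mu> i)\<^sup>2), 1:])"
    using principal_cosines_exist[OF \<xi>(1) \<zeta>(1)] by metis
  show thesis
  proof (rule that[OF \<mu>(1)])
    have "?A \<xi> \<zeta> \<in> carrier_mat n n" by (simp add: gram_mat_transpose)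
    from trace_eq_sum_eigenvalues[OF this \<mu>(2)]
    have "(\<Sum>i<n. (\<mu> i)\<^sup>2) = (\<Sum>i<n. ?A \<xi> \<zeta> $$ (i, i))" .
    also have "\<dots> = (\<Sum>i<n. \<Sum>j<n. (\<xi> i \<bullet> \<zeta> j)\<^sup>2)"
      unfolding gram_mat_transpose
      by (intro sum.cong refl) (simp add: index_mult_mat_sum[of _ n] gram_mat_def inner_commute power2_eq_square del: index_mult_mat)
    finally show "(frame_chord n \<xi> \<zeta>)\<^sup>2 = (\<Sum>i<n. 1 - (\<mu> i)\<^sup>2)"
      unfolding frame_chord_squared[OF \<xi>(1) \<zeta>(1)] by (simp add: sum_subtractf)
    show "d_c n P Q = sqrt (\<Sum>i<n. (arccos (\<mu> i))\<^sup>2)"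
      unfolding d_c_def Let_def
    proof (rule the_equality)
      show "\<exists>\<xi>\<in>P. \<exists>\<zeta>\<in>Q. \<exists>\<mu>'. (\<forall>i<n. 0 \<le> \<mu>' i \<and> \<mu>' i \<le> 1) \<and> char_poly (?A \<xi> \<zeta>) = (\<Prod>i<n. [:- ((\<mu>' i)\<^sup>2), 1:]) \<and>
         sqrt (\<Sum>i<n. (arccos (\<mu> i))\<^sup>2) = sqrt (\<Sum>i<n. (arccos (\<mu>' i))\<^sup>2)"
        using P Q \<mu> by blast
      fix d assume "\<exists>\<xi>\<in>P. \<exists>\<zeta>\<in>Q. \<exists>\<mu>'. (\<forall>i<n. 0 \<le> \<mu>' i \<and> \<mu>' i \<le> 1) \<and> char_poly (?A \<xi> \<zeta>) = (\<Prod>i<n. [:- ((\<mu>' i)\<^sup>2), 1:]) \<and>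
         d = sqrt (\<Sum>i<n. (arccos (\<mu>' i))\<^sup>2)"
      then obtain \<xi>' \<zeta>' \<mu>' where *: "\<xi>' \<in> P" "\<zeta>' \<in> Q" "\<And>i. i < n \<Longrightarrow> 0 \<le> \<mu>' i"
        "char_poly (?A \<xi>' \<zeta>') = (\<Prod>i<n. [:- ((\<mu>' i)\<^sup>2), 1:])" "d = sqrt (\<Sum>i<n. (arccos (\<mu>' i))\<^sup>2)"
        by blast
      have "char_poly (?A \<xi> \<zeta>) = char_poly (?A \<xi>' \<zeta>')"
        by (rule char_poly_gram_cong) (use *(1,2) \<xi> \<zeta> in \<open>auto simp: oriented_span_def\<close>)
      then have eq: "(\<Prod>i<n. [:- ((\<mu>' i)\<^sup>2), 1:]) = (\<Prod>i<n. [:- ((\<mu> i)\<^sup>2), 1:])" using *(4) \<mu>(2) by simp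
      have "(\<Sum>i<n. (arccos (\<mu>' i))\<^sup>2) = (\<Sum>i<n. (arccos (sqrt ((\<mu>' i)\<^sup>2)))\<^sup>2)"
        by (intro sum.cong refl) (use *(3) in simp)
      also have "\<dots> = (\<Sum>i<n. (arccos (sqrt ((\<mu> i)\<^sup>2)))\<^sup>2)"
        using sum_over_roots[of "\<lambda>x. (arccos (sqrt x))\<^sup>2" "\<lambda>i. (\<mu>' i)\<^sup>2" n]
          sum_over_roots[of "\<lambda>x. (arccos (sqrt x))\<^sup>2" "\<lambda>i. (\<mu> i)\<^sup>2" n] eq by simp
      also have "\<dots> = (\<Sum>i<n. (arccos (\<mu> i))\<^sup>2)"
        by (intro sum.cong refl) (use \<mu>(1) in simp)
      finally show "d = sqrt (\<Sum>i<n. (arccos (\<mu> i))\<^sup>2)" using *(5) by simp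
    qed
  qed
qed

text \<open>\<open>sin \<theta> \<le> \<theta>\<close> for each principal angle.\<close>

lemma frame_chord_le_d_c:
  assumes P: "P \<in> oriented_grassmannian n" "\<xi> \<in> P" and Q: "Q \<in> oriented_grassmannian n" "\<zeta> \<in> Q"
  shows "frame_chord n \<xi> \<zeta> \<le> d_c n P Q"
proof -
  obtain \<mu> where \<mu>: "\<And>i. i < n \<Longrightarrow> 0 \<le> \<mu> i \<and> \<mu> i \<le> 1" "(frame_chord n \<xi> \<zeta>)\<^sup>2 = (\<Sum>i<n. 1 - (\<mu> i)\<^sup>2)"
    "d_c n P Q = sqrt (\<Sum>i<n. (arccos (\<mu> i))\<^sup>2)"
    using d_c_eq[OF P Q] by metis
  have "(frame_chord n \<xi> \<zeta>)\<^sup>2 \<le> (\<Sum>i<n. (arccos (\<mu> i))\<^sup>2)"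
    unfolding \<mu>(2)
  proof (rule sum_mono)
    fix i assume "i \<in> {..<n}"
    then have m: "0 \<le> \<mu> i" "\<mu> i \<le> 1" using \<mu>(1) by auto
    have "1 - (\<mu> i)\<^sup>2 = (sin (arccos (\<mu> i)))\<^sup>2" using m by (simp add: sin_squared_eq)
    also have "\<dots> \<le> (arccos (\<mu> i))\<^sup>2"
      using abs_sin_x_le_abs_x[of "arccos (\<mu> i)"] by (metis abs_le_square_iff)
    finally show "1 - (\<mu> i)\<^sup>2 \<le> (arccos (\<mu> i))\<^sup>2" .
  qed
  then show ?thesis unfolding \<mu>(3) by (rule real_le_rsqrt)
qed

text \<open>\<open>\<theta> \<le> (1 + e) sin \<theta>\<close> for small angles, and a small chordal distance forces all principal angles to be small.\<close>

lemma d_c_le_frame_chord: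
  assumes e: "e > 0"
  shows "\<exists>\<eta>>0. \<forall>P\<in>oriented_grassmannian n. \<forall>\<xi>\<in>P. \<forall>Q\<in>oriented_grassmannian n. \<forall>\<zeta>\<in>Q.
      frame_chord n \<xi> (\<zeta> :: nat \<Rightarrow> 'e::euclidean_space) < \<eta> \<longrightarrow> d_c n P Q \<le> (1 + e) * frame_chord n \<xi> \<zeta>"
proof -
  have "((\<lambda>x::real. sin x / x) \<longlongrightarrow> 1) (at 0)"
    using DERIV_sin[of "0::real"] by (simp add: has_field_derivative_iff)
  moreover have "1 / (1 + e) < 1" using e by simp
  ultimately have "eventually (\<lambda>x. 1 / (1 + e) < sin x / x) (at (0::real))"
    by (rule order_tendstoD)
  then obtain d where d: "d > 0" "\<And>x::real. x \<noteq> 0 \<Longrightarrow> dist x 0 < d \<Longrightarrow> 1 / (1 + e) < sin x / x"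
    unfolding eventually_at by auto
  \<comment> \<open>The sine is increasing up to \<open>pi/2\<close>, so \<open>sin \<theta> < sin d'\<close> bounds the angle \<open>\<theta>\<close>.\<close>
  define d' where "d' = min d (pi/2)"
  have d': "0 < d'" "d' \<le> pi/2" "d' \<le> d" using d(1) by (auto simp: d'_def)
  have small: "x \<le> (1 + e) * sin x" if "0 \<le> x" "x < d'" for x
  proof (cases "x = 0")
    case False
    then show ?thesis using d(2)[of x] that d' e by (simp add: field_simps)
  qed simp
  have "sin d' > 0" using d' by (intro sin_gt_zero) auto
  show ?thesis
  proof (intro exI[of _ "sin d'"] conjI ballI impI \<open>sin d' > 0\<close>)
    fix P Q and \<xi> \<zeta> :: "nat \<Rightarrow> 'e"
    assume P: "P \<in> oriented_grassmannian n" "\<xi> \<in> P" and Q: "Q \<in> oriented_grassmannian n" "\<zeta> \<in> Q"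
      and chord: "frame_chord n \<xi> \<zeta> < sin d'"
    obtain \<mu> where \<mu>: "\<And>i. i < n \<Longrightarrow> 0 \<le> \<mu> i \<and> \<mu> i \<le> 1" "(frame_chord n \<xi> \<zeta>)\<^sup>2 = (\<Sum>i<n. 1 - (\<mu> i)\<^sup>2)"
      "d_c n P Q = sqrt (\<Sum>i<n. (arccos (\<mu> i))\<^sup>2)"
      using d_c_eq[OF P Q] by metis
    have "(\<Sum>i<n. (arccos (\<mu> i))\<^sup>2) \<le> (\<Sum>i<n. (1 + e)\<^sup>2 * (1 - (\<mu> i)\<^sup>2))"
    proof (rule sum_mono)
      fix i assume i: "i \<in> {..<n}"
      then have m: "0 \<le> \<mu> i" "\<mu> i \<le> 1" using \<mu>(1) by auto
      define x where "x = arccos (\<mu> i)"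
      have x: "0 \<le> x" "x \<le> pi/2" using m arccos_lbound[of "\<mu> i"] arccos_le_pi2[of "\<mu> i"] by (auto simp: x_def)
      have s: "1 - (\<mu> i)\<^sup>2 = (sin x)\<^sup>2" using m by (simp add: x_def sin_squared_eq)
      have "1 - (\<mu> i)\<^sup>2 \<le> (frame_chord n \<xi> \<zeta>)\<^sup>2"
        unfolding \<mu>(2) using i \<mu>(1) by (intro member_le_sum) (auto simp: abs_square_le_1 abs_le_iff)
      also have "\<dots> < (sin d')\<^sup>2" using chord frame_chord_nonneg by (intro power_strict_mono) auto
      finally have "(sin x)\<^sup>2 < (sin d')\<^sup>2" using s by simp
      then have "sin x < sin d'"
        using \<open>sin d' > 0\<close> by (metis less_imp_le power_less_imp_less_base)
      then have "x < d'"
        using sin_monotone_2pi_le[of d' x] x d' pi_gt_zero by (smt (verit) )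
      then have "x \<le> (1 + e) * sin x" using small x by blast
      then have "x\<^sup>2 \<le> ((1 + e) * sin x)\<^sup>2" using x by (intro power_mono) auto
      then show "(arccos (\<mu> i))\<^sup>2 \<le> (1 + e)\<^sup>2 * (1 - (\<mu> i)\<^sup>2)" unfolding s by (simp add: x_def power_mult_distrib)
    qed
    also have "\<dots> = ((1 + e) * frame_chord n \<xi> \<zeta>)\<^sup>2"
      by (simp add: power_mult_distrib \<mu>(2) sum_distrib_left)
    finally show "d_c n P Q \<le> (1 + e) * frame_chord n \<xi> \<zeta>"
      unfolding \<mu>(3) using e by (intro real_le_lsqrt mult_nonneg_nonneg frame_chord_nonneg) (auto intro: sum_nonneg)
  qed
qed

lemma has_vector_derivative_quotient:
  assumes "(F has_vector_derivative w) (at x within S)"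
  shows "((\<lambda>y. (F y - F x) /\<^sub>R (y - x)) \<longlongrightarrow> w) (at x within S)"
proof -
  have "((\<lambda>y. norm ((F y - F x) - (y - x) *\<^sub>R w) / norm (y - x)) \<longlongrightarrow> 0) (at x within S)"
    using assms unfolding has_vector_derivative_def has_derivative_iff_norm by blast
  moreover have "eventually (\<lambda>y. norm ((F y - F x) - (y - x) *\<^sub>R w) / norm (y - x) = norm ((F y - F x) /\<^sub>R (y - x) - w)) (at x within S)"
    unfolding eventually_at_filter
  proof (intro always_eventually allI impI)
    fix y assume "y \<noteq> x"
    then have "(F y - F x) /\<^sub>R (y - x) - w = ((F y - F x) - (y - x) *\<^sub>R w) /\<^sub>R (y - x)"
      by (simp add: scaleR_diff_right)
    then show "norm ((F y - F x) - (y - x) *\<^sub>R w) / norm (y - x) = norm ((F y - F x) /\<^sub>R (y - x) - w)"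
      by (simp add: divide_inverse mult.commute)
  qed
  ultimately have "((\<lambda>y. norm ((F y - F x) /\<^sub>R (y - x) - w)) \<longlongrightarrow> 0) (at x within S)"
    by (rule Lim_transform_eventually)
  then show ?thesis unfolding Lim_null[of _ w] by (rule tendsto_norm_zero_cancel)
qed

text \<open>The Hilbert-Schmidt norm of the velocity of the plane spanned by a frame \<open>\<xi>\<close> that moves with velocity \<open>w\<close>.\<close>

definition frame_speed :: "nat \<Rightarrow> (nat \<Rightarrow> 'e::euclidean_space) \<Rightarrow> (nat \<Rightarrow> 'e) \<Rightarrow> real" where
  "frame_speed n \<xi> w = sqrt (\<Sum>j<n. (norm (normal_part n \<xi> (w j)))\<^sup>2)"

text \<open>The normal part annihilates the frame at \<open>t\<close>, so it turns the frame at \<open>s\<close> into its difference to the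
  frame at \<open>t\<close>. The absolute value serves approach from either side.\<close>

lemma frame_chord_quotient:
  assumes \<xi>: "\<xi> t \<in> stiefel n"
    and w: "\<And>j. j < n \<Longrightarrow> ((\<lambda>s. \<xi> s j) has_vector_derivative w j) (at t within S)"
  shows "((\<lambda>s. frame_chord n (\<xi> t) (\<xi> s) / \<bar>s - t\<bar>) \<longlongrightarrow> frame_speed n (\<xi> t) w) (at t within S)"
proof -
  let ?N = "normal_part n (\<xi> t)"
  have "((\<lambda>s. sqrt (\<Sum>j<n. (norm (?N ((\<xi> s j - \<xi> t j) /\<^sub>R (s - t))))\<^sup>2)) \<longlongrightarrow> frame_speed n (\<xi> t) w) (at t within S)"
    unfolding frame_speed_def
    by (intro tendsto_intros bounded_linear.tendsto[OF bounded_linear_normal_part] has_vector_derivative_quotient w) auto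
  moreover have "eventually (\<lambda>s. sqrt (\<Sum>j<n. (norm (?N ((\<xi> s j - \<xi> t j) /\<^sub>R (s - t))))\<^sup>2) =
      frame_chord n (\<xi> t) (\<xi> s) / \<bar>s - t\<bar>) (at t within S)"
    unfolding eventually_at_filter
  proof (intro always_eventually allI impI)
    fix s assume s: "s \<noteq> t"
    have "norm (?N ((\<xi> s j - \<xi> t j) /\<^sub>R (s - t))) = norm (?N (\<xi> s j)) / \<bar>s - t\<bar>" if "j < n" for j
      using bounded_linear_normal_part[of n "\<xi> t", THEN bounded_linear.linear] normal_part_frame[OF \<xi> that]
      by (simp add: linear_scale linear_diff divide_inverse mult.commute)
    then have "(\<Sum>j<n. (norm (?N ((\<xi> s j - \<xi> t j) /\<^sub>R (s - t))))\<^sup>2) = (\<Sum>j<n. (norm (?N (\<xi> s j)))\<^sup>2) / \<bar>s - t\<bar>\<^sup>2"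
      by (simp add: power_divide sum_divide_distrib)
    then show "sqrt (\<Sum>j<n. (norm (?N ((\<xi> s j - \<xi> t j) /\<^sub>R (s - t))))\<^sup>2) = frame_chord n (\<xi> t) (\<xi> s) / \<bar>s - t\<bar>"
      by (simp add: frame_chord_def real_sqrt_divide)
  qed
  ultimately show ?thesis by (rule Lim_transform_eventually)
qed

text \<open>The canonical metric is the Hilbert-Schmidt norm of the velocity: to first order, \<open>d\<^sub>c\<close> agrees with the
  chordal distance, whose difference quotients converge.\<close>

theorem g_speed_eq_frame_speed:
  assumes tb: "t < b" and \<gamma>: "\<And>s. s \<in> {t..b} \<Longrightarrow> \<gamma> s \<in> oriented_grassmannian n \<and> \<xi> s \<in> \<gamma> s"
    and w: "\<And>j. j < n \<Longrightarrow> ((\<lambda>s. \<xi> s j) has_vector_derivative w j) (at t within {t..b})"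
  shows "g_speed n \<gamma> t = frame_speed n (\<xi> t) w"
proof -
  let ?\<sigma> = "frame_speed n (\<xi> t) w" and ?\<chi> = "\<lambda>s. frame_chord n (\<xi> t) (\<xi> s)" and ?d = "\<lambda>s. d_c n (\<gamma> t) (\<gamma> s)"
  have at: "at t within {t..b} = at_right t"
    using at_within_Icc_at_right[OF tb] .
  have \<gamma>t: "\<gamma> t \<in> oriented_grassmannian n" "\<xi> t \<in> \<gamma> t" using \<gamma>[of t] tb by auto
  have \<xi>t: "\<xi> t \<in> stiefel n" using oriented_grassmannian_member[OF \<gamma>t] by blast
  have q: "((\<lambda>s. ?\<chi> s / \<bar>s - t\<bar>) \<longlongrightarrow> ?\<sigma>) (at_right t)"
    using frame_chord_quotient[OF \<xi>t w] unfolding at .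
  have \<sigma>0: "?\<sigma> \<ge> 0" unfolding frame_speed_def by (intro real_sqrt_ge_zero sum_nonneg) auto
  have rt: "eventually (\<lambda>s. s \<in> {t<..<b}) (at_right t)" using eventually_at_right_real[OF tb] by simp
  have \<chi>0: "(?\<chi> \<longlongrightarrow> 0) (at_right t)"
  proof -
    have "((\<lambda>s. (?\<chi> s / \<bar>s - t\<bar>) * \<bar>s - t\<bar>) \<longlongrightarrow> ?\<sigma> * \<bar>t - t\<bar>) (at_right t)"
      by (intro tendsto_intros q)
    moreover have "eventually (\<lambda>s. (?\<chi> s / \<bar>s - t\<bar>) * \<bar>s - t\<bar> = ?\<chi> s) (at_right t)"
      using rt by eventually_elim simp
    ultimately have "(?\<chi> \<longlongrightarrow> ?\<sigma> * \<bar>t - t\<bar>) (at_right t)" by (rule Lim_transform_eventually)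
    then show ?thesis by simp
  qed
  have lim: "((\<lambda>s. ?d s / (s - t)) \<longlongrightarrow> ?\<sigma>) (at_right t)"
  proof (rule tendstoI)
    fix e :: real assume e: "e > 0"
    \<comment> \<open>The relative error \<open>e'\<close> costs at most \<open>e/2\<close>, because the quotients stay below \<open>?\<sigma> + e + 1\<close>.\<close>
    define e' where "e' = e / (2 * (?\<sigma> + e + 1))"
    have e': "e' > 0" using e \<sigma>0 by (simp add: e'_def)
    from d_c_le_frame_chord[OF e', of n] obtain \<eta> where \<eta>: "\<eta> > 0"
      "\<forall>P\<in>oriented_grassmannian n. \<forall>\<xi>\<in>P. \<forall>Q\<in>oriented_grassmannian n. \<forall>\<zeta>\<in>Q.
      frame_chord n \<xi> (\<zeta> :: nat \<Rightarrow> 'a) < \<eta> \<longrightarrow> d_c n P Q \<le> (1 + e') * frame_chord n \<xi> \<zeta>" by blast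
    have "eventually (\<lambda>s. ?\<chi> s < \<eta>) (at_right t)" using order_tendstoD(2)[OF \<chi>0 \<eta>(1)] .
    moreover have "eventually (\<lambda>s. dist (?\<chi> s / \<bar>s - t\<bar>) ?\<sigma> < e / 2) (at_right t)" using tendstoD[OF q, of "e/2"] e by simp
    ultimately show "eventually (\<lambda>s. dist (?d s / (s - t)) ?\<sigma> < e) (at_right t)"
      using rt
    proof eventually_elim
      case (elim s)
      then have s: "s \<in> {t..b}" "s - t > 0" by auto
      have up: "?d s \<le> (1 + e') * ?\<chi> s" using \<eta>(2) \<gamma>t elim(1) \<gamma>[OF s(1)] by blast
      have lo: "?\<chi> s \<le> ?d s" using frame_chord_le_d_c[OF \<gamma>t] \<gamma>[OF s(1)] by blast
      define z where "z = ?\<chi> s / (s - t)"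
      have z: "\<bar>z - ?\<sigma>\<bar> < e/2" using elim(2) s by (simp add: z_def dist_real_def)
      have "?d s / (s - t) \<le> (1 + e') * z" "z \<le> ?d s / (s - t)"
        using up lo s(2) by (auto simp: z_def divide_right_mono intro: order_trans[OF divide_right_mono[OF up]])
      moreover have "e' * z \<le> e / 2"
      proof -
        have "z \<le> ?\<sigma> + e + 1" using z e by linarith
        then have "e' * z \<le> e' * (?\<sigma> + e + 1)" using e' by simp
        also have "\<dots> = e / 2" using e \<sigma>0 by (simp add: e'_def field_simps)
        finally show ?thesis .
      qed
      ultimately have "?d s / (s - t) \<le> z + e / 2" "z \<le> ?d s / (s - t)" by (simp_all add: algebra_simps)
      then show ?case using z unfolding dist_real_def by linarith
    qed
  qed
  have d0: "?d t = 0"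
  proof -
    have "?\<chi> t = 0" unfolding frame_chord_def using normal_part_frame[OF \<xi>t] by simp
    moreover obtain \<eta> where \<eta>: "\<eta> > 0" "\<forall>P\<in>oriented_grassmannian n. \<forall>\<xi>\<in>P. \<forall>Q\<in>oriented_grassmannian n. \<forall>\<zeta>\<in>Q.
      frame_chord n \<xi> (\<zeta> :: nat \<Rightarrow> 'a) < \<eta> \<longrightarrow> d_c n P Q \<le> (1 + 1) * frame_chord n \<xi> \<zeta>"
      using d_c_le_frame_chord[of "1::real" n] by auto
    ultimately have "?d t \<le> (1 + 1) * ?\<chi> t" using \<eta>(2)[rule_format, OF \<gamma>t \<gamma>t] by simp
    then show ?thesis using frame_chord_le_d_c[OF \<gamma>t \<gamma>t] \<open>?\<chi> t = 0\<close> by simp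
  qed
  have "((\<lambda>s. ?d s) has_real_derivative ?\<sigma>) (at_right t)"
    using lim d0 by (simp add: has_field_derivative_iff)
  then have "(?d has_vector_derivative ?\<sigma>) (at_right t)"
    by (simp add: has_real_derivative_iff_has_vector_derivative)
  then show ?thesis
    unfolding g_speed_def by (rule vector_derivative_within[rotated]) (simp add: trivial_limit_at_right_real)
qed

section \<open>The differential of the second Gauss map\<close>

lemma sum_lessThan_add:
  fixes g :: "nat \<Rightarrow> 'a::comm_monoid_add"
  shows "(\<Sum>i<m + n. g i) = (\<Sum>i<m. g i) + (\<Sum>j<n. g (m + j))"
  by (induction n) (auto simp: add.assoc)

lemma stiefel_full_span:
  fixes \<xi> :: "nat \<Rightarrow> 'e::euclidean_space"
  assumes "\<xi> \<in> stiefel DIM('e)"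
  shows "span (\<xi> ` {..<DIM('e)}) = UNIV"
proof -
  let ?B = "\<xi> ` {..<DIM('e)}"
  have inj: "inj_on \<xi> {..<DIM('e)}"
  proof (rule inj_onI)
    fix i j assume ij: "i \<in> {..<DIM('e)}" "j \<in> {..<DIM('e)}" "\<xi> i = \<xi> j"
    then show "i = j" using stiefel_inner[OF assms, of i j] stiefel_inner[OF assms, of i i] by (auto split: if_splits)
  qed
  have ind: "independent ?B"
  proof (rule pairwise_orthogonal_independent)
    show "pairwise real_inner_class.orthogonal ?B"
      unfolding pairwise_def real_inner_class.orthogonal_def using stiefel_inner[OF assms] by auto
    show "0 \<notin> ?B" using stiefel_inner[OF assms] by fastforce
  qed
  have "card ?B = DIM('e)" using inj by (simp add: card_image)
  then have "dim ?B = DIM('e)" using dim_eq_card_independent[OF ind] by simp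
  then show ?thesis using dim_eq_full by blast
qed

text \<open>Differentiate \<open>c \<bullet> c = 1\<close>.\<close>

lemma tangent_space_sphere:
  fixes x :: "'e::euclidean_space"
  assumes v: "v \<in> tangent_space (top_of_set (sphere 0 1)) id x"
  shows "v \<bullet> x = 0"
proof -
  obtain c where c: "curve_through (top_of_set (sphere 0 1)) id x v c"
    using v by (auto simp: tangent_space_def)
  then obtain e where e: "e > 0" "smooth_curve (top_of_set (sphere 0 1)) id {-e..e} c" "c 0 = x"
    "(c has_vector_derivative v) (at 0)" by (auto simp: curve_through_def)
  have one: "c s \<bullet> c s = 1" if "s \<in> {-e<..<e}" for s
  proof -
    have "c s \<in> sphere 0 1" using e(2) that unfolding smooth_curve_def continuous_map_def by auto
    then show ?thesis by (simp add: power2_norm_eq_inner[symmetric])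
  qed
  have "((\<lambda>s. c s \<bullet> c s) has_vector_derivative c 0 \<bullet> v + v \<bullet> c 0) (at 0)"
    by (rule bounded_bilinear.has_vector_derivative[OF bounded_bilinear_inner e(4,4)])
  then have "((\<lambda>s. 1::real) has_vector_derivative c 0 \<bullet> v + v \<bullet> c 0) (at 0)"
    by (rule has_vector_derivative_transform_within_open[of _ _ _ "{-e<..<e}"]) (use e(1) one in auto)
  then have "c 0 \<bullet> v + v \<bullet> c 0 = 0"
    using vector_derivative_unique_at has_vector_derivative_const by blast
  then show ?thesis by (simp add: e(3) inner_commute)
qed

lemma smooth_grassmannian_map_lift:
  assumes "smooth_grassmannian_map n T f \<nu>" "p \<in> topspace T"
  obtains U \<xi> where "openin T U" "p \<in> U" "\<And>i. i < n \<Longrightarrow> smooth_map (subtopology T U) f (\<lambda>q. \<xi> q i)"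
    "\<And>q. q \<in> U \<Longrightarrow> \<xi> q \<in> \<nu> q"
proof -
  have "\<exists>U \<xi>. openin T U \<and> p \<in> U \<and> (\<forall>i<n. smooth_map (subtopology T U) f (\<lambda>q. \<xi> q i)) \<and> (\<forall>q\<in>U. \<xi> q \<in> \<nu> q)"
    using assms(1) unfolding smooth_grassmannian_map_def by (elim conjE) (erule bspec[OF _ assms(2)])
  then obtain U \<xi> where "openin T U" "p \<in> U" "\<forall>i<n. smooth_map (subtopology T U) f (\<lambda>q. \<xi> q i)" "\<forall>q\<in>U. \<xi> q \<in> \<nu> q"
    by (elim exE conjE)
  then show thesis by (intro that[of U \<xi>]) simp_all
qed

text \<open>The orientation of \<open>M\<close> provides smooth tangent frames, the smooth Gauss map provides smooth frames of
  the normal planes. By the definition of the Gauss map, the latter complete some frame of the same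
  tangent space to a frame of the sphere; together with \<open>f q\<close> there are \<open>m + n + 1\<close> orthonormal vectors.\<close>

lemma second_gauss_map_adapted_frame:
  fixes f :: "'a \<Rightarrow> 'e::euclidean_space"
  assumes dim: "m + n + 1 = DIM('e)" and imm: "immersed_submanifold m T f"
    and sph: "f ` topspace T \<subseteq> sphere 0 1" and \<tau>: "orientation m T f \<tau>"
    and \<omega>: "orientation (DIM('e) - 1) (top_of_set (sphere 0 1)) id \<omega>"
    and \<nu>: "smooth_grassmannian_map n T f (second_gauss_map m n f \<tau> \<omega>)"
    and p: "p \<in> topspace T"
  obtains O' E V where "adapted_frame m n T f O' E V" "p \<in> O'"
    "\<And>q. q \<in> O' \<Longrightarrow> V q \<in> second_gauss_map m n f \<tau> \<omega> q"
proof -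
  have \<tau>': "smooth_grassmannian_map m T f \<tau>" "\<And>p. p \<in> topspace T \<Longrightarrow> plane (\<tau> p) = tangent_space T f p"
    using \<tau> by (auto simp: orientation_def)
  obtain U1 E where U1: "openin T U1" "p \<in> U1" "\<And>i. i < m \<Longrightarrow> smooth_map (subtopology T U1) f (\<lambda>q. E q i)"
    "\<And>q. q \<in> U1 \<Longrightarrow> E q \<in> \<tau> q"
    using smooth_grassmannian_map_lift[OF \<tau>'(1) p] by metis
  obtain U2 V where U2: "openin T U2" "p \<in> U2" "\<And>i. i < n \<Longrightarrow> smooth_map (subtopology T U2) f (\<lambda>q. V q i)"
    "\<And>q. q \<in> U2 \<Longrightarrow> V q \<in> second_gauss_map m n f \<tau> \<omega> q"
    using smooth_grassmannian_map_lift[OF \<nu> p] by metis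
  define O' where "O' = U1 \<inter> U2"
  have O': "openin T O'" "p \<in> O'" using U1 U2 by (auto simp: O'_def)
  have k: "DIM('e) - 1 = m + n" using dim by simp
  have pt: "q \<in> topspace T" "f q \<in> sphere 0 1" if "q \<in> O'" for q
  proof -
    show "q \<in> topspace T" using openin_subset[OF O'(1)] that by blast
    then show "f q \<in> sphere 0 1" using sph by blast
  qed
  have E: "E q \<in> stiefel m" "tangent_space T f q = span (E q ` {..<m})" if q: "q \<in> O'" for q
  proof -
    have 1: "\<tau> q \<in> oriented_grassmannian m" "E q \<in> \<tau> q"
      using \<tau>'(1) pt[OF q] U1(4) q unfolding smooth_grassmannian_map_def by (auto simp: O'_def)
    then show "E q \<in> stiefel m" "tangent_space T f q = span (E q ` {..<m})"
      using oriented_grassmannian_member[OF 1] plane_eq_span[OF 1] \<tau>'(2)[OF pt(1)[OF q]] by auto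
  qed
  have V: "V q \<in> stiefel n" "\<And>a j. a < m \<Longrightarrow> j < n \<Longrightarrow> E q a \<bullet> V q j = 0"
    "\<And>a. a < m \<Longrightarrow> f q \<bullet> E q a = 0" "\<And>j. j < n \<Longrightarrow> f q \<bullet> V q j = 0" if q: "q \<in> O'" for q
  proof -
    have "V q \<in> second_gauss_map m n f \<tau> \<omega> q" using U2(4) q by (simp add: O'_def)
    then obtain Z where Z: "V q \<in> stiefel n" "Z \<in> \<tau> q" "(\<lambda>i. if i < m then Z i else V q (i - m)) \<in> \<omega> (f q)"
      unfolding second_gauss_map_def by blast
    define F where "F = (\<lambda>i. if i < m then Z i else V q (i - m))"
    have "\<omega> (f q) \<in> oriented_grassmannian (m + n)" "plane (\<omega> (f q)) = tangent_space (top_of_set (sphere 0 1)) id (f q)"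
      using \<omega> pt(2)[OF q] unfolding orientation_def smooth_grassmannian_map_def k by auto
    then have F: "F \<in> stiefel (m + n)" "span (F ` {..<m + n}) = tangent_space (top_of_set (sphere 0 1)) id (f q)"
      using oriented_grassmannian_member(1)[of _ "m + n" F] plane_eq_span[of _ "m + n" F] Z(3) by (auto simp: F_def)
    have Fx: "F i \<bullet> f q = 0" if "i < m + n" for i
      by (rule tangent_space_sphere) (use F(2) that span_base[of "F i" "F ` {..<m + n}"] in auto)
    have FZ: "F a = Z a" if "a < m" for a using that by (simp add: F_def)
    have FV: "F (m + j) = V q j" for j by (simp add: F_def)
    have "\<tau> q \<in> oriented_grassmannian m" using \<tau>'(1) pt[OF q] unfolding smooth_grassmannian_map_def by blast
    from oriented_grassmannian_member(1)[OF this Z(2)] plane_eq_span[OF this Z(2)]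
    have sZ: "span (Z ` {..<m}) = span (E q ` {..<m})" using \<tau>'(2)[OF pt(1)[OF q]] E(2)[OF q] by simp
    have orth: "u \<bullet> E q a = 0" if u: "\<And>b. b < m \<Longrightarrow> u \<bullet> Z b = 0" and a: "a < m" for u a
    proof -
      have "E q a \<in> span (Z ` {..<m})" unfolding sZ using a by (intro span_base) auto
      then have "real_inner_class.orthogonal u (E q a)"
        by (rule orthogonal_to_span) (use u in \<open>auto simp: real_inner_class.orthogonal_def\<close>)
      then show ?thesis by (simp add: real_inner_class.orthogonal_def)
    qed
    show "V q \<in> stiefel n" by fact
    show "f q \<bullet> E q a = 0" if "a < m" for a
      using orth[OF _ that, of "f q"] Fx FZ by (metis inner_commute trans_less_add1)
    show "f q \<bullet> V q j = 0" if "j < n" for j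
      using Fx[of "m + j"] FV that by (simp add: inner_commute)
    show "E q a \<bullet> V q j = 0" if a: "a < m" and j: "j < n" for a j
    proof -
      have "V q j \<bullet> Z b = 0" if "b < m" for b
        using stiefel_inner[OF F(1), of "m + j" b] that j FZ[OF that] FV by simp
      from orth[OF this a] show ?thesis by (simp add: inner_commute)
    qed
  qed
  have ff: "f q \<bullet> f q = 1" if "q \<in> O'" for q
    using pt(2)[OF that] by (simp add: power2_norm_eq_inner[symmetric])
  have complete: "v = (v \<bullet> f q) *\<^sub>R f q + (\<Sum>a<m. (v \<bullet> E q a) *\<^sub>R E q a) + (\<Sum>j<n. (v \<bullet> V q j) *\<^sub>R V q j)"
    if q: "q \<in> O'" for q v
  proof -
    define F where "F i = (if i < m then E q i else if i < m + n then V q (i - m) else if i = m + n then f q else 0)" for i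
    have "F \<in> stiefel DIM('e)"
      unfolding stiefel_def mem_Collect_eq dim[symmetric]
    proof (intro conjI allI impI)
      fix i j assume ij: "i < m + n + 1" "j < m + n + 1"
      have "i < m \<or> (\<exists>a<n. i = m + a) \<or> i = m + n" "j < m \<or> (\<exists>a<n. j = m + a) \<or> j = m + n"
        using ij by presburger+
      then show "F i \<bullet> F j = (if i = j then 1 else 0)"
        using stiefel_inner[OF E(1)[OF q]] stiefel_inner[OF V(1)[OF q]] V(2-4)[OF q] ff[OF q]
        by (elim disjE exE conjE) (auto simp: F_def inner_commute)
    qed (auto simp: F_def)
    then have "v = (\<Sum>i<DIM('e). (v \<bullet> F i) *\<^sub>R F i)"
      using stiefel_span_representation[of F "DIM('e)" v] stiefel_full_span[of F] by simp
    also have "\<dots> = (\<Sum>a<m. (v \<bullet> F a) *\<^sub>R F a) + (\<Sum>j<n. (v \<bullet> F (m + j)) *\<^sub>R F (m + j)) + (v \<bullet> F (m + n)) *\<^sub>R F (m + n)"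
      unfolding dim[symmetric] by (simp add: sum_lessThan_add)
    also have "\<dots> = (v \<bullet> f q) *\<^sub>R f q + (\<Sum>a<m. (v \<bullet> E q a) *\<^sub>R E q a) + (\<Sum>j<n. (v \<bullet> V q j) *\<^sub>R V q j)"
      by (simp add: F_def)
    finally show ?thesis .
  qed
  have "adapted_frame m n T f O' E V"
  proof
    show "smooth_map (subtopology T O') f (\<lambda>q. E q a)" if "a < m" for a
      by (rule smooth_map_subtopology_mono[OF U1(3)[OF that] O'(1)]) (simp add: O'_def)
    show "smooth_map (subtopology T O') f (\<lambda>q. V q j)" if "j < n" for j
      by (rule smooth_map_subtopology_mono[OF U2(3)[OF that] O'(1)]) (simp add: O'_def)
  qed (fact imm O' E V ff complete)+
  then show thesis
    by (rule that[OF _ O'(2)]) (simp add: U2(4) O'_def)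
qed

lemma smooth_map_compose_curve:
  assumes h: "smooth_map (subtopology T U) f h" and U: "openin T U" and c: "smooth_curve T f J c" and cU: "c ` J \<subseteq> U"
  shows "smooth_map (top_of_set J) id (\<lambda>s. h (c s))"
  unfolding smooth_map_def
proof
  fix t assume "t \<in> topspace (top_of_set J)"
  then have t: "t \<in> J" by simp
  then have ct: "c t \<in> U" using cU by blast
  obtain V W H where V: "openin T V" "c t \<in> V" "open W" "f ` V \<subseteq> W" "Cinf_on W H" "\<And>q. q \<in> V \<Longrightarrow> h q = H (f q)"
    using smooth_map_local[OF h U ct] by metis
  have sm: "smooth_map (top_of_set J) id (f \<circ> c)" using c by (simp add: smooth_curve_def)
  have "\<exists>A W' C. openin (top_of_set J) A \<and> t \<in> A \<and> open W' \<and> id ` A \<subseteq> W' \<and> Cinf_on W' C \<and>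
      (\<forall>s\<in>A. (f \<circ> c) s = C (id s))"
    using sm[unfolded smooth_map_def] by (rule bspec) (simp add: t)
  then obtain A W' C where A: "openin (top_of_set J) A" "t \<in> A" "open W'" "id ` A \<subseteq> W'" "Cinf_on W' C"
      "\<forall>s\<in>A. (f \<circ> c) s = C (id s)" by (elim exE conjE) (rule that; assumption)
  have cA: "openin (top_of_set J) {s \<in> J. c s \<in> V}"
    using openin_continuous_map_preimage[of "top_of_set J" T c V] c V(1) by (auto simp: smooth_curve_def)
  define W'' where "W'' = W' \<inter> C -` W"
  have W'': "open W''" unfolding W''_def
    using continuous_open_preimage[OF Cinf_on_continuous[OF A(5)] A(3) V(3)] .
  have C: "Cinf_on W'' (\<lambda>s. H (C s))"
    by (rule Cinf_on_compose[OF W'' V(3) _ V(5)]) (use A(5) in \<open>auto simp: W''_def intro: Cinf_on_subset\<close>)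
  show "\<exists>U W H. openin (top_of_set J) U \<and> t \<in> U \<and> open W \<and> id ` U \<subseteq> W \<and> Cinf_on W H \<and> (\<forall>q\<in>U. h (c q) = H (id q))"
  proof (intro exI conjI ballI)
    show "openin (top_of_set J) (A \<inter> {s \<in> J. c s \<in> V})" using A(1) cA by (rule openin_Int)
    show "t \<in> A \<inter> {s \<in> J. c s \<in> V}" using A t V by simp
    show "id ` (A \<inter> {s \<in> J. c s \<in> V}) \<subseteq> W''"
      using A(4,6) V(4) by (fastforce simp: W''_def)
    show "h (c s) = H (C (id s))" if "s \<in> A \<inter> {s \<in> J. c s \<in> V}" for s
      using that A(6) V(6) by auto
  qed (use W'' C in auto)
qed

lemma orth_proj_orthogonal_comp_self:
  fixes L :: "'e::euclidean_space set"
  assumes "subspace L" "u \<in> L"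
  shows "orth_proj (orthogonal_comp L) u = 0"
  unfolding orth_proj_def orthogonal_comp_self[OF assms(1)]
proof (rule the_equality)
  show "0 \<in> orthogonal_comp L \<and> u - 0 \<in> L"
    using assms by (simp add: orthogonal_comp_def real_inner_class.orthogonal_def)
  fix u' assume u': "u' \<in> orthogonal_comp L \<and> u - u' \<in> L"
  then have "u' \<in> L" using subspace_diff[OF assms, of "u - u'"] by simp
  then have "u' \<bullet> u' = 0" using u' by (auto simp: orthogonal_comp_def real_inner_class.orthogonal_def)
  then show "u' = 0" by simp
qed

context adapted_frame
begin

lemma normal_part_V:
  assumes p: "p \<in> O'"
  shows "normal_part n (V p) u = (u \<bullet> f p) *\<^sub>R f p + tproj p u"
  unfolding normal_part_def tproj_eq[OF p] by simp

text \<open>Differentiate \<open>V\<^sub>j \<bullet> f = 0\<close> and use that \<open>V\<^sub>j\<close> is normal to \<open>M\<close>.\<close>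

lemma dir_deriv_V_f:
  assumes p: "p \<in> O'" and v: "v \<in> TS p" and j: "j < n"
  shows "D (\<lambda>q. V q j) p v \<bullet> f p = 0"
proof -
  obtain V' where V': "has_tangential_derivative T f (\<lambda>q. V q j) V' p" "\<And>v. v \<in> TS p \<Longrightarrow> D (\<lambda>q. V q j) p v = V' v"
    using V_derivative[OF p j] by metis
  have 0: "has_tangential_derivative T f (\<lambda>q. 0::real) (\<lambda>v. 0) p"
    by (rule has_tangential_derivative_const[OF O'_top[OF p]])
  have "has_tangential_derivative T f (\<lambda>q. V q j \<bullet> f q) (\<lambda>v. 0) p"
    by (rule has_tangential_derivative_cong[OF 0 op p]) (use fV j in \<open>simp add: inner_commute\<close>)
  from has_tangential_derivative_unique[OF this has_tangential_derivative_bilinear[OF bounded_bilinear_inner V'(1)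
        has_tangential_derivative_immersion[OF O'_top[OF p]]] v]
  show ?thesis using TS_orth(2)[OF p v j] V'(2)[OF v] by (simp add: inner_commute)
qed

lemma tproj_norm:
  assumes p: "p \<in> O'"
  shows "(norm (tproj p u))\<^sup>2 = (\<Sum>a<m. (u \<bullet> E p a)\<^sup>2)"
proof -
  have "(norm (tproj p u))\<^sup>2 = (\<Sum>a<m. (tproj p u \<bullet> E p a)\<^sup>2)"
    using stiefel_span_norm[OF E[OF p], of "tproj p u"] tproj_TS[OF p] tangent[OF p] by simp
  also have "\<dots> = (\<Sum>a<m. (u \<bullet> E p a)\<^sup>2)"
    by (rule sum.cong[OF refl]) (simp add: tproj_inner[OF p E_TS[OF p]])
  finally show ?thesis .
qed

lemma S_eq:
  assumes p: "p \<in> O'" and v: "v \<in> TS p"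
  shows "S p v = (\<Sum>j<n. (norm (normal_part n (V p) (D (\<lambda>q. V q j) p v)))\<^sup>2)"
  unfolding S_def
  by (rule sum.cong[OF refl]) (simp add: normal_part_V[OF p] dir_deriv_V_f[OF p v] tproj_norm[OF p])

lemma S_nonneg: "0 \<le> S p v"
  unfolding S_def by (intro sum_nonneg) auto

lemma S_scaleR:
  assumes p: "p \<in> O'" and v: "v \<in> TS p"
  shows "S p (r *\<^sub>R v) = r\<^sup>2 * S p v"
  unfolding S_def sum_distrib_left
proof (intro sum.cong[OF refl])
  fix j a assume "j \<in> {..<n}"
  then have j: "j < n" by simp
  obtain V' where V': "has_tangential_derivative T f (\<lambda>q. V q j) V' p" "\<And>v. v \<in> TS p \<Longrightarrow> D (\<lambda>q. V q j) p v = V' v"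
    using V_derivative[OF p j] by metis
  have "r *\<^sub>R v \<in> TS p" by (rule subspace_scale[OF subspace_TS[OF p] v])
  then show "(D (\<lambda>q. V q j) p (r *\<^sub>R v) \<bullet> E p a)\<^sup>2 = r\<^sup>2 * (D (\<lambda>q. V q j) p v \<bullet> E p a)\<^sup>2"
    using V'(2) v has_tangential_derivative_linear[OF V'(1)] by (simp add: linear_scale power_mult_distrib)
qed

text \<open>Immersivity of the Gauss map: a direction in which no \<open>V\<^sub>j\<close> leaves the normal plane is killed
  by the differential.\<close>

lemma immersion_imp_S_pos:
  assumes p: "p \<in> O'" and v: "v \<in> TS p" "v \<noteq> 0"
    and \<nu>: "smooth_grassmannian_embedding n T f \<nu>" and V\<nu>: "\<And>q. q \<in> O' \<Longrightarrow> V q \<in> \<nu> q"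
  shows "S p v > 0"
proof (rule ccontr)
  assume "\<not> S p v > 0"
  then have S0: "S p v = 0" using S_nonneg[of p v] by linarith
  obtain c where c: "curve_through T f p v c" using v(1) by (auto simp: tangent_space_def)
  have OG: "\<nu> q \<in> oriented_grassmannian n" if "q \<in> O'" for q
    using \<nu> O'_top[OF that] unfolding smooth_grassmannian_embedding_def smooth_grassmannian_map_def by blast
  have c0: "c 0 = p" using c by (simp add: curve_through_def)
  have pl: "plane ((\<nu> \<circ> c) 0) = span (V p ` {..<n})"
    using plane_eq_span[OF OG[OF p] V\<nu>[OF p]] c0 by simp
  let ?L = "span (V p ` {..<n})"
  obtain e where e: "e > 0" "smooth_curve T f {-e..e} c" using c by (auto simp: curve_through_def)
  obtain d where d: "d > 0" "\<And>s. \<bar>s\<bar> < d \<Longrightarrow> c s \<in> O'" using curve_through_stays[OF c op p] by blast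
  have dV: "\<exists>w\<in>?L. ((\<lambda>s. V (c s) j) has_vector_derivative w) (at 0)" if j: "j < n" for j
  proof -
    obtain V' where V': "has_tangential_derivative T f (\<lambda>q. V q j) V' p" "\<And>v. v \<in> TS p \<Longrightarrow> D (\<lambda>q. V q j) p v = V' v"
      using V_derivative[OF p j] by metis
    have "((\<lambda>s. V (c s) j) has_vector_derivative V' v) (at 0)"
      using has_tangential_derivative_curve[OF V'(1) c] by (simp add: o_def)
    moreover have "V' v \<in> ?L"
    proof -
      have "(norm (normal_part n (V p) (D (\<lambda>q. V q j) p v)))\<^sup>2 \<le> S p v"
        unfolding S_eq[OF p v(1)] by (rule member_le_sum) (use j in auto)
      then have "normal_part n (V p) (V' v) = 0" using S0 V'(2)[OF v(1)] by simp
      then have "V' v = (\<Sum>i<n. (V' v \<bullet> V p i) *\<^sub>R V p i)" by (simp add: normal_part_def)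
      also have "\<dots> \<in> ?L" by (intro span_sum span_scale span_base) auto
      finally show ?thesis .
    qed
    ultimately show ?thesis by blast
  qed
  \<comment> \<open>Every lift of the curve of planes has velocities in the plane itself, like the lift by \<open>V\<close>.\<close>
  have lift0: "(\<lambda>v. \<Sum>i<n. (v \<bullet> \<xi> 0 i) *\<^sub>R orth_proj (orthogonal_comp (plane ((\<nu> \<circ> c) 0))) (vector_derivative (\<lambda>s. \<xi> s i) (at 0)))
      = (\<lambda>_. 0)"
    if \<epsilon>: "\<epsilon> > 0" and \<xi>: "\<forall>i<n. smooth_map (top_of_set {0-\<epsilon>..0+\<epsilon>}) id (\<lambda>s. \<xi> s i)"
      "\<forall>s\<in>{0-\<epsilon>..0+\<epsilon>}. \<xi> s \<in> (\<nu> \<circ> c) s" for \<epsilon> :: real and \<xi>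
  proof -
    have "orth_proj (orthogonal_comp (plane ((\<nu> \<circ> c) 0))) (vector_derivative (\<lambda>s. \<xi> s i) (at 0)) = 0" if i: "i < n" for i
      unfolding pl
    proof (rule orth_proj_orthogonal_comp_self)
      define d' where "d' = min d \<epsilon>"
      have d': "d' > 0" using d \<epsilon> by (simp add: d'_def)
      have rep: "\<xi> s i = (\<Sum>j<n. (\<xi> s i \<bullet> V (c s) j) *\<^sub>R V (c s) j)" if s: "s \<in> {-d'<..<d'}" for s
      proof -
        have cs: "c s \<in> O'" using d(2)[of s] s by (auto simp: d'_def)
        have "\<xi> s \<in> \<nu> (c s)" using \<xi>(2) s by (auto simp: d'_def)
        then have "span (\<xi> s ` {..<n}) = span (V (c s) ` {..<n})"
          using plane_eq_span[OF OG[OF cs]] V\<nu>[OF cs] by blast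
        then have "\<xi> s i \<in> span (V (c s) ` {..<n})" using i by (metis imageI lessThan_iff span_base)
        then show ?thesis by (rule stiefel_span_representation[OF V[OF cs]])
      qed
      obtain w where w: "\<And>j. j < n \<Longrightarrow> w j \<in> ?L" "\<And>j. j < n \<Longrightarrow> ((\<lambda>s. V (c s) j) has_vector_derivative w j) (at 0)"
        using dV by metis
      have \<xi>': "((\<lambda>s. \<xi> s i) has_vector_derivative vector_derivative (\<lambda>s. \<xi> s i) (at 0)) (at 0)"
        using smooth_map_interval_has_vector_derivative_interior[of "0-\<epsilon>" "0+\<epsilon>" "\<lambda>s. \<xi> s i" 0] \<xi>(1) i \<epsilon>
          vector_derivative_works differentiableI_vector by (metis diff_0 greaterThanLessThan_iff add_0 neg_less_0_iff_less)
      let ?x = "vector_derivative (\<lambda>s. \<xi> s i) (at 0)"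
      have "((\<lambda>s. \<Sum>j<n. (\<xi> s i \<bullet> V (c s) j) *\<^sub>R V (c s) j) has_vector_derivative
          (\<Sum>j<n. (\<xi> 0 i \<bullet> V (c 0) j) *\<^sub>R w j + (\<xi> 0 i \<bullet> w j + ?x \<bullet> V (c 0) j) *\<^sub>R V (c 0) j)) (at 0)"
        by (intro has_vector_derivative_sum bounded_bilinear.has_vector_derivative[OF bounded_bilinear_scaleR]
            bounded_bilinear.has_vector_derivative[OF bounded_bilinear_inner] \<xi>' w) auto
      then have "((\<lambda>s. \<xi> s i) has_vector_derivative
          (\<Sum>j<n. (\<xi> 0 i \<bullet> V (c 0) j) *\<^sub>R w j + (\<xi> 0 i \<bullet> w j + ?x \<bullet> V (c 0) j) *\<^sub>R V (c 0) j)) (at 0)"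
        by (rule has_vector_derivative_transform_within_open[of _ _ _ "{-d'<..<d'}"]) (use d' rep in auto)
      then have "?x = (\<Sum>j<n. (\<xi> 0 i \<bullet> V (c 0) j) *\<^sub>R w j + (\<xi> 0 i \<bullet> w j + ?x \<bullet> V (c 0) j) *\<^sub>R V (c 0) j)"
        using \<xi>' vector_derivative_unique_at by blast
      also have "\<dots> \<in> ?L"
        unfolding c0 by (intro span_sum span_add span_scale w(1)) (auto intro: span_base)
      finally show "?x \<in> ?L" .
    qed simp
    then show ?thesis by simp
  qed
  have "grassmannian_velocity n (\<nu> \<circ> c) 0 = (\<lambda>_. 0)"
    unfolding grassmannian_velocity_def
  proof (rule the_equality)
    show "\<forall>\<epsilon> \<xi>. \<epsilon> > 0 \<and> (\<forall>i<n. smooth_map (top_of_set {0-\<epsilon>..0+\<epsilon>}) id (\<lambda>s. \<xi> s i)) \<and>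
        (\<forall>s\<in>{0-\<epsilon>..0+\<epsilon>}. \<xi> s \<in> (\<nu> \<circ> c) s) \<longrightarrow>
        (\<lambda>_. 0) = (\<lambda>v. \<Sum>i<n. (v \<bullet> \<xi> 0 i) *\<^sub>R
               orth_proj (orthogonal_comp (plane ((\<nu> \<circ> c) 0))) (vector_derivative (\<lambda>s. \<xi> s i) (at 0)))"
      by (intro allI impI) (rule lift0[symmetric]; blast)
  next
    fix A assume A: "\<forall>\<epsilon> \<xi>. \<epsilon> > 0 \<and> (\<forall>i<n. smooth_map (top_of_set {0-\<epsilon>..0+\<epsilon>}) id (\<lambda>s. \<xi> s i)) \<and>
        (\<forall>s\<in>{0-\<epsilon>..0+\<epsilon>}. \<xi> s \<in> (\<nu> \<circ> c) s) \<longrightarrow>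
        A = (\<lambda>v. \<Sum>i<n. (v \<bullet> \<xi> 0 i) *\<^sub>R
               orth_proj (orthogonal_comp (plane ((\<nu> \<circ> c) 0))) (vector_derivative (\<lambda>s. \<xi> s i) (at 0)))"
    \<comment> \<open>The description of the velocity is not vacuous: \<open>V \<circ> c\<close> is a lift.\<close>
    define \<epsilon> where "\<epsilon> = min e (d/2)"
    have \<epsilon>: "\<epsilon> > 0" using e d by (simp add: \<epsilon>_def)
    have cO: "c s \<in> O'" if "s \<in> {0-\<epsilon>..0+\<epsilon>}" for s
      using d(2)[of s] d(1) that by (auto simp: \<epsilon>_def)
    have sm: "\<forall>i<n. smooth_map (top_of_set {0-\<epsilon>..0+\<epsilon>}) id (\<lambda>s. V (c s) i)"
    proof (intro allI impI)
      fix i assume i: "i < n"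
      have "smooth_curve T f {0-\<epsilon>..0+\<epsilon>} c"
        by (rule smooth_curve_subset[OF e(2)]) (auto simp: \<epsilon>_def)
      then show "smooth_map (top_of_set {0-\<epsilon>..0+\<epsilon>}) id (\<lambda>s. V (c s) i)"
        using smooth_map_compose_curve[OF smV[OF i] op] cO by blast
    qed
    have V\<nu>': "\<forall>s\<in>{0-\<epsilon>..0+\<epsilon>}. V (c s) \<in> (\<nu> \<circ> c) s" using cO V\<nu> by simp
    from A[rule_format, of \<epsilon> "\<lambda>s. V (c s)"] \<epsilon> sm V\<nu>' lift0[OF \<epsilon> sm V\<nu>']
    show "A = (\<lambda>_. 0)" by simp
  qed
  moreover have "grassmannian_velocity n (\<nu> \<circ> c) 0 \<noteq> (\<lambda>_. 0)"
    using \<nu> c v O'_top[OF p] unfolding smooth_grassmannian_embedding_def by blast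
  ultimately show False by blast
qed

end

lemma finite_common_nhd:
  assumes "finite I" "p \<in> topspace T" "\<And>i. i \<in> I \<Longrightarrow> \<exists>G. openin T G \<and> p \<in> G \<and> (\<forall>q\<in>G. P i q)"
  shows "\<exists>G. openin T G \<and> p \<in> G \<and> (\<forall>q\<in>G. \<forall>i\<in>I. P i q)"
  using assms(1,3)
proof (induction I)
  case empty
  then show ?case using assms(2) by (intro exI[of _ "topspace T"]) auto
next
  case (insert i I)
  then obtain G G' where "openin T G \<and> p \<in> G \<and> (\<forall>q\<in>G. \<forall>i\<in>I. P i q)" "openin T G' \<and> p \<in> G' \<and> (\<forall>q\<in>G'. P i q)"
    by (metis insertCI)
  then show ?case by (intro exI[of _ "G \<inter> G'"]) auto
qed

context adapted_frame
begin

text \<open>In a parametrization at \<open>p\<close>, the distance in \<open>M\<close> and the chordal distance of the normal planes are to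
  first order the norms of a tangent vector and of its image under the differential of the Gauss map.\<close>

lemma riem_dist_le_frame_chord:
  assumes p: "p \<in> O'" and \<delta>: "\<delta> > 0" "\<And>v. v \<in> TS p \<Longrightarrow> \<delta>\<^sup>2 * (norm v)\<^sup>2 \<le> S p v" and K: "K * \<delta> > 1"
  obtains G where "openin T G" "p \<in> G" "G \<subseteq> O'"
    "\<And>q. q \<in> G \<Longrightarrow> riem_dist T f p q \<le> ereal (K * frame_chord n (V p) (V q))"
proof -
  obtain U W V0 L \<phi> \<psi> g where lp: "local_param m T f U W V0 L \<phi> \<psi> g" "p \<in> U"
    using local_param_exists[OF imm O'_top[OF p]] by metis
  let ?x = "\<phi> (f p)"
  define D\<psi> where "D\<psi> = frechet_derivative \<psi> (at ?x)"
  have U: "openin T U" "open V0" "Cinf_on V0 \<psi>" "?x \<in> V0 \<inter> L" "\<psi> ?x = f p" "f p \<in> W" "Cinf_on W \<phi>" "subspace L"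
    using lp by (auto simp: local_param_def)
  have D\<psi>: "(\<psi> has_derivative D\<psi>) (at ?x)" unfolding D\<psi>_def by (rule Cinf_on_derivative(1)[OF U(3)]) (use U(4) in simp)
  have TSL: "D\<psi> w \<in> TS p" if "w \<in> L" for w
    using local_param_tangent_space[OF lp] that by (simp add: D\<psi>_def)
  have "bounded_linear (frechet_derivative \<phi> (at (f p)))"
    using Cinf_on_derivative(1)[OF U(7,6)] by (rule has_derivative_bounded_linear)
  from bounded_linear.pos_bounded[OF this]
  obtain \<kappa> where \<kappa>: "\<kappa> > 0" "\<And>u. norm (frechet_derivative \<phi> (at (f p)) u) \<le> norm u * \<kappa>"
    by blast
  have w_le: "norm w \<le> \<kappa> * norm (D\<psi> w)" for w
    using \<kappa>(2)[of "D\<psi> w"] local_param_chain[OF lp(1), of ?x w] U(4,5) by (simp add: D\<psi>_def mult.commute)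
  have "K > 0"
  proof (rule ccontr)
    assume "\<not> K > 0"
    then have "K * \<delta> \<le> 0" using \<delta>(1) by (intro mult_nonpos_nonneg) auto
    then show False using K by simp
  qed
  \<comment> \<open>With first order errors \<open>e \<bar>w\<bar> \<le> e \<kappa> \<bar>D\<psi> w\<bar>\<close>, the distance is at most \<open>(1 + e \<kappa>) \<bar>D\<psi> w\<bar>\<close> and the
    chordal distance at least \<open>(\<delta> - n e \<kappa>) \<bar>D\<psi> w\<bar>\<close>; this \<open>e\<close> gives \<open>1 + e \<kappa> = K (\<delta> - n e \<kappa>)\<close>.\<close>
  define e where "e = (K * \<delta> - 1) / (\<kappa> * (1 + K * real n))"
  have e: "e > 0" using K \<kappa>(1) \<open>K > 0\<close> by (auto simp: e_def intro!: divide_pos_pos mult_pos_pos add_pos_nonneg)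
  have e_eq: "e * \<kappa> * (1 + K * real n) = K * \<delta> - 1"
  proof -
    have "1 + K * real n > 0" using \<open>K > 0\<close> by (intro add_pos_nonneg) auto
    then show ?thesis using \<kappa>(1) by (simp add: e_def)
  qed
  obtain d where d: "d > 0" "\<And>w. w \<in> L \<Longrightarrow> norm w < d \<Longrightarrow> ?x + w \<in> V0 \<inter> L \<and>
     riem_dist T f p (g (?x + w)) \<le> ereal (norm (D\<psi> w) + e * norm w)"
    using local_param_riem_dist[OF lp e, folded D\<psi>_def] by auto
  define N where "N = normal_part n (V p)"
  have N: "bounded_linear N" unfolding N_def by (rule bounded_linear_normal_part)
  define w where "w q = \<phi> (f q) - ?x" for q
  have "\<exists>G. openin T G \<and> p \<in> G \<and> (\<forall>q\<in>G. norm (N (V q j) - N (D (\<lambda>q. V q j) p (D\<psi> (w q)))) \<le> e * norm (w q))"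
    if "j \<in> {..<n}" for j
  proof -
    have j: "j < n" using that by simp
    obtain V' where V': "has_tangential_derivative T f (\<lambda>q. V q j) V' p" "\<And>v. v \<in> TS p \<Longrightarrow> D (\<lambda>q. V q j) p v = V' v"
      using V_derivative[OF p j] by metis
    obtain UH H where H: "openin T UH" "p \<in> UH" "\<forall>q\<in>UH. V q j = H (f q)" "(H has_derivative V') (at (f p))"
      using V'(1) unfolding has_tangential_derivative_def by blast
    have "((\<lambda>x. N (H (\<psi> x))) has_derivative (\<lambda>u. N (V' (D\<psi> u)))) (at ?x)"
      using bounded_linear.has_derivative[OF N has_derivative_compose[OF D\<psi>, of H V']] H(4) U(5) by simp
    then obtain r where r: "r > 0" "\<And>y. norm (y - ?x) < r \<Longrightarrow>
        norm (N (H (\<psi> y)) - N (H (\<psi> ?x)) - N (V' (D\<psi> (y - ?x)))) \<le> e * norm (y - ?x)"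
      using e unfolding has_derivative_at_alt by blast
    have 0: "N (H (\<psi> ?x)) = 0"
      using normal_part_frame[OF V[OF p] j] H(2,3) U(5) by (simp add: N_def)
    show ?thesis
    proof (intro exI conjI ballI)
      show "openin T ({q \<in> U. \<phi> (f q) \<in> ball ?x r} \<inter> UH)"
        by (rule openin_Int[OF local_param_ball_nhd[OF lp] H(1)])
      show "p \<in> {q \<in> U. \<phi> (f q) \<in> ball ?x r} \<inter> UH" using lp(2) H(2) r(1) by simp
      fix q assume q: "q \<in> {q \<in> U. \<phi> (f q) \<in> ball ?x r} \<inter> UH"
      have fq: "\<psi> (\<phi> (f q)) = f q" "\<phi> (f q) \<in> L" using q lp(1) by (auto simp: local_param_def)
      then have "w q \<in> L" using U(4,8) by (auto simp: w_def intro: subspace_diff)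
      then have "D (\<lambda>q. V q j) p (D\<psi> (w q)) = V' (D\<psi> (w q))" using V'(2) TSL by blast
      then show "norm (N (V q j) - N (D (\<lambda>q. V q j) p (D\<psi> (w q)))) \<le> e * norm (w q)"
        using r(2)[of "\<phi> (f q)"] q H(3) fq 0 by (auto simp: w_def dist_norm norm_minus_commute)
    qed
  qed
  then have "\<exists>G. openin T G \<and> p \<in> G \<and>
      (\<forall>q\<in>G. \<forall>j\<in>{..<n}. norm (N (V q j) - N (D (\<lambda>q. V q j) p (D\<psi> (w q)))) \<le> e * norm (w q))"
    by (intro finite_common_nhd[where P = "\<lambda>j q. norm (N (V q j) - N (D (\<lambda>q. V q j) p (D\<psi> (w q)))) \<le> e * norm (w q)"]
        O'_top[OF p] finite_lessThan)
  then obtain G0 where G0: "openin T G0" "p \<in> G0" "\<forall>q\<in>G0. \<forall>j\<in>{..<n}.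
      norm (N (V q j) - N (D (\<lambda>q. V q j) p (D\<psi> (w q)))) \<le> e * norm (w q)"
    by (elim exE conjE) (rule that; assumption)
  define G where "G = {q \<in> U. \<phi> (f q) \<in> ball ?x d} \<inter> G0 \<inter> O'"
  show thesis
  proof (rule that)
    show "openin T G" unfolding G_def by (intro openin_Int local_param_ball_nhd[OF lp] G0(1) op)
    show "p \<in> G" using lp(2) G0(2) p d(1) by (simp add: G_def)
    show "G \<subseteq> O'" by (auto simp: G_def)
    fix q assume q: "q \<in> G"
    have wL: "w q \<in> L" "norm (w q) < d" "g (?x + w q) = q"
      using q lp(1) U(4,8) by (auto simp: G_def w_def local_param_def dist_norm norm_minus_commute intro!: subspace_diff)
    let ?w = "w q" and ?y = "norm (D\<psi> (w q))"
    have "L2_set (\<lambda>j. norm (N (D (\<lambda>q. V q j) p (D\<psi> ?w)))) {..<n}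
        \<le> L2_set (\<lambda>j. norm (N (V q j)) + norm (N (V q j) - N (D (\<lambda>q. V q j) p (D\<psi> ?w)))) {..<n}"
      by (rule L2_set_mono) (use norm_triangle_sub norm_minus_commute in metis, simp)
    also have "\<dots> \<le> L2_set (\<lambda>j. norm (N (V q j))) {..<n} + L2_set (\<lambda>j. norm (N (V q j) - N (D (\<lambda>q. V q j) p (D\<psi> ?w)))) {..<n}"
      by (rule L2_set_triangle_ineq)
    also have "L2_set (\<lambda>j. norm (N (V q j) - N (D (\<lambda>q. V q j) p (D\<psi> ?w)))) {..<n} \<le> (\<Sum>j<n. e * norm ?w)"
      by (rule order_trans[OF L2_set_le_sum sum_mono]) (use G0(3) q in \<open>auto simp: G_def\<close>)
    also have "L2_set (\<lambda>j. norm (N (V q j))) {..<n} = frame_chord n (V p) (V q)"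
      by (simp add: L2_set_def frame_chord_def N_def)
    also have "L2_set (\<lambda>j. norm (N (D (\<lambda>q. V q j) p (D\<psi> ?w)))) {..<n} = sqrt (S p (D\<psi> ?w))"
      unfolding L2_set_def N_def S_eq[OF p TSL[OF wL(1)]] ..
    finally have 1: "sqrt (S p (D\<psi> ?w)) \<le> frame_chord n (V p) (V q) + real n * (e * norm ?w)" by simp
    have "\<delta> * ?y = sqrt (\<delta>\<^sup>2 * ?y\<^sup>2)" using \<delta>(1) by (simp add: real_sqrt_mult)
    also have "\<dots> \<le> sqrt (S p (D\<psi> ?w))" using \<delta>(2)[OF TSL[OF wL(1)]] by simp
    finally have 2: "\<delta> * ?y \<le> frame_chord n (V p) (V q) + real n * (e * norm ?w)" using 1 by simp
    have ew: "e * norm ?w \<le> e * \<kappa> * ?y" using w_le[of ?w] e by simp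
    have "?y + e * norm ?w \<le> K * frame_chord n (V p) (V q)"
    proof -
      have "K * (\<delta> * ?y) \<le> K * (frame_chord n (V p) (V q) + real n * (e * norm ?w))"
        using 2 \<open>K > 0\<close> by simp
      then have a: "K * \<delta> * ?y - K * real n * (e * norm ?w) \<le> K * frame_chord n (V p) (V q)"
        by (simp add: algebra_simps)
      have "(1 + K * real n) * (e * norm ?w) \<le> (1 + K * real n) * (e * \<kappa> * ?y)"
        using ew \<open>K > 0\<close> by (intro mult_left_mono) auto
      also have "\<dots> = (e * \<kappa> * (1 + K * real n)) * ?y" by (simp add: mult_ac)
      also have "\<dots> = (K * \<delta> - 1) * ?y" unfolding e_eq ..
      finally show ?thesis using a by (simp add: algebra_simps)
    qed
    then have "ereal (?y + e * norm ?w) \<le> ereal (K * frame_chord n (V p) (V q))" by simp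
    with d(2)[OF wL(1,2)] show "riem_dist T f p q \<le> ereal (K * frame_chord n (V p) (V q))"
      unfolding wL(3) by (blast intro: order_trans)
  qed
qed

end

section \<open>Comparing lengths in the submanifold and in its Gauss image\<close>

lemma smooth_map_top_of_set_continuous_on:
  fixes h :: "'d::euclidean_space \<Rightarrow> 'b::euclidean_space"
  assumes "smooth_map (top_of_set U) id h"
  shows "continuous_on U h"
  unfolding continuous_on_eq_continuous_within
proof
  fix t assume t: "t \<in> U"
  then have "t \<in> topspace (top_of_set U)" by simp
  then obtain A W H where A: "openin (top_of_set U) A" "t \<in> A" "open W" "id ` A \<subseteq> W" "Cinf_on W H" "\<forall>s\<in>A. h s = H (id s)"
    using assms unfolding smooth_map_def by meson
  obtain G where G: "open G" "A = U \<inter> G" using A(1) by (auto simp: openin_open)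
  have "continuous_on A H" using Cinf_on_continuous[OF A(5)] A(4) by (auto intro: continuous_on_subset)
  then have "continuous_on A h" by (rule continuous_on_eq) (use A(6) in simp)
  then have "continuous (at t within A) h" using A(2) by (auto simp: continuous_on_eq_continuous_within)
  moreover have "at t within A = at t within U"
    unfolding G(2) using A(2) G by (intro at_within_nhd[of _ G]) auto
  ultimately show "continuous (at t within U) h" by simp
qed

text \<open>Locally the map is the quotient projection applied to a continuous lift.\<close>

lemma smooth_grassmannian_map_continuous:
  fixes J :: "'d::euclidean_space set" and \<gamma> :: "'d \<Rightarrow> (nat \<Rightarrow> 'e::euclidean_space) set"
  assumes \<gamma>: "smooth_grassmannian_map n (top_of_set J) id \<gamma>"
  shows "continuous_map (top_of_set J) (grassmannian_topology n) \<gamma>"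
proof -
  have OG: "\<gamma> s \<in> oriented_grassmannian n" if "s \<in> J" for s
    using \<gamma> that unfolding smooth_grassmannian_map_def by simp
  have "{\<xi> \<in> stiefel n. oriented_span n \<xi> \<in> oriented_grassmannian n} = (stiefel n :: (nat \<Rightarrow> 'e) set)"
    by (auto simp: oriented_grassmannian_def)
  then have "openin (grassmannian_topology n) (oriented_grassmannian n :: (nat \<Rightarrow> 'e) set set)"
    by (simp add: openin_grassmannian_topology)
  then have top: "oriented_grassmannian n \<subseteq> topspace (grassmannian_topology n :: (nat \<Rightarrow> 'e) set topology)"
    by (rule openin_subset)
  have "openin (top_of_set J) {s \<in> J. \<gamma> s \<in> G}" if G: "openin (grassmannian_topology n) G" for G
  proof (subst openin_subopen, intro ballI)
    fix t assume t: "t \<in> {s \<in> J. \<gamma> s \<in> G}"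
    then have "t \<in> topspace (top_of_set J)" by simp
    then obtain U \<xi> where U: "openin (top_of_set J) U" "t \<in> U"
      "\<And>i. i < n \<Longrightarrow> smooth_map (subtopology (top_of_set J) U) id (\<lambda>q. \<xi> q i)" "\<And>q. q \<in> U \<Longrightarrow> \<xi> q \<in> \<gamma> q"
      using smooth_grassmannian_map_lift[OF \<gamma>] by metis
    have UJ: "U \<subseteq> J" using U(1) openin_imp_subset by blast
    then have sub: "subtopology (top_of_set J) U = top_of_set U" by (simp add: subtopology_subtopology inf.absorb2)
    have st: "\<xi> q \<in> stiefel n" "\<gamma> q = oriented_span n (\<xi> q)" if "q \<in> U" for q
      using oriented_grassmannian_member[OF OG U(4)] that UJ by auto
    have "continuous_on U (\<lambda>q. \<xi> q i)" for i
    proof (cases "i < n")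
      case True
      then show ?thesis using smooth_map_top_of_set_continuous_on U(3) unfolding sub by blast
    next
      case False
      have "continuous_on U (\<lambda>q. 0::'e)" by simp
      then show ?thesis by (rule continuous_on_eq) (use st(1) False in \<open>simp add: stiefel_def\<close>)
    qed
    then have c\<xi>: "continuous_on U \<xi>" by (intro continuous_on_coordinatewise_then_product)
    have "openin (top_of_set (stiefel n)) {\<xi> \<in> stiefel n. oriented_span n \<xi> \<in> G}"
      using G by (simp add: openin_grassmannian_topology)
    then obtain A where A: "open A" "{\<xi> \<in> stiefel n. oriented_span n \<xi> \<in> G} = stiefel n \<inter> A"
      unfolding openin_open by blast
    have "openin (top_of_set U) (U \<inter> \<xi> -` A)" by (rule continuous_openin_preimage_gen[OF c\<xi> A(1)])
    then have "openin (top_of_set J) (U \<inter> \<xi> -` A)" using U(1) openin_trans by blast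
    moreover have iff: "q \<in> U \<inter> \<xi> -` A \<longleftrightarrow> \<gamma> q \<in> G" if "q \<in> U" for q
    proof -
      have "\<xi> q \<in> stiefel n \<inter> A \<longleftrightarrow> \<gamma> q \<in> G"
        unfolding A(2)[symmetric] using st[OF that] by simp
      then show ?thesis using st(1)[OF that] that by simp
    qed
    ultimately show "\<exists>B. openin (top_of_set J) B \<and> t \<in> B \<and> B \<subseteq> {s \<in> J. \<gamma> s \<in> G}"
      using U(2) t UJ by (intro exI[of _ "U \<inter> \<xi> -` A"]) auto
  qed
  then show ?thesis using OG top by (auto simp: continuous_map_def)
qed

text \<open>The Gauss map expands lengths by at least \<open>\<delta>\<close>; the constant \<open>K\<close> exceeds \<open>1/\<delta>\<close> to leave room for errors of
  higher order.\<close>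

locale gauss_expansion =
  fixes m n :: nat and T :: "'a topology" and f :: "'a \<Rightarrow> 'e::euclidean_space"
    and \<nu> :: "'a \<Rightarrow> (nat \<Rightarrow> 'e) set" and \<delta> K :: real
  assumes emb: "smooth_grassmannian_embedding n T f \<nu>"
    and frames: "p \<in> topspace T \<Longrightarrow>
      \<exists>O' E V. adapted_frame m n T f O' E V \<and> p \<in> O' \<and> (\<forall>q\<in>O'. V q \<in> \<nu> q)"
    and \<delta>: "\<delta> > 0" "K * \<delta> > 1"
    and lower: "adapted_frame m n T f O' E V \<Longrightarrow> p \<in> O' \<Longrightarrow> v \<in> tangent_space T f p \<Longrightarrow>
      \<delta>\<^sup>2 * (norm v)\<^sup>2 \<le> adapted_frame.S m n T f E V p v"
begin

lemma K_pos: "K > 0"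
proof (rule ccontr)
  assume "\<not> K > 0"
  then have "K * \<delta> \<le> 0" using \<delta>(1) by (intro mult_nonpos_nonneg) auto
  then show False using \<delta>(2) by simp
qed

lemma \<nu>_OG: "p \<in> topspace T \<Longrightarrow> \<nu> p \<in> oriented_grassmannian n"
  using emb unfolding smooth_grassmannian_embedding_def smooth_grassmannian_map_def by blast

lemma riem_dist_le_chord:
  assumes p: "p \<in> topspace T"
  obtains G where "openin T G" "p \<in> G"
    "\<And>q \<xi> \<zeta>. q \<in> G \<Longrightarrow> \<xi> \<in> \<nu> p \<Longrightarrow> \<zeta> \<in> \<nu> q \<Longrightarrow> riem_dist T f p q \<le> ereal (K * frame_chord n \<xi> \<zeta>)"
proof -
  obtain O' E V where af: "adapted_frame m n T f O' E V" "p \<in> O'" "\<forall>q\<in>O'. V q \<in> \<nu> q"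
    using frames[OF p] by blast
  interpret adapted_frame m n T f O' E V by (rule af(1))
  obtain G where G: "openin T G" "p \<in> G" "G \<subseteq> O'"
    "\<And>q. q \<in> G \<Longrightarrow> riem_dist T f p q \<le> ereal (K * frame_chord n (V p) (V q))"
    using riem_dist_le_frame_chord[OF af(2) \<delta>(1) lower[OF af(1,2)] \<delta>(2)] by metis
  show thesis
  proof (rule that[OF G(1,2)])
    fix q \<xi> \<zeta> assume q: "q \<in> G" "\<xi> \<in> \<nu> p" "\<zeta> \<in> \<nu> q"
    have qT: "q \<in> topspace T" and qO: "q \<in> O'" using q(1) G(1,3) openin_subset by auto
    have "frame_chord n (V p) (V q) = frame_chord n \<xi> \<zeta>"
    proof (rule frame_chord_cong)
      show "span (V p ` {..<n}) = span (\<xi> ` {..<n})"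
        using plane_eq_span[OF \<nu>_OG[OF p]] q(2) af by metis
      show "span (V q ` {..<n}) = span (\<zeta> ` {..<n})"
        using plane_eq_span[OF \<nu>_OG[OF qT]] q(3) af qO by metis
    qed (use oriented_grassmannian_member(1)[OF \<nu>_OG] p qT q af V qO in auto)
    then show "riem_dist T f p q \<le> ereal (K * frame_chord n \<xi> \<zeta>)" using G(4)[OF q(1)] by simp
  qed
qed

text \<open>Near \<open>t\<close>, the distance in \<open>M\<close> is at most \<open>K\<close> times the chordal distance, which grows at the rate
  \<open>g_speed n \<gamma> t\<close>. This is the estimate on short intervals around \<open>t\<close>, up to a multiple of their length,
  and bisection extends it.\<close>

lemma riem_dist_le_g_length_piece:
  fixes \<gamma> :: "real \<Rightarrow> (nat \<Rightarrow> 'e) set"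
  assumes \<gamma>: "smooth_grassmannian_map n (top_of_set {a..b}) id \<gamma>" and ab: "a < b"
    and c: "continuous_map (top_of_set {a..b}) T c" and \<gamma>c: "\<And>s. s \<in> {a..b} \<Longrightarrow> \<gamma> s = \<nu> (c s)"
    and \<epsilon>: "\<epsilon> > 0" and uv: "a \<le> u" "u \<le> v" "v \<le> b"
  shows "g_speed n \<gamma> integrable_on {u..v} \<and>
    riem_dist T f (c u) (c v) \<le> ereal (K * integral {u..v} (g_speed n \<gamma>) + \<epsilon> * (v - u))"
proof -
  \<comment> \<open>Bisection asks for all short intervals around a point; those that leave \<open>[u, v]\<close> are exempted.\<close>
  define P where "P x y \<longleftrightarrow> (u \<le> x \<longrightarrow> x \<le> y \<longrightarrow> y \<le> v \<longrightarrow> g_speed n \<gamma> integrable_on {x..y} \<and>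
    riem_dist T f (c x) (c y) \<le> ereal (K * integral {x..y} (g_speed n \<gamma>) + \<epsilon> * (y - x)))" for x y
  have cT: "c s \<in> topspace T" if "s \<in> {a..b}" for s
    using c that unfolding continuous_map_def by auto
  have OG: "\<gamma> s \<in> oriented_grassmannian n" if "s \<in> {a..b}" for s
    using \<nu>_OG[OF cT[OF that]] \<gamma>c[OF that] by simp
  have "P u v"
  proof (rule Bolzano[OF uv(2)])
    fix x y z assume P: "P x y" "P y z" "x \<le> y" "y \<le> z"
    show "P x z"
      unfolding P_def
    proof (intro impI)
      assume xz: "u \<le> x" "x \<le> z" "z \<le> v"
      have 1: "g_speed n \<gamma> integrable_on {x..y}" "riem_dist T f (c x) (c y) \<le> ereal (K * integral {x..y} (g_speed n \<gamma>) + \<epsilon> * (y - x))"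
        and 2: "g_speed n \<gamma> integrable_on {y..z}" "riem_dist T f (c y) (c z) \<le> ereal (K * integral {y..z} (g_speed n \<gamma>) + \<epsilon> * (z - y))"
        using P xz unfolding P_def by auto
      have I: "g_speed n \<gamma> integrable_on {x..z}"
        by (rule Henstock_Kurzweil_Integration.integrable_combine[OF P(3,4) 1(1) 2(1)])
      have int: "integral {x..z} (g_speed n \<gamma>) = integral {x..y} (g_speed n \<gamma>) + integral {y..z} (g_speed n \<gamma>)"
        using Henstock_Kurzweil_Integration.integral_combine[OF P(3,4) I] by simp
      have "riem_dist T f (c x) (c z) \<le> riem_dist T f (c x) (c y) + riem_dist T f (c y) (c z)"
        by (rule riem_dist_triangle)
      also have "\<dots> \<le> ereal (K * integral {x..y} (g_speed n \<gamma>) + \<epsilon> * (y - x)) + ereal (K * integral {y..z} (g_speed n \<gamma>) + \<epsilon> * (z - y))"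
        by (intro add_mono 1 2)
      also have "\<dots> = ereal (K * integral {x..z} (g_speed n \<gamma>) + \<epsilon> * (z - x))"
        unfolding int by (simp add: algebra_simps)
      finally show "g_speed n \<gamma> integrable_on {x..z} \<and>
        riem_dist T f (c x) (c z) \<le> ereal (K * integral {x..z} (g_speed n \<gamma>) + \<epsilon> * (z - x))" using I by blast
    qed
  next
    fix t assume "u \<le> t" "t \<le> v"
    then have t: "t \<in> {a..b}" using uv by simp
    then have "t \<in> topspace (top_of_set {a..b})" by simp
    then obtain U \<xi> where U: "openin (top_of_set {a..b}) U" "t \<in> U"
      "\<And>i. i < n \<Longrightarrow> smooth_map (subtopology (top_of_set {a..b}) U) id (\<lambda>q. \<xi> q i)" "\<And>q. q \<in> U \<Longrightarrow> \<xi> q \<in> \<gamma> q"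
      using smooth_grassmannian_map_lift[OF \<gamma>] by metis
    obtain A where A: "open A" "U = {a..b} \<inter> A" using U(1) by (auto simp: openin_open)
    then obtain d0 where d0: "d0 > 0" "ball t d0 \<subseteq> A" using U(2) open_contains_ball by blast
    have sub: "subtopology (top_of_set {a..b}) U = top_of_set U"
      by (simp add: A(2) subtopology_subtopology)
    \<comment> \<open>A neighbourhood of \<open>t\<close> in \<open>[a, b]\<close> that is a nondegenerate interval, also if \<open>t\<close> is an end point.\<close>
    define a' b' where "a' = max a (t - d0/2)" and "b' = min b (t + d0/2)"
    have ab': "a' < b'" "t \<in> {a'..b'}" using ab t d0 by (auto simp: a'_def b'_def)
    have abU: "{a'..b'} \<subseteq> U" using d0 by (auto simp: a'_def b'_def A(2) dist_real_def subset_iff)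
    have ab'': "{a'..b'} \<subseteq> {a..b}" by (auto simp: a'_def b'_def)
    have sm: "smooth_map (top_of_set {a'..b'}) id (\<lambda>s. \<xi> s j)" if "j < n" for j
    proof -
      have "smooth_map (top_of_set {a'..b'}) id (\<lambda>s. \<xi> (1 * s + 0) j)"
        by (rule smooth_map_affine_reparam[OF U(3)[OF that, unfolded sub]]) (use abU in auto)
      then show ?thesis by simp
    qed
    define w where "w s j = vector_derivative (\<lambda>s. \<xi> s j) (at s within {a'..b'})" for s j
    have cw: "continuous_on {a'..b'} (\<lambda>s. w s j)"
      and dw: "\<And>s. s \<in> {a'..b'} \<Longrightarrow> ((\<lambda>s. \<xi> s j) has_vector_derivative w s j) (at s within {a'..b'})" if "j < n" for j
      unfolding w_def using smooth_map_interval_derivative[OF sm[OF that] ab'(1)] by auto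
    define \<sigma> where "\<sigma> s = frame_speed n (\<xi> s) (w s)" for s
    have c\<xi>: "continuous_on {a'..b'} (\<lambda>s. \<xi> s j)" if "j < n" for j
      by (rule smooth_map_top_of_set_continuous_on[OF sm[OF that]])
    have c\<sigma>: "continuous_on {a'..b'} \<sigma>"
      unfolding \<sigma>_def frame_speed_def normal_part_def
      by (intro continuous_intros cw c\<xi>) auto
    have sp: "g_speed n \<gamma> s = \<sigma> s" if s: "s \<in> {a'..<b'}" for s
      unfolding \<sigma>_def
    proof (rule g_speed_eq_frame_speed)
      show "s < b'" using s by simp
      show "\<gamma> r \<in> oriented_grassmannian n \<and> \<xi> r \<in> \<gamma> r" if "r \<in> {s..b'}" for r
        using that s abU ab'' OG U(4) by (auto simp: subset_iff)
      show "((\<lambda>s. \<xi> s j) has_vector_derivative w s j) (at s within {s..b'})" if "j < n" for j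
        by (rule has_vector_derivative_within_subset[OF dw[OF that]]) (use s in auto)
    qed
    have I: "g_speed n \<gamma> integrable_on {x..y}" "integral {x..y} (g_speed n \<gamma>) = integral {x..y} \<sigma>"
      if "{x..y} \<subseteq> {a'..b'}" for x y
    proof -
      have "\<sigma> integrable_on {x..y}"
        by (rule integrable_continuous_interval[OF continuous_on_subset[OF c\<sigma> that]])
      then show "g_speed n \<gamma> integrable_on {x..y}"
        by (rule integrable_spike_finite[of "{b'}", rotated 2]) (use sp that in auto)
      show "integral {x..y} (g_speed n \<gamma>) = integral {x..y} \<sigma>"
        by (rule integral_spike[of "{b'}"]) (use sp that in auto)
    qed
    \<comment> \<open>The error \<open>e\<close> enters twice, in the chordal distance and in the integral, and each time with the factor \<open>K\<close>.\<close>
    define e where "e = \<epsilon> / (2 * K)"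
    have e: "e > 0" using \<epsilon> K_pos by (simp add: e_def)
    have \<gamma>t: "\<gamma> t \<in> oriented_grassmannian n" "\<xi> t \<in> \<gamma> t" using OG[OF t] U(2,4) by auto
    have \<xi>t: "\<xi> t \<in> stiefel n" by (rule oriented_grassmannian_member(1)[OF \<gamma>t])
    obtain d1 where d1: "d1 > 0" "\<And>s. s \<in> {a'..b'} \<Longrightarrow> dist s t < d1 \<Longrightarrow> dist (\<sigma> s) (\<sigma> t) < e"
      using c\<sigma> ab'(2) e unfolding continuous_on_iff by meson
    have "eventually (\<lambda>s. frame_chord n (\<xi> t) (\<xi> s) / \<bar>s - t\<bar> < \<sigma> t + e) (at t within {a'..b'})"
      using frame_chord_quotient[of \<xi> t n "w t" "{a'..b'}", OF \<xi>t dw[OF _ ab'(2)], folded \<sigma>_def] e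
      by (intro order_tendstoD(2)) auto
    then obtain d2 where d2: "d2 > 0" "\<And>s. s \<in> {a'..b'} \<Longrightarrow> s \<noteq> t \<Longrightarrow> dist s t < d2 \<Longrightarrow>
        frame_chord n (\<xi> t) (\<xi> s) / \<bar>s - t\<bar> < \<sigma> t + e"
      unfolding eventually_at by auto
    obtain G where G: "openin T G" "c t \<in> G"
      "\<And>q \<xi> \<zeta>. q \<in> G \<Longrightarrow> \<xi> \<in> \<nu> (c t) \<Longrightarrow> \<zeta> \<in> \<nu> q \<Longrightarrow> riem_dist T f (c t) q \<le> ereal (K * frame_chord n \<xi> \<zeta>)"
      by (rule riem_dist_le_chord[OF cT[OF t]]) blast
    have "openin (top_of_set {a..b}) {s \<in> {a..b}. c s \<in> G}"
      using openin_continuous_map_preimage[OF c G(1)] by simp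
    then obtain A' where A': "open A'" "{s \<in> {a..b}. c s \<in> G} = {a..b} \<inter> A'" by (auto simp: openin_open)
    have "t \<in> {s \<in> {a..b}. c s \<in> G}" using t G(2) by simp
    then have "t \<in> A'" unfolding A'(2) by simp
    then obtain d3 where d3: "d3 > 0" "ball t d3 \<subseteq> A'" using A'(1) open_contains_ball by blast
    have cG: "c s \<in> G" if "s \<in> {a..b}" "dist s t < d3" for s
    proof -
      have "s \<in> {a..b} \<inter> A'" using that d3(2) by (auto simp: dist_commute subset_iff)
      then show ?thesis unfolding A'(2)[symmetric] by simp
    qed
    have near: "riem_dist T f (c t) (c s) \<le> ereal (K * ((\<sigma> t + e) * \<bar>s - t\<bar>))"
      if s: "s \<in> {a'..b'}" "dist s t < d2" "dist s t < d3" for s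
    proof -
      have sab: "s \<in> {a..b}" using s(1) ab'' by blast
      have "\<xi> s \<in> \<gamma> s" using U(4) s(1) abU by blast
      then have "riem_dist T f (c t) (c s) \<le> ereal (K * frame_chord n (\<xi> t) (\<xi> s))"
        using \<gamma>t(2) unfolding \<gamma>c[OF t] \<gamma>c[OF sab] by (intro G(3)[OF cG[OF sab s(3)]])
      also have "K * frame_chord n (\<xi> t) (\<xi> s) \<le> K * ((\<sigma> t + e) * \<bar>s - t\<bar>)"
      proof (rule mult_left_mono)
        show "frame_chord n (\<xi> t) (\<xi> s) \<le> (\<sigma> t + e) * \<bar>s - t\<bar>"
        proof (cases "s = t")
          case True
          then show ?thesis using normal_part_frame[OF \<xi>t] by (simp add: frame_chord_def)
        next
          case False
          then show ?thesis using d2(2)[OF s(1) _ s(2)] by (simp add: pos_divide_less_eq less_imp_le)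
        qed
      qed (use K_pos in simp)
      finally show ?thesis by simp
    qed
    define d where "d = min (d0/2) (min d1 (min d2 d3))"
    have "P x y" if xy: "x \<le> t" "t \<le> y" "y - x < d" for x y
      unfolding P_def
    proof (intro impI)
      assume b: "u \<le> x" "x \<le> y" "y \<le> v"
      have dd: "y - x < d0/2" "y - x < d1" "y - x < d2" "y - x < d3" using xy(3) by (auto simp: d_def)
      have sub': "{x..y} \<subseteq> {a'..b'}" using dd(1) xy b uv by (auto simp: a'_def b'_def)
      have mem: "x \<in> {a'..b'}" "y \<in> {a'..b'}" using sub' xy by auto
      have cx: "riem_dist T f (c x) (c t) \<le> ereal (K * ((\<sigma> t + e) * (t - x)))"
        using near[OF mem(1)] dd xy by (simp add: dist_real_def riem_dist_commute[of T f "c x"])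
      have cy: "riem_dist T f (c t) (c y) \<le> ereal (K * ((\<sigma> t + e) * (y - t)))"
        using near[OF mem(2)] dd xy by (simp add: dist_real_def)
      have low: "(\<sigma> t - e) * (y - x) \<le> integral {x..y} \<sigma>"
      proof -
        have "((\<lambda>s. \<sigma> t - e) has_integral (\<sigma> t - e) * (y - x)) {x..y}"
          using has_integral_const_real[of "\<sigma> t - e" x y] xy by (simp add: mult.commute)
        moreover have "(\<sigma> has_integral integral {x..y} \<sigma>) {x..y}"
          by (intro integrable_integral integrable_continuous_interval continuous_on_subset[OF c\<sigma> sub'])
        ultimately show ?thesis
        proof (rule has_integral_le)
          fix s assume s: "s \<in> {x..y}"
          then have "dist s t < d1" using dd(2) xy by (auto simp: dist_real_def)
          then have "dist (\<sigma> s) (\<sigma> t) < e" using d1(2) s sub' by blast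
          then show "\<sigma> t - e \<le> \<sigma> s" by (simp add: dist_real_def)
        qed
      qed
      have "riem_dist T f (c x) (c y) \<le> riem_dist T f (c x) (c t) + riem_dist T f (c t) (c y)"
        by (rule riem_dist_triangle)
      also have "\<dots> \<le> ereal (K * ((\<sigma> t + e) * (t - x))) + ereal (K * ((\<sigma> t + e) * (y - t)))"
        by (intro add_mono cx cy)
      also have "\<dots> = ereal (K * ((\<sigma> t - e) * (y - x)) + 2 * (K * e) * (y - x))"
        by (simp add: algebra_simps)
      also have "\<dots> \<le> ereal (K * integral {x..y} (g_speed n \<gamma>) + \<epsilon> * (y - x))"
      proof -
        have "2 * (K * e) = \<epsilon>" using K_pos by (simp add: e_def)
        moreover have "K * ((\<sigma> t - e) * (y - x)) \<le> K * integral {x..y} \<sigma>"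
          using low K_pos by simp
        ultimately show ?thesis unfolding I(2)[OF sub'] by simp
      qed
      finally show "g_speed n \<gamma> integrable_on {x..y} \<and>
        riem_dist T f (c x) (c y) \<le> ereal (K * integral {x..y} (g_speed n \<gamma>) + \<epsilon> * (y - x))"
        using I(1)[OF sub'] by blast
    qed
    moreover have "d > 0" using d0 d1 d2 d3 by (simp add: d_def)
    ultimately show "\<exists>d>0. \<forall>x y. x \<le> t \<and> t \<le> y \<and> y - x < d \<longrightarrow> P x y" by blast
  qed
  then show ?thesis using uv unfolding P_def by simp
qed

text \<open>Since \<open>\<nu>\<close> is a homeomorphism onto its image, curves in the image are images of continuous curves in \<open>M\<close>,
  piece by piece.\<close>

theorem riem_dist_le_induced_dist:
  assumes p: "p \<in> topspace T" and q: "q \<in> topspace T"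
    and C: "induced_dist n (\<nu> ` topspace T) (\<nu> p) (\<nu> q) \<le> ereal C"
  shows "riem_dist T f p q \<le> ereal (K * (C + 1) + 1)"
proof -
  have "induced_dist n (\<nu> ` topspace T) (\<nu> p) (\<nu> q) < ereal (C + 1)"
    using C by (rule order_le_less_trans) simp
  then obtain \<gamma> where \<gamma>: "pw_smooth_grassmannian_curve n \<gamma>" "\<gamma> ` {0..1} \<subseteq> \<nu> ` topspace T" "\<gamma> 0 = \<nu> p" "\<gamma> 1 = \<nu> q"
    "g_length n \<gamma> < C + 1"
    unfolding induced_dist_def INF_less_iff by auto
  have "homeomorphic_map T (subtopology (grassmannian_topology n) (\<nu> ` topspace T)) \<nu>"
    using emb unfolding smooth_grassmannian_embedding_def embedding_map_def by blast
  then obtain h where h: "homeomorphic_maps T (subtopology (grassmannian_topology n) (\<nu> ` topspace T)) \<nu> h"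
    by (meson homeomorphic_map_maps)
  have hc: "continuous_map (subtopology (grassmannian_topology n) (\<nu> ` topspace T)) T h"
    and h\<nu>: "\<And>x. x \<in> topspace T \<Longrightarrow> h (\<nu> x) = x"
    using h by (auto simp: homeomorphic_maps_def)
  define c where "c = h \<circ> \<gamma>"
  have "g_speed n \<gamma> integrable_on {0..1} \<and>
    riem_dist T f (c 0) (c 1) \<le> ereal (K * integral {0..1} (g_speed n \<gamma>) + 1 * (1 - 0))"
  proof (rule subdivided_interval_induct[where u = 0 and v = 1 and P = "\<lambda>u v. g_speed n \<gamma> integrable_on {u..v} \<and>
      riem_dist T f (c u) (c v) \<le> ereal (K * integral {u..v} (g_speed n \<gamma>) + 1 * (v - u))",
      OF \<gamma>(1)[unfolded pw_smooth_grassmannian_curve_def]])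
    fix a b u v :: real
    assume *: "smooth_grassmannian_map n (top_of_set {a..b}) id \<gamma>" "0 \<le> a" "b \<le> 1" "a < b" "a \<le> u" "u \<le> v" "v \<le> b"
    have img: "\<gamma> ` {a..b} \<subseteq> \<nu> ` topspace T" using \<gamma>(2) *(2,3) by (auto simp: image_subset_iff)
    have "continuous_map (top_of_set {a..b}) (subtopology (grassmannian_topology n) (\<nu> ` topspace T)) \<gamma>"
      using smooth_grassmannian_map_continuous[OF *(1)] img by (simp add: continuous_map_in_subtopology image_subset_iff_funcset)
    then have "continuous_map (top_of_set {a..b}) T c"
      unfolding c_def using hc by (rule continuous_map_compose)
    moreover have "\<gamma> s = \<nu> (c s)" if "s \<in> {a..b}" for s
    proof -
      have "\<gamma> s \<in> \<nu> ` topspace T" using img that by (rule subsetD[OF _ imageI])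
      then obtain x where "x \<in> topspace T" "\<gamma> s = \<nu> x" by (elim imageE)
      then show ?thesis by (simp add: c_def h\<nu>)
    qed
    ultimately show "g_speed n \<gamma> integrable_on {u..v} \<and>
        riem_dist T f (c u) (c v) \<le> ereal (K * integral {u..v} (g_speed n \<gamma>) + 1 * (v - u))"
      by (intro riem_dist_le_g_length_piece[OF *(1,4)]) (use * in auto)
  next
    fix x y z :: real
    assume *: "x \<le> y" "y \<le> z" and
      1: "g_speed n \<gamma> integrable_on {x..y} \<and> riem_dist T f (c x) (c y) \<le> ereal (K * integral {x..y} (g_speed n \<gamma>) + 1 * (y - x))" and
      2: "g_speed n \<gamma> integrable_on {y..z} \<and> riem_dist T f (c y) (c z) \<le> ereal (K * integral {y..z} (g_speed n \<gamma>) + 1 * (z - y))"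
    have I: "g_speed n \<gamma> integrable_on {x..z}"
      by (rule Henstock_Kurzweil_Integration.integrable_combine[OF * conjunct1[OF 1] conjunct1[OF 2]])
    have int: "integral {x..z} (g_speed n \<gamma>) = integral {x..y} (g_speed n \<gamma>) + integral {y..z} (g_speed n \<gamma>)"
      using Henstock_Kurzweil_Integration.integral_combine[OF * I] by simp
    have "riem_dist T f (c x) (c z) \<le> riem_dist T f (c x) (c y) + riem_dist T f (c y) (c z)"
      by (rule riem_dist_triangle)
    also have "\<dots> \<le> ereal (K * integral {x..y} (g_speed n \<gamma>) + 1 * (y - x)) + ereal (K * integral {y..z} (g_speed n \<gamma>) + 1 * (z - y))"
      using 1 2 by (intro add_mono) auto
    also have "\<dots> = ereal (K * integral {x..z} (g_speed n \<gamma>) + 1 * (z - x))"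
      unfolding int by (simp add: algebra_simps)
    finally show "g_speed n \<gamma> integrable_on {x..z} \<and>
        riem_dist T f (c x) (c z) \<le> ereal (K * integral {x..z} (g_speed n \<gamma>) + 1 * (z - x))" using I by blast
  qed auto
  then have "riem_dist T f p q \<le> ereal (K * g_length n \<gamma> + 1)"
    using \<gamma>(3,4) h\<nu> p q by (simp add: c_def g_length_def)
  also have "\<dots> \<le> ereal (K * (C + 1) + 1)" using \<gamma>(5) K_pos by simp
  finally show ?thesis .
qed

end

section \<open>The compact case\<close>

lemma has_tangential_derivative_near:
  assumes imm: "immersed_submanifold m T f" and h: "has_tangential_derivative T f h h' p"
    and p: "p \<in> topspace T" and e: "e > 0"
  shows "\<exists>G. openin T G \<and> p \<in> G \<and> (\<forall>q\<in>G. norm (h q - h p) < e)"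
proof -
  obtain U W V0 L \<phi> \<psi> g where lp: "local_param m T f U W V0 L \<phi> \<psi> g" "p \<in> U"
    using local_param_exists[OF imm p] by metis
  then have U: "openin T U" "continuous_map (subtopology T U) euclidean f" by (auto simp: local_param_def)
  have ts: "topspace (subtopology T U) = U" using openin_subset[OF U(1)] by auto
  obtain A H where H: "openin T A" "p \<in> A" "\<forall>q\<in>A. h q = H (f q)" "(H has_derivative h') (at (f p))"
    using h unfolding has_tangential_derivative_def by blast
  have "isCont H (f p)" using has_derivative_continuous[OF H(4)] by simp
  then obtain d where d: "d > 0" "\<And>y. dist y (f p) < d \<Longrightarrow> dist (H y) (H (f p)) < e"
    using e unfolding continuous_at_eps_delta by blast
  have "openin (subtopology T U) {q \<in> U. f q \<in> ball (f p) d}"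
    using openin_continuous_map_preimage[OF U(2), of "ball (f p) d"] unfolding ts by simp
  then have "openin T {q \<in> U. f q \<in> ball (f p) d}" using U(1) openin_trans_full by blast
  then show ?thesis
    using H(1-3) d lp(2) by (intro exI[of _ "A \<inter> {q \<in> U. f q \<in> ball (f p) d}"]) (auto simp: dist_norm norm_minus_commute)
qed

context adapted_frame
begin

lemma continuous_on_S:
  assumes p: "p \<in> O'"
  shows "continuous_on (TS p) (S p)"
proof -
  have "continuous_on (TS p) (\<lambda>v. D (\<lambda>q. V q j) p v)" if j: "j < n" for j
  proof -
    obtain V' where V': "has_tangential_derivative T f (\<lambda>q. V q j) V' p" "\<And>v. v \<in> TS p \<Longrightarrow> D (\<lambda>q. V q j) p v = V' v"
      using V_derivative[OF p j] by metis
    have "continuous_on (TS p) V'"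
      using has_tangential_derivative_linear[OF V'(1)] linear_continuous_on linear_conv_bounded_linear by blast
    then show ?thesis by (rule continuous_on_eq) (simp add: V'(2))
  qed
  then show ?thesis unfolding S_def[abs_def] by (intro continuous_intros) auto
qed

lemma S_min:
  assumes p: "p \<in> O'" and pos: "\<And>v. v \<in> TS p \<Longrightarrow> v \<noteq> 0 \<Longrightarrow> S p v > 0"
  obtains \<mu> where "\<mu> > 0" "\<And>v. v \<in> TS p \<Longrightarrow> norm v = 1 \<Longrightarrow> \<mu> \<le> sqrt (S p v)"
proof (cases "sphere 0 1 \<inter> TS p = {}")
  case True
  show thesis
  proof (rule that[of 1])
    fix v assume "v \<in> TS p" "norm v = 1"
    then have "v \<in> sphere 0 1 \<inter> TS p" by simp
    then show "1 \<le> sqrt (S p v)" using True by simp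
  qed simp
next
  case False
  have "compact (sphere 0 1 \<inter> TS p)"
    by (intro compact_Int_closed compact_sphere closed_subspace subspace_TS p)
  moreover have "continuous_on (sphere 0 1 \<inter> TS p) (\<lambda>v. sqrt (S p v))"
    by (intro continuous_intros continuous_on_subset[OF continuous_on_S[OF p]]) auto
  ultimately obtain v0 where v0: "v0 \<in> sphere 0 1 \<inter> TS p" "\<forall>v\<in>sphere 0 1 \<inter> TS p. sqrt (S p v0) \<le> sqrt (S p v)"
    using continuous_attains_inf[of "sphere 0 1 \<inter> TS p" "\<lambda>v. sqrt (S p v)"] False by blast
  show thesis
  proof (rule that)
    have "v0 \<noteq> 0" using v0(1) by auto
    then show "sqrt (S p v0) > 0" using pos[of v0] v0(1) by simp
    show "sqrt (S p v0) \<le> sqrt (S p v)" if "v \<in> TS p" "norm v = 1" for v using v0(2) that by auto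
  qed
qed

text \<open>In the frames at \<open>p\<close> and \<open>q\<close>, unit tangent vectors correspond by equal coordinates, and the
  coefficients of \<open>D V\<^sub>j\<close> vary continuously with \<open>q\<close>. So the positive minimum over the compact unit sphere
  of the tangent space at \<open>p\<close> persists nearby.\<close>

lemma S_locally_bounded_below:
  assumes p: "p \<in> O'" and pos: "\<And>v. v \<in> TS p \<Longrightarrow> v \<noteq> 0 \<Longrightarrow> S p v > 0"
  obtains G r where "r > 0" "openin T G" "p \<in> G" "G \<subseteq> O'"
    "\<And>q X. q \<in> G \<Longrightarrow> X \<in> TS q \<Longrightarrow> norm X = 1 \<Longrightarrow> r \<le> S q X"
proof -
  obtain \<mu> where \<mu>: "\<mu> > 0" "\<And>v. v \<in> TS p \<Longrightarrow> norm v = 1 \<Longrightarrow> \<mu> \<le> sqrt (S p v)"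
    using S_min[OF p pos] by metis
  define k where "k = real n * real m * real m"
  \<comment> \<open>There are \<open>k\<close> coefficients, so errors \<open>\<eta>\<close> in each of them reduce the minimum \<open>\<mu>\<close> to \<open>\<mu>/2\<close> at worst.\<close>
  define \<eta> where "\<eta> = \<mu> / (2 * (k + 1))"
  have k: "k \<ge> 0" by (simp add: k_def)
  then have \<eta>: "\<eta> > 0" using \<mu>(1) by (simp add: \<eta>_def)
  define M where "M q = (\<lambda>(j, a, b). D (\<lambda>q. V q j) q (E q b) \<bullet> E q a)" for q
  define I where "I = {..<n} \<times> {..<m} \<times> {..<m}"
  have "\<exists>G. openin T G \<and> p \<in> G \<and> (\<forall>q\<in>G. norm (M q i - M p i) < \<eta>)" if iI: "i \<in> I" for i
  proof -
    obtain j a b where i: "i = (j, a, b)" "j < n" "a < m" "b < m" using iI by (auto simp: I_def)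
    obtain Eb where Eb: "has_tangential_derivative T f (\<lambda>q. E q b) Eb p"
      using smooth_map_has_tangential_derivative[OF smE[OF i(4)] op p] by metis
    obtain Ea where Ea: "has_tangential_derivative T f (\<lambda>q. E q a) Ea p"
      using smooth_map_has_tangential_derivative[OF smE[OF i(3)] op p] by metis
    obtain V' V2 where "\<And>Y Y' U'. has_tangential_derivative T f Y Y' p \<Longrightarrow> openin T U' \<Longrightarrow> p \<in> U' \<Longrightarrow>
       (\<And>q. q \<in> U' \<Longrightarrow> Y q \<in> TS q) \<Longrightarrow>
       has_tangential_derivative T f (\<lambda>q. D (\<lambda>q. V q j) q (Y q)) (\<lambda>v. V2 v (Y p) + V' (Y' v)) p"
      by (rule dir_deriv_field_has_tangential_derivative[OF smV[OF i(2)] op p]) blast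
    from this[OF Eb op p E_TS[OF _ i(4)]]
    have "has_tangential_derivative T f (\<lambda>q. D (\<lambda>q. V q j) q (E q b)) (\<lambda>v. V2 v (E p b) + V' (Eb v)) p" by simp
    from has_tangential_derivative_near[OF imm has_tangential_derivative_bilinear[OF bounded_bilinear_inner this Ea] O'_top[OF p] \<eta>]
    show ?thesis by (simp add: M_def i(1))
  qed
  moreover have "finite I" by (simp add: I_def)
  ultimately have "\<exists>G. openin T G \<and> p \<in> G \<and> (\<forall>q\<in>G. \<forall>i\<in>I. norm (M q i - M p i) < \<eta>)"
    by (intro finite_common_nhd[where P = "\<lambda>i q. norm (M q i - M p i) < \<eta>"] O'_top[OF p])
  then obtain G0 where G0: "openin T G0" "p \<in> G0" "\<forall>q\<in>G0. \<forall>i\<in>I. norm (M q i - M p i) < \<eta>"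
    by (elim exE conjE) (rule that; assumption)
  show thesis
  proof (rule that)
    show "(\<mu> / 2)\<^sup>2 > 0" using \<mu>(1) by simp
    show "openin T (G0 \<inter> O')" "p \<in> G0 \<inter> O'" "G0 \<inter> O' \<subseteq> O'" using G0 op p by auto
    fix q X assume q: "q \<in> G0 \<inter> O'" and X: "X \<in> TS q" "norm X = 1"
    have qO: "q \<in> O'" using q by simp
    define x where "x b = X \<bullet> E q b" for b
    have XE: "X = (\<Sum>b<m. x b *\<^sub>R E q b)"
      using stiefel_span_representation[OF E[OF qO]] X(1) tangent[OF qO] by (simp add: x_def)
    have x1: "(\<Sum>b<m. (x b)\<^sup>2) = 1"
      using stiefel_span_norm[OF E[OF qO], of X] X tangent[OF qO] by (simp add: x_def)
    have xle: "\<bar>x b\<bar> \<le> 1" if "b < m" for b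
    proof -
      have "(x b)\<^sup>2 \<le> (\<Sum>b<m. (x b)\<^sup>2)" using that by (intro member_le_sum) auto
      then show ?thesis using x1 by (simp add: abs_square_le_1)
    qed
    define v where "v = (\<Sum>b<m. x b *\<^sub>R E p b)"
    have vTS: "v \<in> TS p" unfolding v_def by (intro subspace_sum subspace_TS p subspace_scale E_TS) auto
    have "(norm v)\<^sup>2 = (\<Sum>b<m. (v \<bullet> E p b)\<^sup>2)"
      using stiefel_span_norm[OF E[OF p], of v] vTS tangent[OF p] by simp
    also have "\<dots> = 1" unfolding x1[symmetric]
      by (rule sum.cong[OF refl]) (use stiefel_inner_sum[OF E[OF p]] in \<open>simp add: v_def\<close>)
    finally have v1: "norm v = 1" by (simp add: power2_eq_1_iff) (use norm_ge_zero[of v] in linarith)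
    have lin: "D (\<lambda>q. V q j) r (\<Sum>b<m. x b *\<^sub>R E r b) \<bullet> E r a = (\<Sum>b<m. x b * M r (j, a, b))"
      if r: "r \<in> O'" and j: "j < n" for r j a
    proof -
      obtain V' where V': "has_tangential_derivative T f (\<lambda>q. V q j) V' r" "\<And>v. v \<in> TS r \<Longrightarrow> D (\<lambda>q. V q j) r v = V' v"
        using V_derivative[OF r j] by metis
      have "(\<Sum>b<m. x b *\<^sub>R E r b) \<in> TS r" by (intro subspace_sum subspace_TS r subspace_scale E_TS) auto
      then have "D (\<lambda>q. V q j) r (\<Sum>b<m. x b *\<^sub>R E r b) = (\<Sum>b<m. x b *\<^sub>R V' (E r b))"
        using V'(2) has_tangential_derivative_linear[OF V'(1)] by (simp add: linear_sum linear_scale)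
      also have "\<dots> = (\<Sum>b<m. x b *\<^sub>R D (\<lambda>q. V q j) r (E r b))"
        by (rule sum.cong[OF refl]) (simp add: V'(2) E_TS[OF r])
      finally show ?thesis by (simp add: M_def inner_sum_left)
    qed
    define J where "J = {..<n} \<times> {..<m}"
    define F where "F r y = (\<lambda>(j, a). D (\<lambda>q. V q j) r y \<bullet> E r a)" for r y
    have SF: "sqrt (S r y) = L2_set (F r y) J" for r y
      unfolding S_def L2_set_def J_def F_def by (simp add: sum.cartesian_product case_prod_unfold)
    have diff: "\<bar>F p v i - F q X i\<bar> \<le> real m * \<eta>" if i: "i \<in> J" for i
    proof -
      obtain j a where ja: "i = (j, a)" "j < n" "a < m" using i by (auto simp: J_def)
      have "F p v i - F q X i = (\<Sum>b<m. x b * (M p (j, a, b) - M q (j, a, b)))"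
        using lin[OF p ja(2)] lin[OF qO ja(2)]
        by (simp add: F_def ja(1) v_def XE[symmetric] sum_subtractf right_diff_distrib)
      also have "\<bar>\<dots>\<bar> \<le> (\<Sum>b<m. \<eta>)"
      proof (rule order_trans[OF sum_abs sum_mono])
        fix b assume b: "b \<in> {..<m}"
        have "\<bar>M p (j, a, b) - M q (j, a, b)\<bar> \<le> \<eta>"
          using G0(3) q ja b by (force simp: I_def abs_minus_commute)
        then show "\<bar>x b * (M p (j, a, b) - M q (j, a, b))\<bar> \<le> \<eta>"
          using mult_mono[OF xle[of b]] b by (fastforce simp: abs_mult)
      qed
      also have "\<dots> = real m * \<eta>" by simp
      finally show ?thesis .
    qed
    have "\<mu> \<le> sqrt (S p v)" by (rule \<mu>(2)[OF vTS v1])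
    also have "\<dots> = L2_set (\<lambda>i. F q X i + (F p v i - F q X i)) J" by (simp add: SF)
    also have "\<dots> \<le> L2_set (F q X) J + L2_set (\<lambda>i. F p v i - F q X i) J" by (rule L2_set_triangle_ineq)
    also have "L2_set (\<lambda>i. F p v i - F q X i) J \<le> (\<Sum>i\<in>J. \<bar>F p v i - F q X i\<bar>)" by (rule L2_set_le_sum_abs)
    also have "\<dots> \<le> (\<Sum>i\<in>J. real m * \<eta>)" by (intro sum_mono diff)
    also have "\<dots> = k * \<eta>" by (simp add: J_def k_def)
    also have "k * \<eta> \<le> \<mu> / 2"
      using k \<mu>(1) by (simp add: \<eta>_def field_simps)
    finally have "\<mu> / 2 \<le> sqrt (S q X)" by (simp add: SF)
    then show "(\<mu> / 2)\<^sup>2 \<le> S q X" using \<mu>(1) by (simp add: real_le_rsqrt sqrt_ge_absD)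
  qed
qed

end

section \<open>Ricci curvature and compactness\<close>

text \<open>Finitely many of the neighbourhoods with a local gap cover \<open>M\<close>.\<close>

lemma compact_imp_ricci_gap:
  fixes f :: "'a \<Rightarrow> 'e::euclidean_space"
  assumes compact: "compact_space T" and minimal: "minimal_in_sphere m T f"
    and emb: "smooth_grassmannian_embedding n T f \<nu>"
    and frames: "\<And>p. p \<in> topspace T \<Longrightarrow>
      \<exists>O' E V. adapted_frame m n T f O' E V \<and> p \<in> O' \<and> (\<forall>q\<in>O'. V q \<in> \<nu> q)"
  obtains r where "r > 0" "\<And>p X. p \<in> topspace T \<Longrightarrow> X \<in> tangent_space T f p \<Longrightarrow> norm X = 1 \<Longrightarrow>
    ricci m T f p X X \<le> real m - 1 - r"
proof -
  have "\<exists>G r. r > 0 \<and> openin T G \<and> p \<in> G \<and>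
      (\<forall>q\<in>G. \<forall>X\<in>tangent_space T f q. norm X = 1 \<longrightarrow> ricci m T f q X X \<le> real m - 1 - r)" if p: "p \<in> topspace T" for p
  proof -
    obtain O' E V where af: "adapted_frame m n T f O' E V" "p \<in> O'" "\<forall>q\<in>O'. V q \<in> \<nu> q"
      using frames[OF p] by blast
    interpret adapted_frame m n T f O' E V by (rule af(1))
    have pos: "S p v > 0" if "v \<in> TS p" "v \<noteq> 0" for v
      by (rule immersion_imp_S_pos[OF af(2) that emb]) (use af(3) in blast)
    obtain G r where G: "r > 0" "openin T G" "p \<in> G" "G \<subseteq> O'"
      "\<And>q X. q \<in> G \<Longrightarrow> X \<in> TS q \<Longrightarrow> norm X = 1 \<Longrightarrow> r \<le> S q X"
      by (rule S_locally_bounded_below[OF af(2) pos]) blast+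
    have "ricci m T f q X X \<le> real m - 1 - r" if "q \<in> G" "X \<in> TS q" "norm X = 1" for q X
      using ricci_minimal[OF _ minimal that(2,3)] G(4,5) that by (auto simp: subset_iff)
    then show ?thesis using G(1-3) by blast
  qed
  then obtain G r where Gr: "\<And>p. p \<in> topspace T \<Longrightarrow> r p > 0 \<and> openin T (G p) \<and> p \<in> G p \<and>
      (\<forall>q\<in>G p. \<forall>X\<in>tangent_space T f q. norm X = 1 \<longrightarrow> ricci m T f q X X \<le> real m - 1 - r p)" by metis
  have "\<forall>U\<in>G ` topspace T. openin T U" "topspace T \<subseteq> \<Union>(G ` topspace T)" using Gr by blast+
  then obtain \<F> where "finite \<F>" "\<F> \<subseteq> G ` topspace T" "topspace T \<subseteq> \<Union>\<F>"
    using compact unfolding compact_space_def compactin_def by meson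
  moreover from calculation obtain F where "finite F" "F \<subseteq> topspace T" "\<F> = G ` F"
    using finite_subset_image by meson
  ultimately have F: "finite F" "F \<subseteq> topspace T" "topspace T \<subseteq> \<Union>(G ` F)" by simp_all
  define s where "s = Min (insert 1 (r ` F))"
  have "s \<in> insert 1 (r ` F)" unfolding s_def using F(1) by (intro Min_in) auto
  then have "s > 0" using Gr F(2) by auto
  moreover have "ricci m T f q X X \<le> real m - 1 - s"
    if q: "q \<in> topspace T" "X \<in> tangent_space T f q" "norm X = 1" for q X
  proof -
    obtain p where p: "p \<in> F" "q \<in> G p" using F(3) q(1) by blast
    then have "ricci m T f q X X \<le> real m - 1 - r p" using Gr F(2) q by blast
    moreover have "s \<le> r p" unfolding s_def using F(1) p(1) by (intro Min_le) auto
    ultimately show ?thesis by simp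
  qed
  ultimately show thesis using that by blast
qed

theorem theoremB:
  fixes T :: "'a topology"
    and f :: "'a \<Rightarrow> real ^ 'k"
    and m n :: nat
    and \<tau> :: "'a \<Rightarrow> (nat \<Rightarrow> real ^ 'k) set"
    and \<omega> :: "real ^ 'k \<Rightarrow> (nat \<Rightarrow> real ^ 'k) set"
  assumes "m + n + 1 = CARD('k)"
    and "immersed_submanifold m T f"
    and "f ` topspace T \<subseteq> sphere 0 1"
    and "riem_complete T f"
    and "orientation m T f \<tau>"
    and "minimal_in_sphere m T f"
    and "orientation (CARD('k) - 1) (top_of_set (sphere 0 1)) id \<omega>"
    and "bounded_grassmannian_embedding n T f (second_gauss_map m n f \<tau> \<omega>)"
  shows "(\<forall>p\<in>topspace T. \<forall>X\<in>tangent_space T f p. norm X = 1 \<longrightarrow> ricci m T f p X X < real m - 1) \<and>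
         (compact_space T \<longleftrightarrow>
          (SUP (p, X) \<in> {(p, X). p \<in> topspace T \<and> X \<in> tangent_space T f p \<and> norm X = 1}.
             ereal (ricci m T f p X X)) < ereal (real m - 1))"
proof -
  let ?\<nu> = "second_gauss_map m n f \<tau> \<omega>"
  have emb: "smooth_grassmannian_embedding n T f ?\<nu>"
    using assms(8) by (simp add: bounded_grassmannian_embedding_def)
  then have sm: "smooth_grassmannian_map n T f ?\<nu>" by (simp add: smooth_grassmannian_embedding_def)
  have dim: "m + n + 1 = DIM(real ^ 'k)" using assms(1) by simp
  have frames: "\<exists>O' E V. adapted_frame m n T f O' E V \<and> p \<in> O' \<and> (\<forall>q\<in>O'. V q \<in> ?\<nu> q)" if pT: "p \<in> topspace T" for p
  proof -
    have \<omega>: "orientation (DIM(real ^ 'k) - 1) (top_of_set (sphere 0 1)) id \<omega>" using assms(7) by simp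
    obtain O' E V where "adapted_frame m n T f O' E V" "p \<in> O'" "\<And>q. q \<in> O' \<Longrightarrow> V q \<in> ?\<nu> q"
      by (rule second_gauss_map_adapted_frame[OF dim assms(2,3,5) \<omega> sm pT]) blast
    then show ?thesis by blast
  qed
  have ric: "ricci m T f p X X < real m - 1"
    if p: "p \<in> topspace T" and X: "X \<in> tangent_space T f p" "norm X = 1" for p X
  proof -
    obtain O' E V where af: "adapted_frame m n T f O' E V" "p \<in> O'" "\<forall>q\<in>O'. V q \<in> ?\<nu> q"
      using frames[OF p] by blast
    interpret adapted_frame m n T f O' E V by (rule af(1))
    have "X \<noteq> 0" using X(2) by auto
    then have "S p X > 0" by (rule immersion_imp_S_pos[OF af(2) X(1) _ emb]) (use af(3) in blast)
    then show ?thesis using ricci_minimal[OF af(2) assms(6) X] by simp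
  qed
  let ?R = "{(p, X). p \<in> topspace T \<and> X \<in> tangent_space T f p \<and> norm X = 1}"
  let ?sup = "SUP (p, X) \<in> ?R. ereal (ricci m T f p X X)"
  have "?sup < ereal (real m - 1)" if compact: "compact_space T"
  proof -
    obtain r where r: "r > 0" "\<And>p X. p \<in> topspace T \<Longrightarrow> X \<in> tangent_space T f p \<Longrightarrow> norm X = 1 \<Longrightarrow>
        ricci m T f p X X \<le> real m - 1 - r"
      by (rule compact_imp_ricci_gap[OF compact assms(6) emb frames]) blast+
    have "?sup \<le> ereal (real m - 1 - r)" by (rule SUP_least) (use r(2) in auto)
    also have "\<dots> < ereal (real m - 1)" using r(1) by simp
    finally show ?thesis .
  qed
  moreover have "compact_space T" if sup: "?sup < ereal (real m - 1)"
  proof -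
    obtain z where z: "?sup < ereal z" "z < real m - 1"
      using ereal_dense2[OF sup] by auto
    have ric_z: "ricci m T f p X X \<le> z" if "p \<in> topspace T" "X \<in> tangent_space T f p" "norm X = 1" for p X
    proof -
      have "ereal (ricci m T f p X X) \<le> ?sup" using that by (intro SUP_upper2[of "(p, X)"]) auto
      then have "ereal (ricci m T f p X X) < ereal z" using z(1) by (rule order_le_less_trans)
      then show ?thesis by simp
    qed
    define \<delta> where "\<delta> = sqrt (real m - 1 - z)"
    have \<delta>: "\<delta> > 0" "\<delta>\<^sup>2 = real m - 1 - z" using z(2) by (auto simp: \<delta>_def)
    interpret gauss_expansion m n T f ?\<nu> \<delta> "2 / \<delta>"
    proof (unfold_locales; (fact emb)?)
      show "\<exists>O' E V. adapted_frame m n T f O' E V \<and> p \<in> O' \<and> (\<forall>q\<in>O'. V q \<in> ?\<nu> q)" if "p \<in> topspace T" for p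
        by (rule frames[OF that])
      show "\<delta> > 0" "2 / \<delta> * \<delta> > 1" using \<delta>(1) by auto
      fix O' E V p v assume af: "adapted_frame m n T f O' E V" "p \<in> O'" "v \<in> tangent_space T f p"
      interpret adapted_frame m n T f O' E V by (rule af(1))
      show "\<delta>\<^sup>2 * (norm v)\<^sup>2 \<le> S p v"
      proof (cases "v = 0")
        case True
        then show ?thesis using S_nonneg by simp
      next
        case False
        define X where "X = (1 / norm v) *\<^sub>R v"
        have X: "X \<in> TS p" "norm X = 1" "v = norm v *\<^sub>R X"
          using False subspace_scale[OF subspace_TS[OF af(2)] af(3)] by (auto simp: X_def)
        have "\<delta>\<^sup>2 \<le> S p X"
          using ric_z[OF O'_top[OF af(2)] X(1,2)] ricci_minimal[OF af(2) assms(6) X(1,2)] \<delta>(2) by simp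
        moreover have "S p v = (norm v)\<^sup>2 * S p X"
          using S_scaleR[OF af(2) X(1), of "norm v"] X(3) by simp
        ultimately show ?thesis
          using mult_left_mono[of "\<delta>\<^sup>2" "S p X" "(norm v)\<^sup>2"] by (simp add: mult.commute)
      qed
    qed
    obtain C where C: "\<And>P Q. P \<in> ?\<nu> ` topspace T \<Longrightarrow> Q \<in> ?\<nu> ` topspace T \<Longrightarrow>
        induced_dist n (?\<nu> ` topspace T) P Q \<le> ereal C"
      using assms(8) unfolding bounded_grassmannian_embedding_def by blast
    show ?thesis
    proof (rule bounded_complete_imp_compact_space[OF assms(2,4)])
      fix p q assume pq: "p \<in> topspace T" "q \<in> topspace T"
      show "riem_dist T f p q \<le> ereal (2 / \<delta> * (C + 1) + 1)"
        by (rule riem_dist_le_induced_dist[OF pq C]) (use pq in auto)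
    qed
  qed
  ultimately show ?thesis using ric by blast
qed

end
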